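(* Let $\alpha \in \mathbb R_+ \setminus \mathbb N$, $a \in \mathbb R$, $T > 0$, and $y \in C^{\lceil \alpha \rceil+1}[a, a+T]$. Let $N \in \mathbb N$, $h = T/N$, and $t_n = a + nh$ for $n = 0, 1, \ldots, N$ (uniform grid). For $K \in \mathbb N$, let the approximations $\hat\phi_{k,K,n}$ be computed with the backward Euler method as described in the context, and let \[ R_{\alpha,K,n}(y) = D_a^\alpha y(t_n) - \sum_{k=1}^K a_{k,K}^{\mathrm{GLa}} \hat\phi_{k,K,n}. \] Then, for all $p > 0$, \[ \max_{n = 1, 2, \ldots, N} |R_{\alpha, K, n}(y)| = O(K^{-p}) + O\left( h \cdot \exp\left( \frac{1 + q_{\mathrm D}}{1 - q_{\mathrm D}} (4K+2) \right) \right) \] as $K \to \infty$ and/or $N \to \infty$.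
   Context: Notation: $m = \lceil \alpha \rceil$, and $q_{\mathrm D} = \alpha - \lceil \alpha \rceil + 1 \in (0,1)$. The Caputo derivative of order $\alpha$ with starting point $a$ is $D_a^\alpha y(t) = \frac{1}{\Gamma(m-\alpha)} \int_a^t (t-\tau)^{m-\alpha-1} y^{(m)}(\tau)\, \mathrm d\tau$. For $w \in \mathbb R$ and $t \in [a,a+T]$ let $\phi_{\mathrm D}(w,t)$ be the solution (in $t$) of the initial value problem \[ \frac{\partial \phi_{\mathrm D}}{\partial t}(w,t) = -\mathrm e^w \phi_{\mathrm D}(w,t) + (-1)^{\lfloor \alpha \rfloor} \frac{\sin \alpha\pi}{\pi} \mathrm e^{w q_{\mathrm D}} y^{(\lceil\alpha\rceil)}(t), \qquad \phi_{\mathrm D}(w,a) = 0, \] i.e. $\phi_{\mathrm D}(w,t) = (-1)^{\lfloor \alpha \rfloor} \frac{\sin \alpha\pi}{\pi} \mathrm e^{w q_{\mathrm D}} \int_a^t y^{(\lceil\alpha\rceil)}(\tau) \exp(-(t-\tau)\mathrm e^w)\,\mathrm d\tau$. Let $x_{k,K}^{\mathrm{GLa}}$ (ordered increasingly, $k=1,\dots,K$) and $a_{k,K}^{\mathrm{GLa}}$ be the nodes and weights of the $K$-point Gauss–Laguerre quadrature formula (Gaussian quadrature for the weight $\mathrm e^{-w}$ on $[0,\infty)$). Backward Euler: for each fixed $w$, set $\phi_{\mathrm D,0}(w) = 0$ and for $n \ge 1$ let $\phi_{\mathrm D,n}(w)$ solve $\phi_{\mathrm D,n}(w) = \phi_{\mathrm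 D,n-1}(w) + h\big(-\mathrm e^w \phi_{\mathrm D,n}(w) + (-1)^{\lfloor \alpha \rfloor} \frac{\sin \alpha\pi}{\pi} \mathrm e^{w q_{\mathrm D}} y^{(\lceil\alpha\rceil)}(t_n)\big)$. Then \[ \hat\phi_{k,K,n} = \mathrm e^{x_{k,K}^{\mathrm{GLa}}} \left( \frac{1}{q_{\mathrm D}} \phi_{\mathrm D,n}\big(-x_{k,K}^{\mathrm{GLa}}/q_{\mathrm D}\big) + \frac{1}{1-q_{\mathrm D}} \phi_{\mathrm D,n}\big(x_{k,K}^{\mathrm{GLa}}/(1-q_{\mathrm D})\big) \right). \] *)

theory Defs
  imports "HOL-Analysis.Analysis"
begin

definition ordm :: "real \<Rightarrow> nat" where
  "ordm \<alpha> = nat \<lceil>\<alpha>\<rceil>"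

definition qD :: "real \<Rightarrow> real" where
  "qD \<alpha> = \<alpha> - of_int \<lceil>\<alpha>\<rceil> + 1"

text \<open>Caputo derivative of order alpha with starting point a.  The function y is given
  through the family Y of its derivatives (Y j = y^(j)).\<close>
definition caputo :: "real \<Rightarrow> real \<Rightarrow> (nat \<Rightarrow> real \<Rightarrow> real) \<Rightarrow> real \<Rightarrow> real" where
  "caputo \<alpha> a Y t = 1 / Gamma (real (ordm \<alpha>) - \<alpha>) *
     integral {a..t} (\<lambda>\<tau>. (t - \<tau>) powr (real (ordm \<alpha>) - \<alpha> - 1) * Y (ordm \<alpha>) \<tau>)"

definition cD :: "real \<Rightarrow> real" where
  "cD \<alpha> = (-1) ^ nat \<lfloor>\<alpha>\<rfloor> * sin (\<alpha> * pi) / pi"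

primrec phiBE :: "real \<Rightarrow> (nat \<Rightarrow> real \<Rightarrow> real) \<Rightarrow> real \<Rightarrow> real \<Rightarrow> nat \<Rightarrow> real \<Rightarrow> real" where
  "phiBE \<alpha> Y a h 0 w = 0"
| "phiBE \<alpha> Y a h (Suc n) w =
     (THE z. z = phiBE \<alpha> Y a h n w +
        h * (- exp w * z + cD \<alpha> * exp (w * qD \<alpha>) * Y (ordm \<alpha>) (a + real (Suc n) * h)))"

definition phi_hat :: "real \<Rightarrow> (nat \<Rightarrow> real \<Rightarrow> real) \<Rightarrow> real \<Rightarrow> real \<Rightarrow> nat \<Rightarrow> real \<Rightarrow> real" where
  "phi_hat \<alpha> Y a h n x = exp x *
     (1 / qD \<alpha> * phiBE \<alpha> Y a h n (- x / qD \<alpha>)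
      + 1 / (1 - qD \<alpha>) * phiBE \<alpha> Y a h n (x / (1 - qD \<alpha>)))"

text \<open>(x, w) are nodes x_1 < ... < x_K and weights of the K-point Gauss--Laguerre formula,
  i.e. the K-point Gaussian quadrature rule for the weight exp(-w) on [0,infinity):
  exact for all polynomials of degree at most 2K-1 (it suffices to test monomials).
  This rule is unique.\<close>
definition gauss_laguerre :: "nat \<Rightarrow> (nat \<Rightarrow> real) \<Rightarrow> (nat \<Rightarrow> real) \<Rightarrow> bool" where
  "gauss_laguerre K x w \<longleftrightarrow>
     strict_mono_on {1..K} x \<and>
     (\<forall>j < 2 * K. ((\<lambda>s. s ^ j * exp (- s)) has_integral (\<Sum>k=1..K. w k * x k ^ j)) {0..})"

end

theory Submission
  imports Defs "HOL-Probability.Distributions" "HOL-Real_Asymp.Real_Asymp"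
begin

text \<open>
  By linearity in \<open>u = y\<^sup>(\<^sup>m\<^sup>)\<close>, written through \<open>u a\<close> and \<open>u'\<close>, the quadrature error with exact
  \<open>\<phi>\<close> is a superposition of the errors for \<open>u = 1\<close>, where the transformed integrand is an elementary
  function of \<open>exp (- x / q)\<close> and \<open>exp (x / (1 - q))\<close> with all derivatives bounded uniformly in time.

  For a smooth \<open>f\<close> with bounded derivatives, repeated integration by parts against the Laguerre
  differential operator shows that the Laguerre coefficients decay faster than any power. As
  \<open>\<bar>L\<^sub>n(x)\<bar> \<le> 2 (n + 1) exp (x / 2)\<close>, the Laguerre series converges pointwise to \<open>f\<close> (by completeness).
  The \<open>K\<close>-point rule is exact on its first \<open>2 K\<close> terms and \<open>\<Sum>\<^sub>k w\<^sub>k exp (x\<^sub>k / 2) \<le> 4 K\<close>, so the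
  quadrature error is \<open>O(K\<^sup>-\<^sup>p)\<close> for every \<open>p\<close>.

  The backward Euler error for the relaxation equation with rate \<open>v = exp w\<close> is at most
  \<open>C h\<close> times the factor \<open>exp (w q)\<close> of the source term, with \<open>C\<close> independent of \<open>v\<close>: the step defects
  caused by the initial layer telescope. The exponential
  factor in the theorem then comes from the nodes, which the three-term recurrence confines to
  \<open>[0, 4 K - 2]\<close>.
\<close>

section \<open>Laguerre polynomials\<close>

text \<open>Why \<open>u a\<close> and \<open>u'\<close>: acting on \<open>u\<close> itself, the
  branch \<open>v = exp (x / (1 - q))\<close> has the kernel
  \<open>v * exp (- \<theta> * v)\<close>, whose supremum over \<open>v\<close> is of order
  \<open>1 / \<theta>\<close>, not integrable at 0. One integration by parts in time turns it into
  \<open>1 - exp (- \<theta> * v)\<close>, which is bounded; the quadrature is then estimated at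
  fixed \<open>\<theta>\<close> and the result integrated against \<open>u'\<close>. The extra
  derivative of \<open>y\<close> is spent here. The estimate is uniform because, up to a prefactor
  \<open>\<theta>\<close> in one branch, \<open>\<theta>\<close> and \<open>x\<close> enter only
  through \<open>r = \<theta> * exp (l * x)\<close>: differentiation in \<open>x\<close> is
  \<open>l\<close> times \<open>r d/dr\<close>, so no bound sees \<open>\<theta>\<close>. The other
  obstacle is stiffness. The rates reach the order of \<open>exp (4 * K / (1 - q))\<close>, so
  \<open>h * v\<close> is not small, and an error bound through the second derivative of the
  solution would cost one more power of \<open>v\<close>. Together with the \<open>exp x\<close> of
  \<open>phi_hat\<close>, the source factor \<open>exp (w * q)\<close> becomes 1 on the branch
  \<open>w = - x / q\<close> and \<open>exp (x / (1 - q))\<close> on the other; only the latter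
  grows with the nodes.\<close>

definition laguerre :: "nat \<Rightarrow> real poly" where
  "laguerre n = (\<Sum>i\<le>n. monom ((-1) ^ i * real (n choose i) / fact i) i)"

lemma coeff_laguerre: "coeff (laguerre n) i = (-1) ^ i * real (n choose i) / fact i"
proof (cases "i \<le> n")
  case True
  then show ?thesis
    unfolding laguerre_def coeff_sum coeff_monom by (subst sum.delta) auto
next
  case False
  then show ?thesis
    unfolding laguerre_def coeff_sum coeff_monom by (subst sum.delta) auto
qed

lemma laguerre_0 [simp]: "laguerre 0 = 1"
  by (simp add: laguerre_def)

lemma degree_laguerre_le: "degree (laguerre n) \<le> n"
  by (rule degree_le) (simp add: coeff_laguerre binomial_eq_0)

lemma poly_laguerre_0 [simp]: "poly (laguerre n) 0 = 1"
  by (simp add: poly_0_coeff_0 coeff_laguerre)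

lemma binomial_Suc_mult: "(real i + 1) * real (n choose Suc i) = (real n - real i) * real (n choose i)"
proof (cases "i \<le> n")
  case True
  have "Suc i * (n choose Suc i) = (n - i) * (n choose i)"
    by (metis binomial_absorb_comp binomial_absorption)
  then have "real (Suc i * (n choose Suc i)) = real ((n - i) * (n choose i))" by simp
  then show ?thesis using True by (simp add: of_nat_diff algebra_simps)
next
  case False
  then show ?thesis by (simp add: binomial_eq_0)
qed

lemma coeff_laguerre_Suc: "(real i + 1)\<^sup>2 * coeff (laguerre n) (Suc i) = (real i - real n) * coeff (laguerre n) i"
proof -
  have "(real i + 1)\<^sup>2 * coeff (laguerre n) (Suc i)
      = - ((-1) ^ i / fact i) * ((real i + 1) * real (n choose Suc i))"
    by (simp add: coeff_laguerre power2_eq_square divide_simps)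
  also have "\<dots> = (real i - real n) * coeff (laguerre n) i"
    unfolding binomial_Suc_mult by (simp add: coeff_laguerre field_simps)
  finally show ?thesis .
qed

text \<open>At \<open>x ^ i\<close> the left side is \<open>(i + 1)^2\<close> times coefficient
  \<open>i + 1\<close> plus \<open>n - i\<close> times coefficient \<open>i\<close>, so the equation
  is \<open>coeff_laguerre_Suc\<close> read for all \<open>i\<close> at once.\<close>

lemma laguerre_ode_poly:
  "pCons 0 (pderiv (pderiv (laguerre n))) + pderiv (laguerre n) - pCons 0 (pderiv (laguerre n)) + smult (real n) (laguerre n) = 0"
proof (rule poly_eqI)
  fix i
  show "coeff (pCons 0 (pderiv (pderiv (laguerre n))) + pderiv (laguerre n) - pCons 0 (pderiv (laguerre n)) + smult (real n) (laguerre n)) i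
      = coeff 0 i"
    using coeff_laguerre_Suc[of i n]
    by (cases i) (auto simp: coeff_pderiv coeff_pCons power2_eq_square algebra_simps)
qed

lemma laguerre_ode:
  "x * poly (pderiv (pderiv (laguerre n))) x + (1 - x) * poly (pderiv (laguerre n)) x + real n * poly (laguerre n) x = 0"
proof -
  have "poly (pCons 0 (pderiv (pderiv (laguerre n))) + pderiv (laguerre n) - pCons 0 (pderiv (laguerre n))
      + smult (real n) (laguerre n)) x = 0"
    unfolding laguerre_ode_poly by simp
  then show ?thesis by (simp add: algebra_simps)
qed

text \<open>Coefficientwise this is absorption combined with Pascal's rule. For \<open>n = 0\<close>
  the truncated index \<open>n - 1 = 0\<close> is harmless, since it carries the factor
  \<open>n\<close>.\<close>

lemma laguerre_rec_poly:
  "pCons 0 (laguerre n) = smult (2 * real n + 1) (laguerre n) - smult (real n + 1) (laguerre (Suc n)) - smult (real n) (laguerre (n - 1))"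
proof (rule poly_eqI)
  fix i
  show "coeff (pCons 0 (laguerre n)) i
    = coeff (smult (2 * real n + 1) (laguerre n) - smult (real n + 1) (laguerre (Suc n)) - smult (real n) (laguerre (n - 1))) i"
  proof (cases i)
    case 0
    then show ?thesis by (simp add: coeff_laguerre)
  next
    case (Suc j)
    have a: "real n * real (n - 1 choose j) = (real j + 1) * real (n choose Suc j)"
      by (metis add.commute binomial_absorption mult.commute of_nat_Suc of_nat_mult)
    have b: "real n * real (n choose Suc j) = real n * (real (n - 1 choose Suc j) + real (n - 1 choose j))"
      by (cases n) auto
    have c: "(real n + 1) * real (Suc n choose Suc j) = (real n + 1) * (real (n choose Suc j) + real (n choose j))"
      by simp
    have d: "(real j + 1) * real (n choose j)
        = - (2 * real n + 1) * real (n choose Suc j)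
          + (real n + 1) * real (Suc n choose Suc j) + real n * real (n - 1 choose Suc j)"
      using a b c binomial_Suc_mult[of j n] by (simp add: algebra_simps)
    have "coeff (pCons 0 (laguerre n)) i = (-1) ^ j * ((real j + 1) * real (n choose j)) / fact (Suc j)"
      by (simp add: Suc coeff_laguerre divide_simps)
    also have "\<dots> = coeff (smult (2 * real n + 1) (laguerre n) - smult (real n + 1) (laguerre (Suc n)) - smult (real n) (laguerre (n - 1))) i"
      unfolding d by (simp add: Suc coeff_laguerre add_divide_distrib diff_divide_distrib algebra_simps
          del: binomial_Suc_Suc fact_Suc)
    finally show ?thesis .
  qed
qed

lemma laguerre_rec:
  "x * poly (laguerre n) x = (2 * real n + 1) * poly (laguerre n) x - (real n + 1) * poly (laguerre (Suc n)) x
     - real n * poly (laguerre (n - 1)) x"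
  using arg_cong[OF laguerre_rec_poly[of n], of "\<lambda>p. poly p x"] by simp

text \<open>The growth of the signed values is what closes the induction: it bounds the subtracted
  term of the recurrence, leaving the factor \<open>x - 3 * (n - 1) - 1\<close>, and this is at
  least \<open>n\<close> exactly when \<open>x \<ge> 4 * n - 2\<close>.\<close>

lemma laguerre_pos_large:
  assumes "4 * real n \<le> x + 2"
  shows "(-1) ^ n * poly (laguerre n) x \<ge> 1 \<and> (n > 0 \<longrightarrow> (-1) ^ n * poly (laguerre n) x \<ge> (-1) ^ (n - 1) * poly (laguerre (n - 1)) x)"
  using assms
proof (induction n)
  case 0
  then show ?case by simp
next
  case (Suc n)
  define p where "p k = (-1) ^ k * poly (laguerre k) x" for k
  have IH: "p n \<ge> 1" "n > 0 \<longrightarrow> p n \<ge> p (n - 1)"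
    using Suc by (auto simp: p_def)
  have r: "(real n + 1) * p (Suc n) = (x - 2 * real n - 1) * p n - real n * p (n - 1)"
  proof -
    have *: "real n * p (n - 1) = - ((-1) ^ n * (real n * poly (laguerre (n - 1)) x))"
      by (cases n) (auto simp: p_def)
    have "(real n + 1) * p (Suc n) = - ((-1) ^ n * ((real n + 1) * poly (laguerre (Suc n)) x))"
      by (simp add: p_def)
    also have "(real n + 1) * poly (laguerre (Suc n)) x
        = (2 * real n + 1 - x) * poly (laguerre n) x - real n * poly (laguerre (n - 1)) x"
      using laguerre_rec[of x n] by (simp add: algebra_simps)
    finally show ?thesis unfolding * by (simp add: p_def algebra_simps)
  qed
  have "real n * p (n - 1) \<le> real n * p n" using IH by (cases n) auto
  then have "(real n + 1) * p (Suc n) \<ge> (x - 3 * real n - 1) * p n" using r by (simp add: algebra_simps)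
  moreover have "(x - 3 * real n - 1) * p n \<ge> (real n + 1) * p n"
    using IH Suc.prems by (intro mult_right_mono) auto
  ultimately have "(real n + 1) * p (Suc n) \<ge> (real n + 1) * p n" by linarith
  then have "p (Suc n) \<ge> p n" by (simp add: mult_le_cancel_left)
  then show ?case using IH by (simp add: p_def)
qed

lemma laguerre_nonzero_large:
  assumes "4 * real n \<le> x + 2" shows "poly (laguerre n) x \<noteq> 0"
  using laguerre_pos_large[OF assms] by auto

section \<open>Comparison of powers and polynomials with exponentials\<close>

lemma power_le_exp: "\<lbrakk>x \<ge> 0; e > 0\<rbrakk> \<Longrightarrow> x ^ m \<le> fact m / e ^ m * exp (e * (x::real))"
proof -
  assume "x \<ge> 0" "e > 0"
  then have "(e * x) ^ m / fact m \<le> exp (e * x)"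
  proof -
    have "(\<Sum>k\<in>{m}. (e * x) ^ k / fact k) \<le> (\<Sum>k. (e * x) ^ k / fact k)"
      using \<open>x \<ge> 0\<close> \<open>e > 0\<close> summable_exp[of "e * x"]
      by (intro sum_le_suminf) (auto simp: divide_inverse mult.commute)
    then show ?thesis by (simp add: exp_def divide_inverse mult.commute)
  qed
  then show ?thesis using \<open>e > 0\<close> by (simp add: field_simps power_mult_distrib)
qed

lemma one_plus_power_le_exp:
  assumes "e > 0"
  obtains C where "C > 0" "\<And>x::real. x \<ge> 0 \<Longrightarrow> (1 + x) ^ m \<le> C * exp (e * x)"
proof -
  have "(1 + x) ^ m \<le> (fact m / e ^ m * exp e) * exp (e * x)" if "x \<ge> 0" for x :: real
    using power_le_exp[of "1 + x" e m] that assms by (simp add: exp_add distrib_left)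
  then show ?thesis using that[of "fact m / e ^ m * exp e"] assms by simp
qed

lemma poly_bound_one_plus_power:
  fixes p :: "real poly"
  obtains C where "C \<ge> 0" "\<And>x. x \<ge> 0 \<Longrightarrow> \<bar>poly p x\<bar> \<le> C * (1 + x) ^ degree p"
proof -
  have "\<bar>poly p x\<bar> \<le> (\<Sum>i\<le>degree p. \<bar>coeff p i\<bar>) * (1 + x) ^ degree p" if "x \<ge> 0" for x
  proof -
    have "\<bar>poly p x\<bar> \<le> (\<Sum>i\<le>degree p. \<bar>coeff p i\<bar> * x ^ i)"
      unfolding poly_altdef using that
      by (intro order.trans[OF sum_abs] sum_mono) (auto simp: abs_mult)
    also have "\<dots> \<le> (\<Sum>i\<le>degree p. \<bar>coeff p i\<bar> * (1 + x) ^ degree p)"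
    proof (intro sum_mono mult_left_mono)
      fix i assume "i \<in> {..degree p}"
      have "x ^ i \<le> (1 + x) ^ i" using that by (intro power_mono) auto
      also have "\<dots> \<le> (1 + x) ^ degree p" using that \<open>i \<in> _\<close> by (intro power_increasing) auto
      finally show "x ^ i \<le> (1 + x) ^ degree p" .
    qed auto
    finally show ?thesis by (simp add: sum_distrib_right)
  qed
  then show ?thesis using that[of "\<Sum>i\<le>degree p. \<bar>coeff p i\<bar>"] by (simp add: sum_nonneg)
qed

lemma poly_bound_exp:
  fixes p :: "real poly" assumes "e > 0"
  obtains C where "C \<ge> 0" "\<And>x. x \<ge> 0 \<Longrightarrow> \<bar>poly p x\<bar> \<le> C * exp (e * x)"
proof -
  obtain C where C: "C \<ge> 0" "\<And>x. x \<ge> 0 \<Longrightarrow> \<bar>poly p x\<bar> \<le> C * (1 + x) ^ degree p"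
    using poly_bound_one_plus_power[of p] by blast
  obtain C' where C': "C' > 0" "\<And>x::real. x \<ge> 0 \<Longrightarrow> (1 + x) ^ degree p \<le> C' * exp (e * x)"
    using one_plus_power_le_exp[OF assms] by blast
  have "\<bar>poly p x\<bar> \<le> C * C' * exp (e * x)" if "x \<ge> 0" for x
    using mult_left_mono[OF C'(2)[OF that] C(1)] C(2)[OF that] by (simp add: mult.assoc)
  then show ?thesis using that[of "C * C'"] C C' by simp
qed

lemma tendsto_zero_of_exp_bound:
  fixes f :: "real \<Rightarrow> real"
  assumes "\<And>x. x \<ge> 0 \<Longrightarrow> \<bar>f x\<bar> \<le> C * exp (e * x)" "e < 1"
  shows "((\<lambda>x. exp (- x) * f x) \<longlongrightarrow> 0) at_top"
proof (rule Lim_null_comparison)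
  show "\<forall>\<^sub>F x in at_top. norm (exp (- x) * f x) \<le> C * exp (- (1 - e) * x)"
    using eventually_ge_at_top[of 0]
  proof eventually_elim
    case (elim x)
    have "norm (exp (- x) * f x) = exp (-x) * \<bar>f x\<bar>" by (simp add: abs_mult)
    also have "\<dots> \<le> exp (-x) * (C * exp (e * x))" using assms(1)[OF elim] by (intro mult_left_mono) auto
    also have "\<dots> = C * exp (- (1 - e) * x)" by (simp add: exp_add[symmetric] algebra_simps)
    finally show ?case .
  qed
  have "((\<lambda>x. exp (- (1 - e) * x)) \<longlongrightarrow> 0) at_top"
    using assms(2) by real_asymp
  then show "((\<lambda>x. C * exp (- (1 - e) * x)) \<longlongrightarrow> 0) at_top"
    by (rule tendsto_mult_right_zero)
qed

text \<open>For \<open>z = exp (- x / 2) L\<^sub>n\<close> the energy \<open>x z'\<^sup>2 + (n + 1 - x / 4) z\<^sup>2\<close> has derivative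
  \<open>- (z' - z / 2)\<^sup>2\<close>; beyond \<open>4 n + 2\<close>, \<open>x z z'\<close> increases to its limit 0, so \<open>z\<^sup>2\<close> decreases.\<close>

lemma laguerre_bound:
  assumes x: "x \<ge> 0"
  shows "\<bar>poly (laguerre n) x\<bar> \<le> 2 * (real n + 1) * exp (x / 2)"
proof -
  define L L1 L2 where "L = poly (laguerre n)" "L1 = poly (pderiv (laguerre n))" "L2 = poly (pderiv (pderiv (laguerre n)))"
  note Ls = L_L1_L2_def
  define z z1 where "z x = exp (- x / 2) * L x" "z1 x = exp (- x / 2) * (L1 x - L x / 2)" for x
  note zs = z_z1_def
  have d: "(L has_real_derivative L1 x) (at x)" "(L1 has_real_derivative L2 x) (at x)" for x
    unfolding Ls by (auto intro: poly_DERIV)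
  have ode: "x * L2 x + (1 - x) * L1 x + real n * L x = 0" for x
    using laguerre_ode[of x n] by (simp add: Ls)
  have dz: "(z has_real_derivative z1 x) (at x)" for x
    unfolding zs by (auto intro!: derivative_eq_intros d simp: algebra_simps)
  define z2 where "z2 x = exp (- x / 2) * (L2 x - L1 x + L x / 4)" for x
  have dz1: "(z1 has_real_derivative z2 x) (at x)" for x
    unfolding zs z2_def by (auto intro!: derivative_eq_intros d simp: field_simps)
  have zode: "x * z2 x + z1 x + (real n + 1/2 - x / 4) * z x = 0" for x
  proof -
    have "x * z2 x + z1 x + (real n + 1/2 - x / 4) * z x
       = exp (-x/2) * (x * L2 x + (1 - x) * L1 x + real n * L x)"
      by (simp add: zs z2_def algebra_simps)
    then show ?thesis by (simp add: ode)
  qed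
  \<comment> \<open>The \<open>n + 1\<close>, in place of the \<open>n + 1/2\<close> of
    \<open>zode\<close>, supplies the cross term that completes the square in the
    derivative.\<close>
  define F where "F x = x * (z1 x)\<^sup>2 + (real n + 1 - x / 4) * (z x)\<^sup>2" for x
  have dF: "(F has_real_derivative - (z1 x - z x / 2)\<^sup>2) (at x)" for x
  proof -
    have "(F has_real_derivative (z1 x)\<^sup>2 + x * (2 * z1 x * z2 x)
        + (- (z x)\<^sup>2 / 4 + (real n + 1 - x / 4) * (2 * z x * z1 x))) (at x)"
      unfolding F_def by (auto intro!: derivative_eq_intros dz dz1 simp: algebra_simps power2_eq_square)
    moreover have "(z1 x)\<^sup>2 + x * (2 * z1 x * z2 x)
        + (- (z x)\<^sup>2 / 4 + (real n + 1 - x / 4) * (2 * z x * z1 x)) = - (z1 x - z x / 2)\<^sup>2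
        + 2 * z1 x * (x * z2 x + z1 x + (real n + 1/2 - x / 4) * z x)"
      by (simp add: algebra_simps power2_eq_square)
    ultimately show ?thesis by (simp add: zode)
  qed
  have F0: "F 0 = real n + 1" by (simp add: F_def zs Ls)
  \<comment> \<open>Up to \<open>4 * n + 2\<close> the coefficient \<open>n + 1 - x / 4\<close> is
    at least 1/2, and \<open>F\<close> starts at \<open>n + 1\<close>. Further out the coefficient
    turns negative, hence the separate argument \<open>large\<close>.\<close>
  have small: "(z x)\<^sup>2 \<le> 2 * (real n + 1)" if "0 \<le> x" "x \<le> 4 * real n + 2" for x
  proof -
    have "F x \<le> F 0"
      by (rule DERIV_nonpos_imp_nonincreasing[OF that(1)]) (use dF in force)
    moreover have "x * (z1 x)\<^sup>2 \<ge> 0" using that by simp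
    ultimately have "(real n + 1 - x / 4) * (z x)\<^sup>2 \<le> real n + 1"
      unfolding F0 by (simp add: F_def)
    moreover have "1/2 * (z x)\<^sup>2 \<le> (real n + 1 - x / 4) * (z x)\<^sup>2"
      using that by (intro mult_right_mono) auto
    ultimately show ?thesis by simp
  qed
  have large: "(z x)\<^sup>2 \<le> 2 * (real n + 1)" if "x > 4 * real n + 2" for x
  proof -
    define W where "W x = x * z x * z1 x" for x
    have dW: "(W has_real_derivative x * (z1 x)\<^sup>2 + (x / 4 - real n - 1/2) * (z x)\<^sup>2) (at x)" for x
    proof -
      have "(W has_real_derivative z x * z1 x + x * (z1 x * z1 x + z x * z2 x)) (at x)"
        unfolding W_def by (auto intro!: derivative_eq_intros dz dz1 simp: algebra_simps)
      moreover have "z x * z1 x + x * (z1 x * z1 x + z x * z2 x)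
         = x * (z1 x)\<^sup>2 + (x / 4 - real n - 1/2) * (z x)\<^sup>2
           + z x * (x * z2 x + z1 x + (real n + 1/2 - x / 4) * z x)"
        by (simp add: algebra_simps power2_eq_square)
      ultimately show ?thesis by (simp add: zode)
    qed
    have mono: "W a \<le> W b" if "4 * real n + 2 \<le> a" "a \<le> b" for a b
      by (rule DERIV_nonneg_imp_nondecreasing[OF that(2)])
         (use that in \<open>auto intro!: exI dW add_nonneg_nonneg mult_nonneg_nonneg\<close>)
    \<comment> \<open>\<open>z\<close> and \<open>z1\<close> contribute \<open>exp (- x / 2)\<close>
      each, so \<open>W\<close> is \<open>exp (- x)\<close> times this polynomial and tends to
      0.\<close>
    define pp where "pp = pCons 0 (laguerre n * (pderiv (laguerre n) - smult (1/2) (laguerre n)))"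
    obtain C where "\<And>x. x \<ge> 0 \<Longrightarrow> \<bar>poly pp x\<bar> \<le> C * exp (1/2 * x)"
      using poly_bound_exp[of "1/2" pp] by auto
    then have "((\<lambda>x. exp (- x) * poly pp x) \<longlongrightarrow> 0) at_top"
      by (rule tendsto_zero_of_exp_bound) auto
    moreover have "exp (- x) * poly pp x = W x" for x
    proof -
      have "exp (-x) = exp (-x/2) * exp (-x/2)" by (simp add: exp_add[symmetric])
      then show ?thesis by (simp add: W_def zs pp_def Ls algebra_simps)
    qed
    ultimately have lim: "(W \<longlongrightarrow> 0) at_top" by simp
    have W0: "W a \<le> 0" if "4 * real n + 2 \<le> a" for a
      by (rule tendsto_lowerbound[OF lim])
         (use eventually_mono[OF eventually_ge_at_top[of a]] mono that in auto)
    have "(z x)\<^sup>2 \<le> (z (4 * real n + 2))\<^sup>2"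
    proof (rule DERIV_nonpos_imp_nonincreasing[where f = "\<lambda>x. (z x)\<^sup>2"])
      fix y assume y: "4 * real n + 2 \<le> y" "y \<le> x"
      have "((\<lambda>x. (z x)\<^sup>2) has_real_derivative 2 * z y * z1 y) (at y)"
        by (auto intro!: derivative_eq_intros dz)
      moreover have "y > 0" using y by linarith
      then have "2 * z y * z1 y \<le> 0"
        using W0[OF y(1)] by (simp add: W_def mult.assoc mult_le_0_iff)
      ultimately show "\<exists>y'. ((\<lambda>x. (z x)\<^sup>2) has_real_derivative y') (at y) \<and> y' \<le> 0" by blast
    qed (use that in auto)
    also have "\<dots> \<le> 2 * (real n + 1)" by (rule small) auto
    finally show ?thesis .
  qed
  have "(z x)\<^sup>2 \<le> 2 * (real n + 1)" using small large x by (cases "x \<le> 4 * real n + 2") auto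
  \<comment> \<open>A square root is given away here; a polynomial factor in \<open>n\<close> costs
    nothing against coefficients of arbitrarily fast decay.\<close>
  also have "\<dots> \<le> (2 * (real n + 1))\<^sup>2" by (intro self_le_power) auto
  finally have "\<bar>z x\<bar> \<le> 2 * (real n + 1)" by (simp add: abs_le_square_iff[symmetric])
  then have "exp (x / 2) * \<bar>z x\<bar> \<le> exp (x / 2) * (2 * (real n + 1))" by (intro mult_left_mono) auto
  moreover have "exp (x / 2) * \<bar>z x\<bar> = \<bar>poly (laguerre n) x\<bar>"
    by (simp add: zs abs_mult mult.assoc[symmetric] exp_add[symmetric] Ls)
  ultimately show ?thesis by (simp only: mult_ac)
qed

section \<open>The weight exp (- x) on the half-line\<close>

text \<open>Living on the whole line with no mass on the negatives, this measure takes total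
  functions as integrands while asking for bounds only on \<open>x \<ge> 0\<close>
  (\<open>AE_exp_weight\<close>).\<close>

definition exp_weight :: "real measure" where
  "exp_weight = density lborel (\<lambda>x. ennreal (indicator {0..} x * exp (- x)))"

lemma sets_exp_weight [simp, measurable_cong]: "sets exp_weight = sets borel"
  by (simp add: exp_weight_def)

lemma space_exp_weight [simp]: "space exp_weight = UNIV"
  by (simp add: exp_weight_def)

lemma AE_exp_weight: "(\<And>x. x \<ge> 0 \<Longrightarrow> P x) \<Longrightarrow> AE x in exp_weight. P x"
  unfolding exp_weight_def by (subst AE_density) (auto intro!: AE_I2 simp: indicator_def split: if_splits)

lemma
  fixes f :: "real \<Rightarrow> real"
  assumes "f \<in> borel_measurable borel"
  shows integrable_exp_weight_iff: "integrable exp_weight f \<longleftrightarrow> set_integrable lborel {0..} (\<lambda>x. exp (- x) * f x)"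
    and integral_exp_weight_eq: "integral\<^sup>L exp_weight f = set_lebesgue_integral lborel {0..} (\<lambda>x. exp (- x) * f x)"
  using assms unfolding exp_weight_def set_integrable_def set_lebesgue_integral_def
  by (auto simp: integrable_density integral_density mult.assoc)

text \<open>For nonnegative integrands a finite limit of the antiderivative already gives
  integrability, so no majorant has to be found.\<close>

lemma
  fixes f F :: "real \<Rightarrow> real"
  assumes [measurable]: "f \<in> borel_measurable borel"
    and F: "\<And>x. x \<ge> 0 \<Longrightarrow> (F has_real_derivative exp (- x) * f x) (at x)"
    and nonneg: "\<And>x. x \<ge> 0 \<Longrightarrow> f x \<ge> 0"
    and lim: "(F \<longlongrightarrow> T) at_top"
  shows integrable_exp_weight_FTC_nonneg: "integrable exp_weight f"
    and integral_exp_weight_FTC_nonneg: "integral\<^sup>L exp_weight f = T - F 0"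
proof -
  have "F 0 \<le> T"
  proof (rule tendsto_lowerbound[OF lim])
    have "F 0 \<le> F x" if "0 \<le> x" for x
      by (rule DERIV_nonneg_imp_nondecreasing[OF that]) (meson F nonneg exp_ge_zero mult_nonneg_nonneg)
    then show "\<forall>\<^sub>F x in at_top. F 0 \<le> F x"
      by (intro eventually_mono[OF eventually_ge_at_top[of 0]])
  qed auto
  have "(\<integral>\<^sup>+x. ennreal (f x) \<partial>exp_weight) = (\<integral>\<^sup>+x. ennreal (exp (- x) * f x) * indicator {0..} x \<partial>lborel)"
  proof -
    have "(\<integral>\<^sup>+x. ennreal (f x) \<partial>exp_weight)
        = (\<integral>\<^sup>+x. ennreal (indicator {0..} x * exp (- x)) * ennreal (f x) \<partial>lborel)"
      unfolding exp_weight_def by (rule nn_integral_density) measurable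
    also have "\<dots> = (\<integral>\<^sup>+x. ennreal (exp (- x) * f x) * indicator {0..} x \<partial>lborel)"
      by (rule nn_integral_cong) (simp add: indicator_def ennreal_mult')
    finally show ?thesis .
  qed
  also have "\<dots> = ennreal (T - F 0)"
    by (rule nn_integral_FTC_atLeast) (use F nonneg lim in auto)
  finally have "integrable exp_weight f \<and> integral\<^sup>L exp_weight f = T - F 0"
    using \<open>F 0 \<le> T\<close> nonneg by (intro iffD1[OF nn_integral_eq_integrable]) (auto intro: AE_exp_weight)
  then show "integrable exp_weight f" "integral\<^sup>L exp_weight f = T - F 0" by auto
qed

lemma
  assumes "e < 1"
  shows integrable_exp_weight_exp: "integrable exp_weight (\<lambda>x. exp (e * x))"
    and integral_exp_weight_exp: "integral\<^sup>L exp_weight (\<lambda>x. exp (e * x)) = 1 / (1 - e)"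
proof -
  let ?F = "\<lambda>x. - exp (- (1 - e) * x) / (1 - e)"
  have F: "(?F has_real_derivative exp (- x) * exp (e * x)) (at x)" for x
  proof -
    have "(?F has_real_derivative - (exp (- (1 - e) * x) * (- (1 - e))) / (1 - e)) (at x)"
      using assms by (auto intro!: derivative_eq_intros)
    moreover have "- (exp (- (1 - e) * x) * (- (1 - e))) / (1 - e) = exp (- x) * exp (e * x)"
    proof -
      have "- (exp (- (1 - e) * x) * (- (1 - e))) / (1 - e) = exp (- (1 - e) * x)"
        by (simp only: mult_minus_right minus_minus) (use assms in simp)
      then show ?thesis by (simp add: exp_add[symmetric] left_diff_distrib)
    qed
    ultimately show ?thesis by simp
  qed
  have "((\<lambda>x. exp (- (1 - e) * x)) \<longlongrightarrow> 0) at_top"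
    using assms by real_asymp
  then have lim: "(?F \<longlongrightarrow> - 0 / (1 - e)) at_top"
    by (intro tendsto_intros) (use assms in auto)
  show "integrable exp_weight (\<lambda>x. exp (e * x))"
    by (rule integrable_exp_weight_FTC_nonneg[OF _ F _ lim]) auto
  show "integral\<^sup>L exp_weight (\<lambda>x. exp (e * x)) = 1 / (1 - e)"
    by (subst integral_exp_weight_FTC_nonneg[OF _ F _ lim]) auto
qed

lemma
  assumes [measurable]: "g \<in> borel_measurable borel"
    and b: "\<And>x. x \<ge> 0 \<Longrightarrow> \<bar>g x\<bar> \<le> C * exp (e * x)" and "e < 1"
  shows integrable_exp_weight_exp_bound: "integrable exp_weight g"
    and integral_exp_weight_exp_bound: "\<bar>integral\<^sup>L exp_weight g\<bar> \<le> C / (1 - e)"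
proof -
  have i: "integrable exp_weight (\<lambda>x. C * exp (e * x))"
    using integrable_exp_weight_exp[OF \<open>e < 1\<close>] by simp
  show gi: "integrable exp_weight g"
    by (rule Bochner_Integration.integrable_bound[OF i])
       (use b in \<open>auto intro!: AE_exp_weight intro: order.trans[OF _ abs_ge_self]\<close>)
  have "\<bar>integral\<^sup>L exp_weight g\<bar> \<le> integral\<^sup>L exp_weight (\<lambda>x. \<bar>g x\<bar>)" by (rule integral_abs_bound)
  also have "\<dots> \<le> integral\<^sup>L exp_weight (\<lambda>x. C * exp (e * x))"
    by (rule integral_mono_AE) (use b gi i in \<open>auto intro!: AE_exp_weight\<close>)
  also have "\<dots> = C / (1 - e)" using integral_exp_weight_exp[OF \<open>e < 1\<close>] by simp
  finally show "\<bar>integral\<^sup>L exp_weight g\<bar> \<le> C / (1 - e)" .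
qed

text \<open>The version for integrands of either sign: integrability is supplied, and the integrals
  over \<open>{0..b}\<close> converge both to the full integral and to the limit of
  \<open>G b - G 0\<close>.\<close>

lemma integral_exp_weight_FTC:
  fixes k G :: "real \<Rightarrow> real"
  assumes k: "integrable exp_weight k" and cont: "continuous_on UNIV k"
    and G: "\<And>x. (G has_real_derivative exp (- x) * k x) (at x)"
    and lim: "(G \<longlongrightarrow> l) at_top"
  shows "integral\<^sup>L exp_weight k = l - G 0"
proof -
  have m: "k \<in> borel_measurable borel" using cont by (rule borel_measurable_continuous_onI)
  have i: "set_integrable lborel {0..} (\<lambda>x. exp (- x) * k x)"
    using k integrable_exp_weight_iff[OF m] by simp
  have "((\<lambda>b. set_lebesgue_integral lborel {0..b} (\<lambda>x. exp (- x) * k x)) \<longlongrightarrow> integral\<^sup>L exp_weight k) at_top"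
    unfolding integral_exp_weight_eq[OF m]
    by (rule tendsto_set_lebesgue_integral_at_top[OF _ i]) auto
  moreover have "\<forall>\<^sub>F b in at_top. set_lebesgue_integral lborel {0..b} (\<lambda>x. exp (- x) * k x) = G b - G 0"
    using eventually_ge_at_top[of 0]
  proof eventually_elim
    case (elim b)
    have "continuous_on {0..b} (\<lambda>x. exp (- x) * k x)"
      by (intro continuous_intros continuous_on_subset[OF cont]) auto
    then have "integral\<^sup>L lborel (\<lambda>x. indicator {0..b} x *\<^sub>R (exp (- x) * k x)) = G b - G 0"
      using elim G
      by (intro integral_FTC_Icc[where F = G])
         (auto simp: has_real_derivative_iff_has_vector_derivative intro: has_vector_derivative_at_within)
    then show ?case by (simp add: set_lebesgue_integral_def)
  qed
  ultimately have "((\<lambda>b. G b - G 0) \<longlongrightarrow> integral\<^sup>L exp_weight k) at_top"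
    by (rule Lim_transform_eventually)
  moreover have "((\<lambda>b. G b - G 0) \<longlongrightarrow> l - G 0) at_top" by (intro tendsto_intros lim)
  ultimately show ?thesis by (rule tendsto_unique[OF trivial_limit_at_top_linorder])
qed

text \<open>Allowing every rate \<open>e > 0\<close> makes the class closed under products (each
  factor takes \<open>e / 2\<close>), which a bound with one fixed rate would not be.\<close>

definition subexp :: "(real \<Rightarrow> real) \<Rightarrow> bool" where
  "subexp f \<longleftrightarrow> (\<forall>e>0. \<exists>C. \<forall>x\<ge>0. \<bar>f x\<bar> \<le> C * exp (e * x))"

lemma subexp_poly: "subexp (poly p)"
  unfolding subexp_def by (meson poly_bound_exp)

lemma subexp_add:
  assumes "subexp f" "subexp g" shows "subexp (\<lambda>x. f x + g x)"
  unfolding subexp_def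
proof safe
  fix e :: real assume "e > 0"
  then obtain C D where "\<forall>x\<ge>0. \<bar>f x\<bar> \<le> C * exp (e * x)" "\<forall>x\<ge>0. \<bar>g x\<bar> \<le> D * exp (e * x)"
    using assms unfolding subexp_def by blast
  then have "\<bar>f x + g x\<bar> \<le> (C + D) * exp (e * x)" if "x \<ge> 0" for x
    using that abs_triangle_ineq[of "f x" "g x"] by (force simp: distrib_right)
  then show "\<exists>C. \<forall>x\<ge>0. \<bar>f x + g x\<bar> \<le> C * exp (e * x)" by blast
qed

lemma subexp_mult:
  assumes "subexp f" "subexp g" shows "subexp (\<lambda>x. f x * g x)"
  unfolding subexp_def
proof safe
  fix e :: real assume "e > 0"
  then obtain C D where CD: "\<forall>x\<ge>0. \<bar>f x\<bar> \<le> C * exp (e/2 * x)" "\<forall>x\<ge>0. \<bar>g x\<bar> \<le> D * exp (e/2 * x)"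
    using assms unfolding subexp_def by (meson half_gt_zero)
  have "\<bar>f x * g x\<bar> \<le> (C * D) * exp (e * x)" if "x \<ge> 0" for x
  proof -
    have "\<bar>f x * g x\<bar> \<le> (C * exp (e/2 * x)) * (D * exp (e/2 * x))"
      unfolding abs_mult using CD that by (intro mult_mono) (auto intro: order.trans[OF abs_ge_zero])
    also have "\<dots> = (C * D) * (exp (e/2 * x) * exp (e/2 * x))" by simp
    also have "exp (e/2 * x) * exp (e/2 * x) = exp (e * x)" by (simp add: exp_add[symmetric])
    finally show ?thesis .
  qed
  then show "\<exists>C. \<forall>x\<ge>0. \<bar>f x * g x\<bar> \<le> C * exp (e * x)" by blast
qed

lemma subexp_const: "subexp (\<lambda>x. c)"
proof -
  have "poly [:c:] = (\<lambda>x. c)" by auto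
  then show ?thesis using subexp_poly[of "[:c:]"] by simp
qed

lemma subexp_id: "subexp (\<lambda>x. x)"
proof -
  have "poly [:0, 1:] = (\<lambda>x::real. x)" by auto
  then show ?thesis using subexp_poly[of "[:0, 1:]"] by simp
qed

lemma subexp_diff: "subexp f \<Longrightarrow> subexp g \<Longrightarrow> subexp (\<lambda>x. f x - g x)"
  using subexp_add[of f "\<lambda>x. -1 * g x"] subexp_mult[OF subexp_const[of "-1"], of g] by simp

lemmas subexp_intros = subexp_poly subexp_add subexp_diff subexp_mult subexp_const subexp_id

lemma integrable_exp_weight_subexp:
  assumes "f \<in> borel_measurable borel" "subexp f"
  shows "integrable exp_weight f"
proof -
  obtain C where "\<forall>x\<ge>0. \<bar>f x\<bar> \<le> C * exp (1/2 * x)"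
    using assms(2) unfolding subexp_def by (auto dest: spec[of _ "1/2"])
  then show ?thesis using assms(1) by (intro integrable_exp_weight_exp_bound[of f C "1/2"]) auto
qed

lemma measurable_poly [measurable]: "poly (p :: real poly) \<in> borel_measurable borel"
  by (intro borel_measurable_continuous_onI continuous_intros)

lemma integrable_exp_weight_poly: "integrable exp_weight (poly p)"
  by (intro integrable_exp_weight_subexp subexp_intros measurable_poly)

text \<open>The generator of the Laguerre semigroup, \<open>x f'' + (1 - x) f'\<close>, is symmetric for the
  weight \<open>exp (- x)\<close>, and the Laguerre polynomials are its eigenfunctions.\<close>

lemma laguerre_green:
  assumes f: "\<And>x. (f has_real_derivative f1 x) (at x)" "\<And>x. (f1 has_real_derivative f2 x) (at x)"
    and f2: "continuous_on UNIV f2"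
    and sub: "subexp f" "subexp f1" "subexp f2"
  shows "real n * (\<integral>x. f x * poly (laguerre n) x \<partial>exp_weight)
     = (\<integral>x. (- x * f2 x - (1 - x) * f1 x) * poly (laguerre n) x \<partial>exp_weight)"
proof -
  define L L1 L2 where "L = poly (laguerre n)" "L1 = poly (pderiv (laguerre n))" "L2 = poly (pderiv (pderiv (laguerre n)))"
  note Ls = L_L1_L2_def
  have d: "(L has_real_derivative L1 x) (at x)" "(L1 has_real_derivative L2 x) (at x)" for x
    unfolding Ls by (auto intro: poly_DERIV)
  have ode: "real n * L x = - x * L2 x - (1 - x) * L1 x" for x
    using laguerre_ode[of x n] by (simp add: Ls)
  have cf: "continuous_on UNIV f" "continuous_on UNIV f1"
    using f by (meson DERIV_isCont continuous_at_imp_continuous_on)+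
  have cL: "continuous_on UNIV L" unfolding Ls by (intro continuous_intros)
  have sL: "subexp L" "subexp L1" unfolding Ls by (intro subexp_intros)+
  define g where "g x = (- x * f2 x - (1 - x) * f1 x) * L x" for x
  have cg: "continuous_on UNIV g" "continuous_on UNIV (\<lambda>x. f x * L x)"
    unfolding g_def by (intro continuous_intros cf f2 cL)+
  have ig: "integrable exp_weight g"
  proof -
    have "subexp (\<lambda>x. (-1 * x * f2 x - (1 - x) * f1 x) * L x)"
      by (intro subexp_intros sub sL)
    then show ?thesis using cg(1)
      by (intro integrable_exp_weight_subexp borel_measurable_continuous_onI) (auto simp: g_def[abs_def])
  qed
  have if': "integrable exp_weight (\<lambda>x. f x * L x)"
    using cg(2) by (intro integrable_exp_weight_subexp borel_measurable_continuous_onI subexp_intros sub sL)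
  \<comment> \<open>The boundary term of Green's formula. Its factor \<open>x\<close> removes it at
    0, and \<open>exp (- x)\<close> removes it at infinity.\<close>
  define G where "G x = exp (- x) * (x * (f x * L1 x - f1 x * L x))" for x
  have "integral\<^sup>L exp_weight (\<lambda>x. g x - real n * (f x * L x)) = 0 - G 0"
  proof (rule integral_exp_weight_FTC)
    show "integrable exp_weight (\<lambda>x. g x - real n * (f x * L x))" using ig if' by simp
    show "continuous_on UNIV (\<lambda>x. g x - real n * (f x * L x))" by (intro continuous_intros cg)
    show "(G has_real_derivative exp (- x) * (g x - real n * (f x * L x))) (at x)" for x
    proof -
      have "(G has_real_derivative exp (- x) * ((1 - x) * (f x * L1 x - f1 x * L x)
          + x * (f x * L2 x - f2 x * L x))) (at x)"
        unfolding G_def by (auto intro!: derivative_eq_intros f d simp: algebra_simps)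
      moreover have "(1 - x) * (f x * L1 x - f1 x * L x) + x * (f x * L2 x - f2 x * L x)
          = g x - f x * (real n * L x)"
        unfolding ode by (simp add: g_def algebra_simps)
      ultimately show ?thesis by (simp add: mult.left_commute)
    qed
    have "subexp (\<lambda>x. x * (f x * L1 x - f1 x * L x))" by (intro subexp_intros sub sL)
    then obtain C where "\<forall>x\<ge>0. \<bar>x * (f x * L1 x - f1 x * L x)\<bar> \<le> C * exp (1/2 * x)"
      unfolding subexp_def by (auto dest: spec[of _ "1/2"])
    then show "(G \<longlongrightarrow> 0) at_top"
      unfolding G_def by (intro tendsto_zero_of_exp_bound[of _ C "1/2"]) auto
  qed
  then have "integral\<^sup>L exp_weight g - real n * integral\<^sup>L exp_weight (\<lambda>x. f x * L x) = 0"
    using ig if' by (simp add: G_def)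
  then show ?thesis by (simp add: g_def[abs_def] Ls)
qed

section \<open>Orthogonality relations\<close>

text \<open>Symmetry of the operator gives \<open>n * I = m * I\<close> for the inner product
  \<open>I\<close>, since both polynomials are eigenfunctions.\<close>

lemma laguerre_orthogonal:
  assumes "m \<noteq> n" shows "integral\<^sup>L exp_weight (poly (laguerre m * laguerre n)) = 0"
proof -
  have "real n * (\<integral>x. poly (laguerre m) x * poly (laguerre n) x \<partial>exp_weight)
     = (\<integral>x. (- x * poly (pderiv (pderiv (laguerre m))) x - (1 - x) * poly (pderiv (laguerre m)) x) * poly (laguerre n) x \<partial>exp_weight)"
    by (rule laguerre_green) (auto intro: poly_DERIV subexp_poly continuous_intros)
  also have "\<dots> = (\<integral>x. real m * (poly (laguerre m) x * poly (laguerre n) x) \<partial>exp_weight)"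
  proof (rule Bochner_Integration.integral_cong[OF refl])
    fix x
    have "- x * poly (pderiv (pderiv (laguerre m))) x - (1 - x) * poly (pderiv (laguerre m)) x = real m * poly (laguerre m) x"
      using laguerre_ode[of x m] by (simp add: algebra_simps)
    then show "(- x * poly (pderiv (pderiv (laguerre m))) x - (1 - x) * poly (pderiv (laguerre m)) x) * poly (laguerre n) x
      = real m * (poly (laguerre m) x * poly (laguerre n) x)" by simp
  qed
  also have "\<dots> = real m * (\<integral>x. poly (laguerre m) x * poly (laguerre n) x \<partial>exp_weight)" by simp
  finally show ?thesis using assms by (simp add: poly_mult[abs_def])
qed

lemma integral_exp_weight_poly_linear:
  "integral\<^sup>L exp_weight (poly (p + q)) = integral\<^sup>L exp_weight (poly p) + integral\<^sup>L exp_weight (poly q)"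
  "integral\<^sup>L exp_weight (poly (p - q)) = integral\<^sup>L exp_weight (poly p) - integral\<^sup>L exp_weight (poly q)"
  "integral\<^sup>L exp_weight (poly (smult c p)) = c * integral\<^sup>L exp_weight (poly p)"
  using integrable_exp_weight_poly[of p] integrable_exp_weight_poly[of q]
  by (simp_all add: poly_add[abs_def] poly_diff[abs_def] poly_smult[abs_def])

lemma integral_exp_weight_poly_sum:
  "integral\<^sup>L exp_weight (poly (\<Sum>i\<in>A. f i)) = (\<Sum>i\<in>A. integral\<^sup>L exp_weight (poly (f i)))"
  by (induction A rule: infinite_finite_induct) (simp_all add: integral_exp_weight_poly_linear del: poly_add)

lemma integral_exp_weight_pCons_laguerre:
  "integral\<^sup>L exp_weight (poly (pCons 0 (laguerre n) * p)) = (2 * real n + 1) * integral\<^sup>L exp_weight (poly (laguerre n * p))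
     - (real n + 1) * integral\<^sup>L exp_weight (poly (laguerre (Suc n) * p)) - real n * integral\<^sup>L exp_weight (poly (laguerre (n - 1) * p))"
  unfolding laguerre_rec_poly by (simp add: left_diff_distrib integral_exp_weight_poly_linear)

text \<open>The integral of \<open>x\<close> times two consecutive polynomials is computed twice,
  applying the recurrence to either factor; orthogonality leaves one squared norm on each side, with
  the same coefficient.\<close>

lemma laguerre_normalized: "integral\<^sup>L exp_weight (poly (laguerre n * laguerre n)) = 1"
proof (induction n)
  case 0
  show ?case using integral_exp_weight_exp[of 0] by simp
next
  case (Suc n)
  let ?I = "\<lambda>p. integral\<^sup>L exp_weight (poly p)"
  have a: "?I (pCons 0 (laguerre n) * laguerre (Suc n)) = - ((real n + 1) * ?I (laguerre (Suc n) * laguerre (Suc n)))"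
    unfolding integral_exp_weight_pCons_laguerre by (simp add: laguerre_orthogonal)
  have b: "?I (pCons 0 (laguerre (Suc n)) * laguerre n) = - ((real n + 1) * ?I (laguerre n * laguerre n))"
    unfolding integral_exp_weight_pCons_laguerre by (simp add: laguerre_orthogonal)
  have "pCons 0 (laguerre (Suc n)) * laguerre n = pCons 0 (laguerre n) * laguerre (Suc n)"
    by (simp add: mult.commute)
  then have "(real n + 1) * ?I (laguerre (Suc n) * laguerre (Suc n)) = (real n + 1) * ?I (laguerre n * laguerre n)"
    using a b by (metis neg_equal_iff_equal)
  then show ?case using Suc by (simp del: poly_mult)
qed

text \<open>No expansion of \<open>p\<close> in the Laguerre basis is needed: by the recurrence,
  \<open>x ^ j\<close> times \<open>laguerre m\<close> involves only indices up to
  \<open>j + m\<close>, so induction on \<open>j\<close> reduces monomials to plain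
  orthogonality.\<close>

lemma laguerre_orthogonal_low_degree:
  assumes "degree p < n" shows "integral\<^sup>L exp_weight (poly (p * laguerre n)) = 0"
proof -
  let ?I = "\<lambda>p. integral\<^sup>L exp_weight (poly p)"
  have *: "?I (monom 1 j * (laguerre m * laguerre n)) = 0" if "j + m < n" for j m
    using that
  proof (induction j arbitrary: m)
    case 0
    then show ?case using laguerre_orthogonal[of m n] by (simp only: monom_0 one_pCons[symmetric] mult_1_left)
  next
    case (Suc j)
    have eq: "monom 1 (Suc j) * (laguerre m * laguerre n) = pCons 0 (laguerre m) * (monom 1 j * laguerre n)"
    proof -
      have "pCons 0 r * r' = pCons 0 (r * r')" for r r' :: "real poly" by simp
      then show ?thesis by (simp only: monom_Suc mult_ac)
    qed
    have "?I (laguerre k * (monom 1 j * laguerre n)) = 0" if "k \<le> Suc m" for k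
      using Suc.IH[of k] Suc.prems that by (simp only: mult_ac)
    from this[of m] this[of "Suc m"] this[of "m - 1"] show ?case
      unfolding eq integral_exp_weight_pCons_laguerre by (simp only: mult_zero_right diff_zero simp_thms le_refl)
  qed
  have "p = (\<Sum>i\<le>degree p. smult (coeff p i) (monom 1 i))"
    using poly_as_sum_of_monoms[of p] by (simp only: smult_monom mult_1_right)
  then have "p * laguerre n = (\<Sum>i\<le>degree p. smult (coeff p i) (monom 1 i)) * laguerre n"
    by (rule arg_cong[where f = "\<lambda>r. r * laguerre n"])
  also have "\<dots> = (\<Sum>i\<le>degree p. smult (coeff p i) (monom 1 i * laguerre n))"
    by (simp only: sum_distrib_right mult_smult_left)
  finally have "?I (p * laguerre n) = (\<Sum>i\<le>degree p. coeff p i * ?I (monom 1 i * laguerre n))"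
    by (simp only: integral_exp_weight_poly_sum integral_exp_weight_poly_linear)
  also have "\<dots> = 0" 
  proof (intro sum.neutral ballI)
    fix i assume "i \<in> {..degree p}"
    then have "?I (monom 1 i * (laguerre 0 * laguerre n)) = 0" using assms by (intro *) auto
    then show "coeff p i * ?I (monom 1 i * laguerre n) = 0" by (simp only: laguerre_0 mult_1_left mult_zero_right)
  qed
  finally show ?thesis .
qed

section \<open>Decay of Laguerre coefficients\<close>

text \<open>If \<open>D j\<close> is the \<open>j\<close>-th derivative of \<open>f\<close>, this is
  the \<open>j\<close>-th derivative of \<open>- x * f'' - (1 - x) * f'\<close> by Leibniz' rule, so
  the operator maps derivative sequences to derivative sequences and can be iterated.\<close>

definition laguerre_op :: "(nat \<Rightarrow> real \<Rightarrow> real) \<Rightarrow> nat \<Rightarrow> real \<Rightarrow> real" where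
  "laguerre_op D j x = - x * D (j + 2) x - (real j + 1 - x) * D (j + 1) x + real j * D j x"

lemma subexp_poly_bound:
  assumes "\<And>x. x \<ge> 0 \<Longrightarrow> \<bar>f x\<bar> \<le> B * (1 + x) ^ M"
  shows "subexp f"
  unfolding subexp_def
proof safe
  fix e :: real assume "e > 0"
  then obtain C where C: "C > 0" "\<And>x::real. x \<ge> 0 \<Longrightarrow> (1 + x) ^ M \<le> C * exp (e * x)"
    using one_plus_power_le_exp[of e M] by blast
  have "\<bar>f x\<bar> \<le> \<bar>B\<bar> * C * exp (e * x)" if "x \<ge> 0" for x
  proof -
    have "\<bar>f x\<bar> \<le> \<bar>B\<bar> * (1 + x) ^ M"
    proof -
      have "B * (1 + x) ^ M \<le> \<bar>B\<bar> * (1 + x) ^ M" using that by (intro mult_right_mono) auto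
      then show ?thesis using assms[OF that] by linarith
    qed
    also have "\<dots> \<le> \<bar>B\<bar> * (C * exp (e * x))" using C(2)[OF that] by (intro mult_left_mono) auto
    finally show ?thesis by simp
  qed
  then show "\<exists>C. \<forall>x\<ge>0. \<bar>f x\<bar> \<le> C * exp (e * x)" by blast
qed

text \<open>\<open>C\<close> is chosen before \<open>D\<close> and \<open>n\<close>; this uniformity
  later lets one constant serve all times. Each power of \<open>n\<close> is traded by
  \<open>laguerre_green\<close> for one application of \<open>laguerre_op\<close>. That raises the
  growth degree by one and changes the bounds, so the induction keeps \<open>B\<close> and
  \<open>M\<close> general. The factor \<open>n + 1\<close> is the one in
  \<open>laguerre_bound\<close>.\<close>

lemma laguerre_coeff_decay:
  "\<exists>C\<ge>0. \<forall>D n. (\<forall>j x. (D j has_real_derivative D (Suc j) x) (at x)) \<longrightarrow>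
      (\<forall>j x. x \<ge> 0 \<longrightarrow> \<bar>D j x\<bar> \<le> B j * (1 + x) ^ M) \<longrightarrow>
      real n ^ s * \<bar>\<integral>x. D 0 x * poly (laguerre n) x \<partial>exp_weight\<bar> \<le> C * (real n + 1)"
proof (induction s arbitrary: B M)
  case 0
  obtain C where C: "C > 0" "\<And>x::real. x \<ge> 0 \<Longrightarrow> (1 + x) ^ M \<le> C * exp (1/4 * x)"
    using one_plus_power_le_exp[of "1/4" M] by auto
  have "\<bar>\<integral>x. D 0 x * poly (laguerre n) x \<partial>exp_weight\<bar> \<le> 8 * \<bar>B 0\<bar> * C * (real n + 1)"
    if D: "\<And>j x. (D j has_real_derivative D (Suc j) x) (at x)"
      and b: "\<And>j x. x \<ge> 0 \<Longrightarrow> \<bar>D j x\<bar> \<le> B j * (1 + x) ^ M" for D n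
  proof -
    have "continuous_on UNIV (D 0)" using D by (meson DERIV_isCont continuous_at_imp_continuous_on)
    then have [measurable]: "D 0 \<in> borel_measurable borel" by (rule borel_measurable_continuous_onI)
    \<comment> \<open>The rates add up: 1/4 absorbs \<open>(1 + x) ^ M\<close> and 1/2 comes from
      the Laguerre polynomial, leaving the room \<open>1 - 3/4\<close>.\<close>
    have "\<bar>\<integral>x. D 0 x * poly (laguerre n) x \<partial>exp_weight\<bar> \<le> (\<bar>B 0\<bar> * C * (2 * (real n + 1))) / (1 - 3/4)"
    proof (rule integral_exp_weight_exp_bound)
      fix x :: real assume x: "x \<ge> 0"
      have "\<bar>D 0 x\<bar> \<le> B 0 * (1 + x) ^ M" by (rule b[OF x])
      also have "\<dots> \<le> \<bar>B 0\<bar> * (C * exp (1/4 * x))" using C(2)[OF x] x by (intro mult_mono) auto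
      finally have "\<bar>D 0 x * poly (laguerre n) x\<bar> \<le> (\<bar>B 0\<bar> * (C * exp (1/4 * x))) * (2 * (real n + 1) * exp (x/2))"
        unfolding abs_mult using laguerre_bound[OF x, of n] C(1) by (intro mult_mono) auto
      also have "\<dots> = (\<bar>B 0\<bar> * C * (2 * (real n + 1))) * (exp (1/4 * x) * exp (x/2))" by simp
      also have "exp (1/4 * x) * exp (x/2) = exp (3/4 * x)" by (simp add: exp_add[symmetric])
      finally show "\<bar>D 0 x * poly (laguerre n) x\<bar> \<le> (\<bar>B 0\<bar> * C * (2 * (real n + 1))) * exp (3/4 * x)" .
    qed auto
    then show ?thesis by (simp add: algebra_simps)
  qed
  then show ?case using C(1) by (intro exI[of _ "8 * \<bar>B 0\<bar> * C"]) auto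
next
  case (Suc s)
  \<comment> \<open>The triangle inequality applied to \<open>laguerre_op\<close>, with the
    multipliers \<open>x\<close> and \<open>j + 1 - x\<close> absorbed into the extra factor
    \<open>1 + x\<close>.\<close>
  define B' where "B' j = B (j + 2) + (real j + 1) * B (j + 1) + real j * B j" for j
  obtain C where C: "C \<ge> 0" "\<And>D n. (\<And>j x. (D j has_real_derivative D (Suc j) x) (at x)) \<Longrightarrow>
      (\<And>j x. x \<ge> 0 \<Longrightarrow> \<bar>D j x\<bar> \<le> B' j * (1 + x) ^ Suc M) \<Longrightarrow>
      real n ^ s * \<bar>\<integral>x. D 0 x * poly (laguerre n) x \<partial>exp_weight\<bar> \<le> C * (real n + 1)"
    using Suc.IH[of B' "Suc M"] by blast
  have "real n ^ Suc s * \<bar>\<integral>x. D 0 x * poly (laguerre n) x \<partial>exp_weight\<bar> \<le> C * (real n + 1)"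
    if D: "\<And>j x. (D j has_real_derivative D (Suc j) x) (at x)"
      and b: "\<And>j x. x \<ge> 0 \<Longrightarrow> \<bar>D j x\<bar> \<le> B j * (1 + x) ^ M" for D n
  proof -
    have "real n * (\<integral>x. D 0 x * poly (laguerre n) x \<partial>exp_weight)
       = (\<integral>x. (- x * D (Suc (Suc 0)) x - (1 - x) * D (Suc 0) x) * poly (laguerre n) x \<partial>exp_weight)"
    proof (rule laguerre_green)
      show "continuous_on UNIV (D (Suc (Suc 0)))"
        using D by (meson DERIV_isCont continuous_at_imp_continuous_on)
    qed (use b D in \<open>auto intro: subexp_poly_bound\<close>)
    also have "\<dots> = (\<integral>x. laguerre_op D 0 x * poly (laguerre n) x \<partial>exp_weight)"
      by (simp add: laguerre_op_def numeral_2_eq_2)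
    finally have eq: "real n * (\<integral>x. D 0 x * poly (laguerre n) x \<partial>exp_weight) = \<dots>" .
    have "real n ^ s * \<bar>\<integral>x. laguerre_op D 0 x * poly (laguerre n) x \<partial>exp_weight\<bar> \<le> C * (real n + 1)"
    proof (rule C(2))
      fix j x
      show "(laguerre_op D j has_real_derivative laguerre_op D (Suc j) x) (at x)"
        unfolding laguerre_op_def by (auto intro!: derivative_eq_intros D simp: algebra_simps)
    next
      fix j and x :: real assume x: "x \<ge> 0"
      have B0: "B i \<ge> 0" for i
        using b[of 0 i] by (auto intro: order.trans[OF abs_ge_zero])
      have "\<bar>laguerre_op D j x\<bar> \<le> x * \<bar>D (j + 2) x\<bar> + (real j + 1 + x) * \<bar>D (j + 1) x\<bar> + real j * \<bar>D j x\<bar>"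
      proof -
        have "\<bar>(real j + 1 - x) * D (j + 1) x\<bar> \<le> (real j + 1 + x) * \<bar>D (j + 1) x\<bar>"
          unfolding abs_mult using x by (intro mult_right_mono) auto
        moreover have "\<bar>- x * D (j + 2) x\<bar> = x * \<bar>D (j + 2) x\<bar>" "\<bar>real j * D j x\<bar> = real j * \<bar>D j x\<bar>"
          using x by (auto simp: abs_mult)
        ultimately show ?thesis unfolding laguerre_op_def by linarith
      qed
      also have "\<dots> \<le> (1 + x) * (B (j + 2) * (1 + x) ^ M) + ((real j + 1) * (1 + x)) * (B (j + 1) * (1 + x) ^ M)
          + (real j * (1 + x)) * (B j * (1 + x) ^ M)"
        using x b[OF x] B0 by (intro add_mono mult_mono) (auto simp: algebra_simps)
      also have "\<dots> = B' j * (1 + x) ^ Suc M"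
        by (simp add: B'_def algebra_simps)
      finally show "\<bar>laguerre_op D j x\<bar> \<le> B' j * (1 + x) ^ Suc M" .
    qed
    then show ?thesis unfolding eq[symmetric] by (simp add: abs_mult algebra_simps)
  qed
  then show ?case using C(1) by (intro exI[of _ C]) auto
qed

section \<open>Completeness and pointwise Laguerre expansion\<close>

lemma exp_partial_sum_abs_le: "\<bar>\<Sum>i<N. (y::real) ^ i / fact i\<bar> \<le> exp \<bar>y\<bar>"
proof -
  have "\<bar>\<Sum>i<N. y ^ i / fact i\<bar> \<le> (\<Sum>i<N. \<bar>y\<bar> ^ i / fact i)"
    by (rule order.trans[OF sum_abs]) (simp add: power_abs)
  also have "\<dots> \<le> (\<Sum>i. \<bar>y\<bar> ^ i / fact i)"
    using summable_exp[of "\<bar>y\<bar>"]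
    by (intro sum_le_suminf) (auto simp: divide_inverse mult.commute)
  also have "\<dots> = exp \<bar>y\<bar>" by (simp add: exp_def divide_inverse mult.commute)
  finally show ?thesis .
qed

lemma exp_partial_sums: "(\<lambda>N. \<Sum>i<N. (y::real) ^ i / fact i) \<longlonglongrightarrow> exp y"
  using exp_converges[of y] by (simp add: sums_def divide_inverse mult.commute)

text \<open>Expanding \<open>exp (- x / 4)\<close> in powers is legitimate against functions of growth \<open>exp (x / 2)\<close>;
  iterating reaches \<open>exp (- k x / 4)\<close> for every \<open>k\<close>, whereas a single step would not.\<close>

lemma exp_weight_moments_zero_exp:
  assumes [measurable]: "g \<in> borel_measurable borel"
    and b: "\<And>x. x \<ge> 0 \<Longrightarrow> \<bar>g x\<bar> \<le> C * exp (x / 2)"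
    and z: "\<And>j::nat. (\<integral>x. g x * x ^ j \<partial>exp_weight) = 0"
  shows "(\<integral>x. g x * x ^ j * exp (- real k * x / 4) \<partial>exp_weight) = 0"
proof (induction k arbitrary: j)
  case 0
  then show ?case using z by simp
next
  case (Suc k)
  define h where "h j x = g x * x ^ j * exp (- real k * x / 4)" for j x
  have [measurable]: "h j \<in> borel_measurable borel" for j unfolding h_def by measurable
  have C0: "C \<ge> 0" using b[of 0] by (auto intro: order.trans[OF abs_ge_zero])
  have hb: "\<bar>h j x\<bar> \<le> C * x ^ j * exp (x / 2)" if "x \<ge> 0" for j x
  proof -
    have "\<bar>h j x\<bar> = \<bar>g x\<bar> * x ^ j * exp (- real k * x / 4)"
      using that by (simp add: h_def abs_mult)
    also have "\<dots> \<le> \<bar>g x\<bar> * x ^ j * 1" using that by (intro mult_left_mono) auto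
    also have "\<dots> \<le> (C * exp (x / 2)) * x ^ j"
      using b[OF that] that by (simp add: mult_right_mono)
    finally show ?thesis by (simp add: mult_ac)
  qed
  \<comment> \<open>The rate 1/2 comes from \<open>g\<close>, 1/4 from the majorant of the partial
    sums, and 1/8 absorbs \<open>x ^ j\<close>; the total 7/8 stays below 1, so the majorant is
    integrable.\<close>
  have growth: "C * x ^ j * exp (x / 2) * exp (x / 4) \<le> C * (fact j / (1/8) ^ j) * exp (7/8 * x)"
    if "x \<ge> 0" for x :: real and j
  proof -
    have "C * x ^ j * exp (x / 2) * exp (x / 4) = C * x ^ j * exp (3/4 * x)"
      by (simp add: mult.assoc exp_add[symmetric])
    also have "\<dots> \<le> C * (fact j / (1/8) ^ j * exp (1/8 * x)) * exp (3/4 * x)"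
      using power_le_exp[OF that, of "1/8" j] C0 by (intro mult_right_mono mult_left_mono) auto
    also have "\<dots> = C * (fact j / (1/8) ^ j) * (exp (1/8 * x) * exp (3/4 * x))" by simp
    also have "exp (1/8 * x) * exp (3/4 * x) = exp (7/8 * x)" by (simp add: exp_add[symmetric])
    finally show ?thesis .
  qed
  have hi: "integrable exp_weight (h j)" for j
  proof (rule integrable_exp_weight_exp_bound)
    fix x :: real assume x: "x \<ge> 0"
    have "C * x ^ j * exp (x / 2) * 1 \<le> C * x ^ j * exp (x / 2) * exp (x / 4)"
      using x C0 by (intro mult_left_mono) auto
    then show "\<bar>h j x\<bar> \<le> C * (fact j / (1/8) ^ j) * exp (7/8 * x)"
      using hb[OF x, of j] growth[OF x, of j] by linarith
  qed auto
  have h0: "integral\<^sup>L exp_weight (h j) = 0" for j using Suc.IH unfolding h_def by simp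
  define S where "S N x = h j x * (\<Sum>i<N. (- x / 4) ^ i / fact i)" for N x
  have [measurable]: "S N \<in> borel_measurable borel" for N unfolding S_def by measurable
  have "(\<lambda>N. integral\<^sup>L exp_weight (S N)) \<longlonglongrightarrow> (\<integral>x. h j x * exp (- x / 4) \<partial>exp_weight)"
  proof (rule integral_dominated_convergence[where w = "\<lambda>x. C * (fact j / (1/8) ^ j) * exp (7/8 * x)"])
    show "integrable exp_weight (\<lambda>x. C * (fact j / (1/8) ^ j) * exp (7/8 * x))"
      using integrable_exp_weight_exp[of "7/8"] by simp
    show "AE x in exp_weight. (\<lambda>N. S N x) \<longlonglongrightarrow> h j x * exp (- x / 4)"
      unfolding S_def by (intro AE_I2 tendsto_mult tendsto_const exp_partial_sums)
    show "AE x in exp_weight. norm (S N x) \<le> C * (fact j / (1/8) ^ j) * exp (7/8 * x)" for N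
    proof (rule AE_exp_weight)
      fix x :: real assume x: "x \<ge> 0"
      have "norm (S N x) = \<bar>h j x\<bar> * \<bar>\<Sum>i<N. (- x / 4) ^ i / fact i\<bar>" by (simp add: S_def abs_mult)
      also have "\<dots> \<le> (C * x ^ j * exp (x / 2)) * exp (x / 4)"
        using hb[OF x, of j] exp_partial_sum_abs_le[of "- x / 4" N] x C0 by (intro mult_mono) auto
      finally show "norm (S N x) \<le> C * (fact j / (1/8) ^ j) * exp (7/8 * x)"
        using growth[OF x, of j] by linarith
    qed
  qed auto
  moreover have "integral\<^sup>L exp_weight (S N) = 0" for N
  proof -
    have "S N = (\<lambda>x. \<Sum>i<N. ((-1/4) ^ i / fact i) * h (j + i) x)"
      unfolding S_def sum_distrib_left
    proof (intro ext sum.cong refl)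
      fix x :: real and i
      have "(- x / 4) ^ i = (-1/4) ^ i * x ^ i"
        unfolding power_mult_distrib[symmetric] by simp
      then have "h j x * ((- x / 4) ^ i / fact i) = h j x * ((-1/4) ^ i * x ^ i / fact i)" by (simp only:)
      also have "\<dots> = ((-1/4) ^ i / fact i) * h (j + i) x" unfolding h_def power_add by (simp only: mult_ac times_divide_eq_right times_divide_eq_left)
      finally show "h j x * ((- x / 4) ^ i / fact i) = ((-1/4) ^ i / fact i) * h (j + i) x" .
    qed
    then show ?thesis using hi h0 by simp
  qed
  ultimately have "(\<integral>x. h j x * exp (- x / 4) \<partial>exp_weight) = 0"
    by (simp add: LIMSEQ_const_iff)
  moreover have "h j x * exp (- x / 4) = g x * x ^ j * exp (- real (Suc k) * x / 4)" for x
  proof -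
    have "exp (- real k * x / 4) * exp (- x / 4) = exp (- real (Suc k) * x / 4)"
      by (simp add: exp_add[symmetric] algebra_simps add_divide_distrib diff_divide_distrib)
    then show ?thesis by (simp add: h_def mult.assoc)
  qed
  ultimately show ?case by simp
qed

text \<open>The substitution \<open>u = exp (- x)\<close> compactifies the half-line to
  \<open>{0..1}\<close>, where Stone-Weierstrass applies. The extra factor \<open>u\<close> in
  \<open>G\<close> beats the growth \<open>exp (x / 2) = 1 / sqrt u\<close>, making \<open>G\<close>
  continuous at 0 with value 0. Since \<open>g\<close> annihilates all powers of
  \<open>exp (- x)\<close>, the weighted square integral of \<open>g x * exp (- x)\<close> vanishes,
  and continuity turns almost everywhere into everywhere.\<close>

lemma exp_weight_complete:
  assumes m [measurable]: "g \<in> borel_measurable borel"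
    and cont: "continuous_on {0..} g"
    and b: "\<And>x. x \<ge> 0 \<Longrightarrow> \<bar>g x\<bar> \<le> C * exp (x / 2)"
    and z: "\<And>j::nat. (\<integral>x. g x * x ^ j \<partial>exp_weight) = 0"
    and x0: "x0 \<ge> 0"
  shows "g x0 = 0"
proof -
  have C0: "C \<ge> 0" using b[of 0] by (auto intro: order.trans[OF abs_ge_zero])
  define G where "G u = (if u = 0 then 0 else g (- ln u) * u)" for u :: real
  have Gexp: "G (exp (- x)) = g x * exp (- x)" for x by (simp add: G_def)
  \<comment> \<open>The preceding lemma works in steps of 1/4, so \<open>4 * k\<close> of them give
    \<open>exp (- x) ^ k\<close>.\<close>
  have z': "(\<integral>x. g x * exp (- x) ^ k \<partial>exp_weight) = 0" for k
    using exp_weight_moments_zero_exp[OF m b z, of 0 "4 * k"] by (simp add: exp_of_nat_mult[symmetric])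
  have contG: "continuous_on {0..1} G"
  proof -
    have "continuous (at u within {0..1}) G" if u: "u \<in> {0..1}" for u
    proof (cases "u = 0")
      case True
      have "(G \<longlongrightarrow> 0) (at 0 within {0..1})"
      proof (rule Lim_null_comparison)
        show "\<forall>\<^sub>F u in at 0 within {0..1}. norm (G u) \<le> C * sqrt u"
        proof (unfold eventually_at_filter, rule always_eventually, intro allI impI)
          fix u :: real assume "u \<noteq> 0" "u \<in> {0..1}"
          then have u: "u > 0" "u \<le> 1" by auto
          have "norm (G u) = \<bar>g (- ln u)\<bar> * u" using u by (simp add: G_def abs_mult)
          also have "\<dots> \<le> C * exp (- ln u / 2) * u" using b[of "- ln u"] u by (intro mult_right_mono) auto
          also have "exp (- ln u / 2) = 1 / sqrt u"
            using u by (simp add: exp_minus ln_sqrt[symmetric] inverse_eq_divide)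
          also have "C * (1 / sqrt u) * u = C * (u / sqrt u)" by simp
          also have "u / sqrt u = sqrt u" using u by (simp add: real_div_sqrt)
          finally show "norm (G u) \<le> C * sqrt u" .
        qed
        have "((\<lambda>u. C * sqrt u) \<longlongrightarrow> C * sqrt 0) (at 0 within {0..1})"
          by (intro tendsto_intros)
        then show "((\<lambda>u. C * sqrt u) \<longlongrightarrow> 0) (at 0 within {0..1})" by simp
      qed
      then show ?thesis using True by (simp add: continuous_within G_def)
    next
      case False
      then have u0: "u > 0" using u by auto
      have c: "continuous_on {0<..1} (\<lambda>u. g (- ln u) * u)"
        by (intro continuous_intros continuous_on_compose2[OF cont]) auto
      have "continuous_on {0<..1} G"
        by (rule continuous_on_eq[OF c]) (auto simp: G_def)
      then have "continuous (at u within {0<..1}) G"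
        using u u0 by (simp add: continuous_on_eq_continuous_within)
      moreover have "at u within {0<..1} = at u within {0..1}"
        by (rule at_within_nhd[of u "{0<..}"]) (use u0 in auto)
      ultimately show ?thesis by (simp add: continuous_within)
    qed
    then show ?thesis by (simp add: continuous_on_eq_continuous_within)
  qed
  define J where "J = (\<integral>x. (g x * exp (- x)) ^ 2 \<partial>exp_weight)"
  have gb: "\<bar>g x * exp (- x)\<bar> \<le> C" if "x \<ge> 0" for x
  proof -
    have "\<bar>g x * exp (- x)\<bar> \<le> C * exp (x / 2) * exp (- x)"
      unfolding abs_mult using b[OF that] by (intro mult_mono) auto
    also have "\<dots> = C * exp (- x / 2)" by (simp add: exp_add[symmetric])
    also have "\<dots> \<le> C * 1" using that C0 by (intro mult_left_mono) auto
    finally show ?thesis by simp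
  qed
  \<comment> \<open>One factor of the square is replaced by its difference from a polynomial in
    \<open>exp (- x)\<close>: the polynomial part integrates to 0, and the difference is below
    \<open>e\<close> while the other factor is at most \<open>C\<close>.\<close>
  have small: "\<bar>J\<bar> \<le> C * e" if e: "e > 0" for e
  proof -
    obtain p where p: "real_polynomial_function p" "\<And>u. u \<in> {0..1} \<Longrightarrow> \<bar>G u - p u\<bar> < e"
      using Stone_Weierstrass_real_polynomial_function[OF compact_Icc contG e] by blast
    obtain a n where an: "p = (\<lambda>x. \<Sum>i\<le>n. a i * x ^ i)"
      using p(1) unfolding real_polynomial_function_iff_sum by blast
    have gi: "integrable exp_weight (\<lambda>x. g x * exp (- x) ^ k)" for k
    proof (rule integrable_exp_weight_exp_bound)
      fix x :: real assume x: "x \<ge> 0"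
      have "\<bar>g x * exp (- x) ^ k\<bar> \<le> C * exp (x / 2) * 1"
        unfolding abs_mult using b[OF x] x C0 by (intro mult_mono) (auto intro: power_le_one)
      then show "\<bar>g x * exp (- x) ^ k\<bar> \<le> C * exp (1/2 * x)" by simp
    qed auto
    have pz: "(\<integral>x. g x * exp (- x) * p (exp (- x)) \<partial>exp_weight) = 0"
    proof -
      have "(\<lambda>x. g x * exp (- x) * p (exp (- x))) = (\<lambda>x. \<Sum>i\<le>n. a i * (g x * exp (- x) ^ Suc i))"
        by (auto simp: an sum_distrib_left mult_ac)
      moreover have "(\<integral>x. (\<Sum>i\<le>n. a i * (g x * exp (- x) ^ Suc i)) \<partial>exp_weight) = 0"
        using gi z' by (simp del: power_Suc)
      ultimately show ?thesis by simp
    qed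
    have [measurable]: "p \<in> borel_measurable borel" unfolding an by measurable
    have bb: "\<bar>g x * exp (- x) * (g x * exp (- x) - p (exp (- x)))\<bar> \<le> C * e" if "x \<ge> 0" for x
    proof -
      have "\<bar>g x * exp (- x) - p (exp (- x))\<bar> < e" using p(2)[of "exp (- x)"] that by (simp add: Gexp)
      then show ?thesis unfolding abs_mult[of "g x * exp (- x)" "_ - _"]
        using gb[OF that] C0 by (intro mult_mono) auto
    qed
    have i1: "integrable exp_weight (\<lambda>x. g x * exp (- x) * (g x * exp (- x) - p (exp (- x))))"
      by (rule integrable_exp_weight_exp_bound[where C = "C * e" and e = 0]) (use bb in auto)
    have l1: "\<bar>\<integral>x. g x * exp (- x) * (g x * exp (- x) - p (exp (- x))) \<partial>exp_weight\<bar> \<le> C * e / (1 - 0)"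
      by (rule integral_exp_weight_exp_bound[where C = "C * e" and e = 0]) (use bb in auto)
    have i2: "integrable exp_weight (\<lambda>x. (g x * exp (- x)) ^ 2)"
    proof (rule integrable_exp_weight_exp_bound[where C = "C\<^sup>2" and e = 0])
      fix x :: real assume "x \<ge> 0"
      then show "\<bar>(g x * exp (- x)) ^ 2\<bar> \<le> C\<^sup>2 * exp (0 * x)"
        using power_mono[OF gb[of x], of 2] by simp
    qed auto
    have "J = (\<integral>x. g x * exp (- x) * (g x * exp (- x) - p (exp (- x))) + g x * exp (- x) * p (exp (- x)) \<partial>exp_weight)"
      unfolding J_def by (simp add: algebra_simps power2_eq_square)
    also have "\<dots> = (\<integral>x. g x * exp (- x) * (g x * exp (- x) - p (exp (- x))) \<partial>exp_weight)
        + (\<integral>x. g x * exp (- x) * p (exp (- x)) \<partial>exp_weight)"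
    proof (rule Bochner_Integration.integral_add[OF i1])
      have "integrable exp_weight (\<lambda>x. (g x * exp (- x)) ^ 2 - g x * exp (- x) * (g x * exp (- x) - p (exp (- x))))"
        using i1 i2 by simp
      then show "integrable exp_weight (\<lambda>x. g x * exp (- x) * p (exp (- x)))"
        by (simp add: algebra_simps power2_eq_square)
    qed
    finally show ?thesis using l1 pz by simp
  qed
  have J0: "J = 0"
  proof (rule ccontr)
    assume "J \<noteq> 0"
    \<comment> \<open>With this \<open>e\<close>, \<open>small\<close> would give at most half of
      \<open>\<bar>J\<bar>\<close> as a bound for \<open>\<bar>J\<bar>\<close>; \<open>C + 1\<close>
      avoids dividing by zero.\<close>
    then have "\<bar>J\<bar> / (C + 1) / 2 > 0" using C0 by simp
    from small[OF this] have J2: "\<bar>J\<bar> \<le> \<bar>J\<bar> * (C / (C + 1)) / 2" by (simp add: mult.commute)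
    define r where "r = \<bar>J\<bar> * (C / (C + 1))"
    have "r \<le> \<bar>J\<bar> * 1" unfolding r_def using C0 by (intro mult_left_mono) auto
    moreover have "\<bar>J\<bar> \<le> r / 2" using J2 unfolding r_def .
    ultimately show False using \<open>J \<noteq> 0\<close> by linarith
  qed
  have i2: "integrable exp_weight (\<lambda>x. (g x * exp (- x)) ^ 2)"
  proof (rule integrable_exp_weight_exp_bound[where C = "C\<^sup>2" and e = 0])
    fix x :: real assume "x \<ge> 0"
    then show "\<bar>(g x * exp (- x)) ^ 2\<bar> \<le> C\<^sup>2 * exp (0 * x)"
      using power_mono[OF gb[of x], of 2] by simp
  qed auto
  have "AE x in exp_weight. (g x * exp (- x)) ^ 2 = 0"
    using integral_nonneg_eq_0_iff_AE[OF i2] J0 by (simp add: J_def)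
  then have "AE x in exp_weight. g x = 0" by simp
  then have ae: "AE x in lborel. 0 \<le> x \<longrightarrow> g x = 0"
  proof -
    have "AE x in lborel. 0 < ennreal (indicator {0..} x * exp (- x)) \<longrightarrow> g x = 0"
      using \<open>AE x in exp_weight. g x = 0\<close> unfolding exp_weight_def by (subst (asm) AE_density) auto
    then show ?thesis by (rule AE_mp) (simp add: indicator_def)
  qed
  show ?thesis
  proof (rule ccontr)
    assume ne: "g x0 \<noteq> 0"
    have "\<exists>d>0. \<forall>x\<in>{0..}. dist x x0 < d \<longrightarrow> dist (g x) (g x0) < \<bar>g x0\<bar>"
      using cont x0 ne by (auto simp: continuous_on_iff)
    then obtain d where d: "d > 0" "\<And>x. x \<ge> 0 \<Longrightarrow> dist x x0 < d \<Longrightarrow> dist (g x) (g x0) < \<bar>g x0\<bar>" by auto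
    have nz: "g x \<noteq> 0" if "x \<in> {x0<..<x0+d}" for x
      using d(2)[of x] that x0 by (auto simp: dist_real_def)
    have "AE x in lborel. x \<notin> {x0<..<x0+d}"
      using ae by eventually_elim (use nz x0 in force)
    then have "emeasure lborel {x0<..<x0+d} = 0"
      by (subst (asm) AE_iff_measurable[of "{x0<..<x0+d}"]) auto
    then show False using d(1) by simp
  qed
qed

text \<open>The sum \<open>f\<close> of the series is continuous, grows at most like
  \<open>exp (x / 2)\<close> and has the same Laguerre coefficients as \<open>D 0\<close>. Hence all
  moments of the difference \<open>g\<close> vanish, and \<open>exp_weight_complete\<close> gives
  equality at every point.\<close>

lemma exp_weight_expansion:
  assumes D: "\<And>j x. (D j has_real_derivative D (Suc j) x) (at x)"
    and b: "\<And>j x. x \<ge> 0 \<Longrightarrow> \<bar>D j x\<bar> \<le> B j * (1 + x) ^ M"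
    and x0: "x0 \<ge> 0"
  defines "c \<equiv> \<lambda>n. \<integral>x. D 0 x * poly (laguerre n) x \<partial>exp_weight"
  shows "(\<lambda>n. c n * poly (laguerre n) x0) sums D 0 x0"
proof -
  \<comment> \<open>Order 4 is what summability asks for: decay and \<open>laguerre_bound\<close>
    each bring a factor \<open>n + 1\<close>, which leaves \<open>1 / n ^ 2\<close>.\<close>
  obtain C where C: "C \<ge> 0" "\<And>n. real n ^ 4 * \<bar>c n\<bar> \<le> C * (real n + 1)"
    using laguerre_coeff_decay[of B M 4] D b unfolding c_def by metis
  define Mn where "Mn n = 2 * (\<bar>c n\<bar> * (real n + 1))" for n
  have sM: "summable Mn"
  proof (rule summable_comparison_test_ev)
    show "summable (\<lambda>n. 8 * C * (1 / real n ^ 2))"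
      using inverse_power_summable[of 2, where 'a = real] by (intro summable_mult) (simp add: inverse_eq_divide)
    show "\<forall>\<^sub>F n in sequentially. norm (Mn n) \<le> 8 * C * (1 / real n ^ 2)"
      using eventually_ge_at_top[of 1]
    proof eventually_elim
      case (elim n)
      have "real n ^ 4 * Mn n = 2 * (real n ^ 4 * \<bar>c n\<bar>) * (real n + 1)" by (simp add: Mn_def)
      also have "\<dots> \<le> 2 * (C * (real n + 1)) * (real n + 1)"
        using C(2)[of n] by (intro mult_right_mono) auto
      also have "\<dots> \<le> 2 * (C * (2 * real n)) * (2 * real n)"
        using elim C(1) by (intro mult_mono) auto
      finally have "real n ^ 4 * Mn n \<le> 8 * C * real n ^ 2" by (simp add: power2_eq_square)
      moreover have "real n ^ 4 = real n ^ 2 * real n ^ 2" by (simp add: power_add[symmetric])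
      ultimately have "real n ^ 2 * (real n ^ 2 * Mn n) \<le> real n ^ 2 * (8 * C)"
        by (simp only: mult_ac)
      then have "real n ^ 2 * Mn n \<le> 8 * C"
        by (rule mult_left_le_imp_le) (use elim in simp)
      then have "Mn n \<le> 8 * C / real n ^ 2" using elim by (simp add: pos_le_divide_eq mult.commute)
      then show ?case by (simp add: Mn_def)
    qed
  qed
  have tb: "\<bar>c n * poly (laguerre n) x\<bar> \<le> Mn n * exp (x / 2)" if "x \<ge> 0" for n x
  proof -
    have "\<bar>c n * poly (laguerre n) x\<bar> \<le> \<bar>c n\<bar> * (2 * (real n + 1) * exp (x / 2))"
      unfolding abs_mult by (intro mult_left_mono laguerre_bound that abs_ge_zero)
    then show ?thesis by (simp add: Mn_def mult_ac)
  qed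
  have sumx: "summable (\<lambda>n. \<bar>c n * poly (laguerre n) x\<bar>)" if "x \<ge> 0" for x
    by (rule summable_comparison_test[OF _ summable_mult2[OF sM, of "exp (x / 2)"]]) (use tb[OF that] in auto)
  define f where "f x = (\<Sum>n. c n * poly (laguerre n) x)" for x
  have Mn0: "Mn n \<ge> 0" for n by (simp add: Mn_def)
  have fb: "\<bar>f x\<bar> \<le> suminf Mn * exp (x / 2)" if "x \<ge> 0" for x
  proof -
    have "\<bar>f x\<bar> \<le> (\<Sum>n. \<bar>c n * poly (laguerre n) x\<bar>)"
      unfolding f_def by (rule summable_rabs[OF sumx[OF that]])
    also have "\<dots> \<le> (\<Sum>n. Mn n * exp (x / 2))"
      by (rule suminf_le[OF tb[OF that] sumx[OF that] summable_mult2[OF sM]])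
    also have "\<dots> = suminf Mn * exp (x / 2)" by (rule suminf_mult2[OF sM, symmetric])
    finally show ?thesis .
  qed
  have contD: "continuous_on UNIV (D 0)" using D by (meson DERIV_isCont continuous_at_imp_continuous_on)
  then have [measurable]: "D 0 \<in> borel_measurable borel" by (rule borel_measurable_continuous_onI)
  have [measurable]: "f \<in> borel_measurable borel" unfolding f_def by measurable
  have contf: "continuous_on {0..} f"
  proof -
    \<comment> \<open>The M-test works on bounded intervals only, because the majorant contains
      \<open>exp (x / 2)\<close>. Half-open intervals are relatively open in the half-line, so
      continuity carries over to it.\<close>
    have "continuous_on {0..<R} f" for R
    proof (rule continuous_on_subset)
      have "uniform_limit {0..R} (\<lambda>n x. \<Sum>i<n. c i * poly (laguerre i) x) f sequentially"
        unfolding f_def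
      proof (rule Weierstrass_m_test)
        fix n x assume x: "x \<in> {0..R}"
        have "\<bar>c n * poly (laguerre n) x\<bar> \<le> Mn n * exp (x / 2)" using x by (intro tb) auto
        also have "\<dots> \<le> Mn n * exp (R / 2)" using x Mn0 by (intro mult_left_mono) auto
        finally show "norm (c n * poly (laguerre n) x) \<le> Mn n * exp (R / 2)" by simp
      qed (rule summable_mult2[OF sM])
      then show "continuous_on {0..R} f"
        by (rule uniform_limit_theorem[rotated]) (auto intro!: always_eventually continuous_intros)
    qed auto
    then have "continuous (at x within {0..}) f" if "x \<ge> 0" for x
    proof -
      have "continuous (at x within {0..<x + 1}) f"
        using \<open>continuous_on {0..<x + 1} f\<close> that by (simp add: continuous_on_eq_continuous_within)
      moreover have "at x within {0..<x + 1} = at x within {0..}"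
        by (rule at_within_nhd[of x "{..<x+1}"]) auto
      ultimately show ?thesis by (simp add: continuous_within)
    qed
    then show ?thesis by (simp add: continuous_on_eq_continuous_within)
  qed
  define g where "g x = D 0 x - f x" for x
  obtain C1 where C1: "C1 > 0" "\<And>x::real. x \<ge> 0 \<Longrightarrow> (1 + x) ^ M \<le> C1 * exp (1/2 * x)"
    using one_plus_power_le_exp[of "1/2" M] by auto
  have B0: "B 0 \<ge> 0" using b[of 0 0] by (auto intro: order.trans[OF abs_ge_zero])
  have Db: "\<bar>D 0 x\<bar> \<le> (B 0 * C1) * exp (x / 2)" if "x \<ge> 0" for x
  proof -
    have "\<bar>D 0 x\<bar> \<le> B 0 * (1 + x) ^ M" by (rule b[OF that])
    also have "\<dots> \<le> B 0 * (C1 * exp (1/2 * x))" using C1(2)[OF that] B0 by (rule mult_left_mono)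
    finally show ?thesis by simp
  qed
  define CC where "CC = B 0 * C1 + suminf Mn"
  have gb: "\<bar>g x\<bar> \<le> CC * exp (x / 2)" if "x \<ge> 0" for x
    using Db[OF that] fb[OF that] unfolding g_def CC_def distrib_right by linarith
  have [measurable]: "g \<in> borel_measurable borel" unfolding g_def by measurable
  have gi: "integrable exp_weight (\<lambda>x. k x * poly p x)"
    if "k \<in> borel_measurable borel" and kb: "\<And>x. x \<ge> 0 \<Longrightarrow> \<bar>k x\<bar> \<le> K * exp (x / 2)" for k K p
  proof -
    obtain E where E: "E \<ge> 0" "\<And>x. x \<ge> 0 \<Longrightarrow> \<bar>poly p x\<bar> \<le> E * exp (1/4 * x)"
      using poly_bound_exp[of "1/4" p] by auto
    show ?thesis
    proof (rule integrable_exp_weight_exp_bound[where C = "K * E" and e = "3/4"])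
      fix x :: real assume x: "x \<ge> 0"
      have "\<bar>k x * poly p x\<bar> \<le> (K * exp (x / 2)) * (E * exp (1/4 * x))"
        unfolding abs_mult using kb[OF x] E(2)[OF x]
        by (intro mult_mono) (auto intro: order.trans[OF abs_ge_zero])
      also have "\<dots> = K * E * (exp (x / 2) * exp (1/4 * x))" by simp
      also have "exp (x / 2) * exp (1/4 * x) = exp (3/4 * x)" by (simp add: exp_add[symmetric])
      finally show "\<bar>k x * poly p x\<bar> \<le> K * E * exp (3/4 * x)" .
    qed (use that in auto)
  qed
  \<comment> \<open>Sum and integral may be exchanged: the terms have integrals bounded by a
    multiple of the summable \<open>Mn\<close>, and orthonormality keeps only the term
    \<open>n = m\<close>.\<close>
  have fL: "(\<integral>x. f x * poly (laguerre m) x \<partial>exp_weight) = c m" for m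
  proof -
    obtain E where E: "E \<ge> 0" "\<And>x. x \<ge> 0 \<Longrightarrow> \<bar>poly (laguerre m) x\<bar> \<le> E * exp (1/4 * x)"
      using poly_bound_exp[of "1/4" "laguerre m"] by auto
    have bd: "\<bar>c n * poly (laguerre n * laguerre m) x\<bar> \<le> (Mn n * E) * exp (3/4 * x)" if "x \<ge> 0" for n x
    proof -
      have "\<bar>c n * poly (laguerre n * laguerre m) x\<bar> = \<bar>c n * poly (laguerre n) x\<bar> * \<bar>poly (laguerre m) x\<bar>"
        by (simp add: abs_mult)
      also have "\<dots> \<le> (Mn n * exp (x / 2)) * (E * exp (1/4 * x))"
        using tb[OF that, of n] E(2)[OF that] Mn0 by (intro mult_mono) auto
      also have "\<dots> = Mn n * E * (exp (x / 2) * exp (1/4 * x))" by simp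
      also have "exp (x / 2) * exp (1/4 * x) = exp (3/4 * x)" by (simp add: exp_add[symmetric])
      finally show ?thesis .
    qed
    have "(\<lambda>n. \<integral>x. c n * poly (laguerre n * laguerre m) x \<partial>exp_weight) sums (\<integral>x. (\<Sum>n. c n * poly (laguerre n * laguerre m) x) \<partial>exp_weight)"
    proof (rule sums_integral)
      show "integrable exp_weight (\<lambda>x. c n * poly (laguerre n * laguerre m) x)" for n
        using integrable_exp_weight_poly[of "laguerre n * laguerre m"] by (intro integrable_mult_right)
      show "AE x in exp_weight. summable (\<lambda>n. norm (c n * poly (laguerre n * laguerre m) x))"
      proof (rule AE_exp_weight)
        fix x :: real assume x: "x \<ge> 0"
        show "summable (\<lambda>n. norm (c n * poly (laguerre n * laguerre m) x))"
          using summable_mult2[OF sumx[OF x], of "\<bar>poly (laguerre m) x\<bar>"] by (simp add: abs_mult mult.assoc)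
      qed
      show "summable (\<lambda>n. \<integral>x. norm (c n * poly (laguerre n * laguerre m) x) \<partial>exp_weight)"
      proof (rule summable_comparison_test)
        show "summable (\<lambda>n. Mn n * (E * 4))" by (rule summable_mult2[OF sM])
        have "\<bar>\<integral>x. norm (c n * poly (laguerre n * laguerre m) x) \<partial>exp_weight\<bar> \<le> (Mn n * E) / (1 - 3/4)" for n
          by (rule integral_exp_weight_exp_bound) (use bd in \<open>auto simp: abs_mult\<close>)
        then show "\<exists>N. \<forall>n\<ge>N. norm (\<integral>x. norm (c n * poly (laguerre n * laguerre m) x) \<partial>exp_weight) \<le> Mn n * (E * 4)"
          by (simp add: mult.assoc)
      qed
    qed
    moreover have "(\<integral>x. c n * poly (laguerre n * laguerre m) x \<partial>exp_weight) = (if n = m then c m else 0)" for n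
      using laguerre_orthogonal[of n m] laguerre_normalized[of m] by (simp del: poly_mult)
    moreover have "(\<integral>x. (\<Sum>n. c n * poly (laguerre n * laguerre m) x) \<partial>exp_weight) = (\<integral>x. f x * poly (laguerre m) x \<partial>exp_weight)"
    proof (rule integral_cong_AE)
      show "AE x in exp_weight. (\<Sum>n. c n * poly (laguerre n * laguerre m) x) = f x * poly (laguerre m) x"
      proof (rule AE_exp_weight)
        fix x :: real assume x: "x \<ge> 0"
        show "(\<Sum>n. c n * poly (laguerre n * laguerre m) x) = f x * poly (laguerre m) x"
          unfolding f_def using suminf_mult2[OF summable_rabs_cancel[OF sumx[OF x]], of "poly (laguerre m) x"]
          by (simp add: mult.assoc)
      qed
    qed auto
    ultimately have "(\<lambda>n. if n = m then c m else 0) sums (\<integral>x. f x * poly (laguerre m) x \<partial>exp_weight)" by simp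
    moreover have "(\<lambda>n. if n = m then c m else 0) sums c m"
      using sums_single[of m "\<lambda>_. c m"] by (simp add: if_distrib)
    ultimately show ?thesis using sums_unique2 by blast
  qed
  have gL: "(\<integral>x. g x * poly (laguerre m) x \<partial>exp_weight) = 0" for m
  proof -
    have i: "integrable exp_weight (\<lambda>x. D 0 x * poly (laguerre m) x)" "integrable exp_weight (\<lambda>x. f x * poly (laguerre m) x)"
      by (rule gi[OF _ Db], simp_all) (rule gi[OF _ fb], simp_all)
    have "(\<integral>x. g x * poly (laguerre m) x \<partial>exp_weight) = (\<integral>x. D 0 x * poly (laguerre m) x - f x * poly (laguerre m) x \<partial>exp_weight)"
      by (simp add: g_def left_diff_distrib)
    also have "\<dots> = c m - c m" using i by (simp add: fL c_def)
    finally show ?thesis by simp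
  qed
  \<comment> \<open>From Laguerre coefficients to moments: the recurrence moves one factor
    \<open>x\<close> at a time into the index, and \<open>m = 0\<close> at the end gives the plain
    moments.\<close>
  have gxL: "(\<integral>x. g x * x ^ j * poly (laguerre m) x \<partial>exp_weight) = 0" for j m
  proof (induction j arbitrary: m)
    case 0
    then show ?case using gL by simp
  next
    case (Suc j)
    have i: "integrable exp_weight (\<lambda>x. g x * x ^ j * poly (laguerre k) x)" for k
      using gi[OF _ gb, of "monom 1 j * laguerre k"] by (simp add: poly_monom mult.assoc)
    have "g x * x ^ Suc j * poly (laguerre m) x = (2 * real m + 1) * (g x * x ^ j * poly (laguerre m) x)
      - (real m + 1) * (g x * x ^ j * poly (laguerre (Suc m)) x) - real m * (g x * x ^ j * poly (laguerre (m - 1)) x)" for x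
    proof -
      have "g x * x ^ Suc j * poly (laguerre m) x = g x * x ^ j * (x * poly (laguerre m) x)" by simp
      also have "\<dots> = (2 * real m + 1) * (g x * x ^ j * poly (laguerre m) x)
      - (real m + 1) * (g x * x ^ j * poly (laguerre (Suc m)) x) - real m * (g x * x ^ j * poly (laguerre (m - 1)) x)"
        unfolding laguerre_rec by (simp add: algebra_simps)
      finally show ?thesis .
    qed
    then show ?case using Suc.IH i by (simp del: power_Suc)
  qed
  have "g x0 = 0"
  proof (rule exp_weight_complete[OF _ _ gb _ x0])
    show "continuous_on {0..} g"
      unfolding g_def by (intro continuous_intros contf continuous_on_subset[OF contD]) auto
    show "(\<integral>x. g x * x ^ j \<partial>exp_weight) = 0" for j using gxL[of j 0] by simp
  qed auto
  then have "D 0 x0 = f x0" by (simp add: g_def)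
  then show ?thesis
    using summable_sums[OF summable_rabs_cancel[OF sumx[OF x0]]] by (simp add: f_def)
qed

section \<open>Gauss--Laguerre quadrature\<close>

lemma integral_exp_weight_power: "(\<integral>x. x ^ j \<partial>exp_weight) = fact j"
proof -
  have "(\<integral>\<^sup>+x. ennreal (x ^ j) \<partial>exp_weight)
      = (\<integral>\<^sup>+x. ennreal (indicator {0..} x * exp (- x)) * ennreal (x ^ j) \<partial>lborel)"
    unfolding exp_weight_def by (rule nn_integral_density) measurable
  also have "\<dots> = (\<integral>\<^sup>+x. ennreal (x ^ j * exp (- x)) * indicator {0..} x \<partial>lborel)"
    by (rule nn_integral_cong) (simp add: indicator_def ennreal_mult' mult.commute)
  also have "\<dots> = ennreal (fact j)"
    using nn_intergal_power_times_exp_Ici[of j] by simp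
  finally show ?thesis
    using nn_integral_eq_integrable[of "\<lambda>x. x ^ j" exp_weight "fact j"]
      AE_exp_weight[of "\<lambda>x. 0 \<le> x ^ j"] by auto
qed

lemma gauss_laguerre_exact:
  assumes "gauss_laguerre K x w" "degree p < 2 * K"
  shows "(\<Sum>k=1..K. w k * poly p (x k)) = integral\<^sup>L exp_weight (poly p)"
proof -
  have mono: "(\<Sum>k=1..K. w k * x k ^ j) = (\<integral>s. s ^ j \<partial>exp_weight)" if "j < 2 * K" for j
  proof -
    have "poly (monom 1 j) = (\<lambda>s::real. s ^ j)" by (auto simp: poly_monom)
    then have i: "integrable exp_weight (\<lambda>s. s ^ j)" using integrable_exp_weight_poly[of "monom 1 j"] by simp
    have m: "(\<lambda>s::real. s ^ j) \<in> borel_measurable borel" by measurable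
    have "set_integrable lborel {0..} (\<lambda>s::real. exp (- s) * s ^ j)"
      using i integrable_exp_weight_iff[OF m] by simp
    then have "integral\<^sup>L exp_weight (\<lambda>s. s ^ j) = integral {0..} (\<lambda>s::real. exp (- s) * s ^ j)"
      unfolding integral_exp_weight_eq[OF m] by (rule set_borel_integral_eq_integral)
    moreover have "((\<lambda>s. s ^ j * exp (- s)) has_integral (\<Sum>k=1..K. w k * x k ^ j)) {0..}"
      using assms(1) that unfolding gauss_laguerre_def by blast
    ultimately show ?thesis by (simp add: integral_unique mult.commute)
  qed
  have "(\<Sum>k=1..K. w k * poly p (x k)) = (\<Sum>i\<le>degree p. coeff p i * (\<Sum>k=1..K. w k * x k ^ i))"
    unfolding poly_altdef sum_distrib_left by (subst sum.swap) (simp add: mult_ac)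
  also have "\<dots> = (\<Sum>i\<le>degree p. coeff p i * integral\<^sup>L exp_weight (poly (monom 1 i)))"
  proof (intro sum.cong refl)
    fix i assume "i \<in> {..degree p}"
    moreover have "poly (monom 1 i) = (\<lambda>s::real. s ^ i)" by (auto simp: poly_monom)
    ultimately show "coeff p i * (\<Sum>k=1..K. w k * x k ^ i) = coeff p i * integral\<^sup>L exp_weight (poly (monom 1 i))"
      using mono[of i] assms(2) by simp
  qed
  also have "\<dots> = integral\<^sup>L exp_weight (poly (\<Sum>i\<le>degree p. smult (coeff p i) (monom 1 i)))"
    by (simp only: integral_exp_weight_poly_sum integral_exp_weight_poly_linear)
  also have "(\<Sum>i\<le>degree p. smult (coeff p i) (monom 1 i)) = p"
    using poly_as_sum_of_monoms[of p] by (simp only: smult_monom mult_1_right)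
  finally show ?thesis .
qed

text \<open>Exactness is tested on \<open>P * P\<close>, \<open>x * P * P\<close> and
  \<open>laguerre K * P\<close>, where \<open>P\<close> vanishes at all other nodes; their degrees
  are at most \<open>2 * K - 1\<close>. These give the sign of the weight, the sign of the node, and
  that the node is a zero of \<open>laguerre K\<close>, hence below \<open>4 * K - 2\<close>. The
  case \<open>w k = 0\<close> is kept as an alternative, as such a node adds nothing to any weighted
  sum.\<close>

lemma gauss_laguerre_node:
  assumes gl: "gauss_laguerre K x w" and k: "k \<in> {1..K}"
  shows "w k = 0 \<or> (w k > 0 \<and> 0 \<le> x k \<and> x k \<le> 4 * real K - 2)"
proof -
  define P where "P = (\<Prod>j\<in>{1..K} - {k}. [:- x j, 1:])"
  have inj: "inj_on x {1..K}" 
    by (rule strict_mono_on_imp_inj_on[OF conjunct1[OF gl[unfolded gauss_laguerre_def]]])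
  have Pi: "poly P (x i) = 0" if "i \<in> {1..K}" "i \<noteq> k" for i
    using that by (auto simp: P_def poly_prod)
  have Pk: "poly P (x k) \<noteq> 0"
  proof -
    have "x k \<noteq> x j" if "j \<in> {1..K} - {k}" for j
      using inj_on_eq_iff[OF inj, of k j] that k by blast
    then show ?thesis by (simp add: P_def poly_prod)
  qed
  have dP: "degree P \<le> K - 1"
  proof -
    have "degree P \<le> (\<Sum>j\<in>{1..K} - {k}. degree [:- x j, 1:])"
      unfolding P_def using degree_prod_sum_le[of "{1..K} - {k}" "\<lambda>j. [:- x j, 1:]"] by (simp add: o_def)
    also have "\<dots> = K - 1" using k by simp
    finally show ?thesis .
  qed
  have K: "K \<ge> 1" using k by auto
  have ev: "w k * poly q (x k) * poly P (x k) = integral\<^sup>L exp_weight (poly (q * P))" if "degree q \<le> K" for q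
  proof -
    have "degree (q * P) < 2 * K"
      using degree_mult_le[of q P] that dP K by linarith
    then have "integral\<^sup>L exp_weight (poly (q * P)) = (\<Sum>i=1..K. w i * poly (q * P) (x i))"
      by (rule gauss_laguerre_exact[OF gl, symmetric])
    also have "\<dots> = w k * poly (q * P) (x k) + (\<Sum>i\<in>{1..K} - {k}. w i * poly (q * P) (x i))"
      using k by (intro sum.remove) auto
    also have "(\<Sum>i\<in>{1..K} - {k}. w i * poly (q * P) (x i)) = 0"
      using Pi by (intro sum.neutral) auto
    finally show ?thesis by (metis add_0_right mult.assoc poly_mult)
  qed
  have P2: "(poly P (x k))\<^sup>2 > 0" using Pk by simp
  have "w k * (poly P (x k))\<^sup>2 = integral\<^sup>L exp_weight (poly (P * P))"
  proof -
    have "degree P \<le> K" using dP by linarith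
    from ev[OF this] show ?thesis by (simp add: power2_eq_square mult.assoc del: poly_mult)
  qed
  also have "\<dots> \<ge> 0" by (rule integral_nonneg_AE) (auto intro: AE_exp_weight)
  finally have w: "w k \<ge> 0" using P2 by (simp add: zero_le_mult_iff)
  have "w k * x k * (poly P (x k))\<^sup>2 = integral\<^sup>L exp_weight (poly (pCons 0 P * P))"
  proof -
    have "degree (pCons 0 P) \<le> K" using dP K degree_pCons_le[of 0 P] by linarith
    from ev[OF this] show ?thesis by (simp add: power2_eq_square mult_ac)
  qed
  also have "\<dots> \<ge> 0"
  proof (rule integral_nonneg_AE, rule AE_exp_weight)
    fix y :: real assume "y \<ge> 0"
    moreover have "poly (pCons 0 P * P) y = y * (poly P y)\<^sup>2" by (simp add: power2_eq_square)
    ultimately show "0 \<le> poly (pCons 0 P * P) y" by simp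
  qed
  finally have wx: "w k * x k \<ge> 0" using P2 by (simp add: zero_le_mult_iff)
  have "w k * poly (laguerre K) (x k) * poly P (x k) = integral\<^sup>L exp_weight (poly (P * laguerre K))"
    using ev[of "laguerre K"] degree_laguerre_le by (simp only: mult.commute[of P])
  also have "\<dots> = 0" by (rule laguerre_orthogonal_low_degree) (use dP K in linarith)
  finally have "w k = 0 \<or> poly (laguerre K) (x k) = 0" using Pk by simp
  moreover have "poly (laguerre K) (x k) = 0 \<Longrightarrow> x k < 4 * real K - 2"
    using laguerre_nonzero_large[of K "x k"] by argo
  ultimately show ?thesis using w wx by (auto simp: zero_le_mult_iff)
qed

text \<open>In the series of \<open>(m - y) * exp y\<close> the coefficient of
  \<open>y ^ j / fact j\<close> is \<open>m - j\<close>: nonpositive from \<open>j = m\<close> on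
  and at most \<open>m\<close> before. The factor \<open>m - y\<close> is at least 1.\<close>

lemma exp_le_partial_sum:
  assumes "0 \<le> y" "y \<le> real m - 1"
  shows "exp y \<le> real m * (\<Sum>j<m. y ^ j / fact j)"
proof -
  have e: "(\<lambda>j. y ^ j / fact j) sums exp y"
    using exp_converges[of y] by (simp add: divide_inverse mult.commute)
  have "(\<lambda>j. real (Suc j) * (y ^ Suc j / fact (Suc j))) sums (y * exp y)"
    using sums_mult[OF e, of y] by (simp add: field_simps del: of_nat_Suc)
  then have "(\<lambda>j. real j * (y ^ j / fact j)) sums (y * exp y)"
    using sums_Suc[of "\<lambda>j. real j * (y ^ j / fact j)" "y * exp y"] by simp
  from sums_diff[OF sums_mult[OF e, of "real m"] this]
  have s: "(\<lambda>j. (real m - real j) * (y ^ j / fact j)) sums ((real m - y) * exp y)"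
    by (simp only: left_diff_distrib)
  have fin: "(\<lambda>j. if j \<in> {..<m} then real m * (y ^ j / fact j) else 0) sums (\<Sum>j<m. real m * (y ^ j / fact j))"
    by (rule sums_If_finite_set) simp
  have "(real m - y) * exp y \<le> (\<Sum>j<m. real m * (y ^ j / fact j))"
  proof (rule sums_le[OF _ s fin])
    fix j
    have "y ^ j / fact j \<ge> 0" using assms by simp
    then show "(real m - real j) * (y ^ j / fact j) \<le> (if j \<in> {..<m} then real m * (y ^ j / fact j) else 0)"
      by (auto intro: mult_right_mono mult_nonpos_nonneg simp del: times_divide_eq_right)
  qed
  moreover have "1 * exp y \<le> (real m - y) * exp y" using assms by (intro mult_right_mono) auto
  ultimately show ?thesis unfolding sum_distrib_left by linarith
qed

text \<open>By the node bound \<open>x k / 2 \<le> 2 * K - 1\<close>, so the Taylor polynomial of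
  degree \<open>2 * K - 1\<close> dominates the exponential up to the factor \<open>2 * K\<close>,
  and the rule integrates it exactly. Moments \<open>fact j\<close> reduce it to a geometric sum
  below 2.\<close>

lemma gauss_laguerre_exp_half:
  assumes gl: "gauss_laguerre K x w"
  shows "(\<Sum>k=1..K. w k * exp (x k / 2)) \<le> 4 * real K"
proof -
  have "(\<Sum>k=1..K. w k * exp (x k / 2))
      \<le> (\<Sum>k=1..K. w k * (real (2 * K) * (\<Sum>j<2 * K. (x k / 2) ^ j / fact j)))"
  proof (rule sum_mono)
    fix k assume "k \<in> {1..K}"
    with gauss_laguerre_node[OF gl this]
    show "w k * exp (x k / 2) \<le> w k * (real (2 * K) * (\<Sum>j<2 * K. (x k / 2) ^ j / fact j))"
      by (elim disjE) (auto intro!: mult_left_mono exp_le_partial_sum[of "x k / 2" "2 * K"] simp del: of_nat_mult)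
  qed
  also have "\<dots> = real (2 * K) * (\<Sum>j<2 * K. (1/2) ^ j / fact j * (\<Sum>k=1..K. w k * x k ^ j))"
    unfolding sum_distrib_left by (subst sum.swap) (simp add: power_divide mult_ac)
  also have "\<dots> = real (2 * K) * (\<Sum>j<2 * K. (1/2) ^ j)"
  proof (intro arg_cong[where f = "\<lambda>z. real (2 * K) * z"] sum.cong refl)
    fix j assume j: "j \<in> {..<2 * K}"
    have "poly (monom 1 j) = (\<lambda>s::real. s ^ j)" by (auto simp: poly_monom)
    then have "(\<Sum>k=1..K. w k * x k ^ j) = fact j"
      using gauss_laguerre_exact[OF gl, of "monom 1 j"] j integral_exp_weight_power[of j] by (simp add: degree_monom_eq)
    then show "(1/2) ^ j / fact j * (\<Sum>k=1..K. w k * x k ^ j) = (1/2) ^ j" by simp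
  qed
  also have "\<dots> \<le> real (2 * K) * 2"
  proof (rule mult_left_mono)
    have "(\<Sum>j<2 * K. (1/2::real) ^ j) \<le> (\<Sum>j. (1/2) ^ j)"
      by (intro sum_le_suminf summable_geometric) auto
    then show "(\<Sum>j<2 * K. (1/2::real) ^ j) \<le> 2" by (simp add: suminf_geometric)
  qed auto
  finally show ?thesis by simp
qed

section \<open>Quadrature error for smooth integrands\<close>

lemma tail_suminf_bound:
  fixes t b :: "nat \<Rightarrow> real"
  assumes t: "t sums s" and b: "summable b" "\<And>n. b n \<ge> 0" and A: "A \<ge> 0"
    and tb: "\<And>n. n \<ge> N \<Longrightarrow> \<bar>t n\<bar> \<le> A * b n"
  shows "\<bar>s - (\<Sum>n<N. t n)\<bar> \<le> A * suminf b"
proof -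
  have sb: "summable (\<lambda>n. b (n + N))" using b(1) by (rule summable_ignore_initial_segment)
  have st: "summable (\<lambda>n. \<bar>t (n + N)\<bar>)"
    by (rule summable_comparison_test[OF _ summable_mult[OF sb, of A]]) (use tb in auto)
  have "s - (\<Sum>n<N. t n) = (\<Sum>n. t (n + N))"
    using sums_split_initial_segment[OF t, of N] sums_unique by metis
  then have "\<bar>s - (\<Sum>n<N. t n)\<bar> \<le> (\<Sum>n. \<bar>t (n + N)\<bar>)" using summable_rabs[OF st] by simp
  also have "\<dots> \<le> (\<Sum>n. A * b (n + N))" by (rule suminf_le[OF _ st summable_mult[OF sb]]) (use tb in auto)
  also have "\<dots> = A * (\<Sum>n. b (n + N))" by (rule suminf_mult[OF sb])
  also have "(\<Sum>n. b (n + N)) = suminf b - (\<Sum>n<N. b n)"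
    using suminf_minus_initial_segment[OF b(1), of N] by simp
  also have "A * (suminf b - (\<Sum>n<N. b n)) \<le> A * suminf b"
    using A b(2) by (intro mult_left_mono) (auto intro: sum_nonneg)
  finally show ?thesis .
qed

text \<open>\<open>C\<close> depends only on the derivative bounds \<open>B\<close> and on
  \<open>p\<close>, not on the integrand, which is essential for the later families indexed by
  time.\<close>

theorem gauss_laguerre_error:
  fixes B :: "nat \<Rightarrow> real" and p :: real
  shows "\<exists>C\<ge>0. \<forall>D K x w. (\<forall>j x. (D j has_real_derivative D (Suc j) x) (at x)) \<longrightarrow>
      (\<forall>j x. x \<ge> 0 \<longrightarrow> \<bar>D j x\<bar> \<le> B j) \<longrightarrow> K \<ge> 1 \<longrightarrow> gauss_laguerre K x w \<longrightarrow>
      \<bar>integral\<^sup>L exp_weight (D 0) - (\<Sum>k=1..K. w k * D 0 (x k))\<bar> \<le> C * real K powr (- p)"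
proof -
  \<comment> \<open>The extra 1 pays for the factor \<open>4 * K\<close> of
    \<open>gauss_laguerre_exp_half\<close>; the 4 added below pays for two factors
    \<open>n + 1\<close> and a summable \<open>1 / n ^ 2\<close>.\<close>
  define r where "r = nat \<lceil>p\<rceil> + 1"
  obtain C where C: "C \<ge> 0" "\<And>D n. (\<And>j x. (D j has_real_derivative D (Suc j) x) (at x)) \<Longrightarrow>
      (\<And>j x. x \<ge> 0 \<Longrightarrow> \<bar>D j x\<bar> \<le> B j * (1 + x) ^ 0) \<Longrightarrow>
      real n ^ (r + 4) * \<bar>\<integral>x. D 0 x * poly (laguerre n) x \<partial>exp_weight\<bar> \<le> C * (real n + 1)"
    using laguerre_coeff_decay[of B 0 "r + 4"] by blast
  define b where "b n = 1 / real n ^ 2" for n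
  have b: "summable b" "\<And>n. b n \<ge> 0"
    using inverse_power_summable[of 2, where 'a = real] by (simp_all add: b_def[abs_def] inverse_eq_divide)
  define C' where "C' = 32 * C * suminf b"
  have C'0: "C' \<ge> 0" unfolding C'_def using C(1) b by (simp add: suminf_nonneg)
  have "\<bar>integral\<^sup>L exp_weight (D 0) - (\<Sum>k=1..K. w k * D 0 (x k))\<bar> \<le> C' * real K powr (- p)"
    if D: "\<And>j x. (D j has_real_derivative D (Suc j) x) (at x)"
      and Db: "\<And>j x. x \<ge> 0 \<Longrightarrow> \<bar>D j x\<bar> \<le> B j" and K: "K \<ge> 1" and gl: "gauss_laguerre K x w" for D K x w
  proof -
    have Db': "\<bar>D j x\<bar> \<le> B j * (1 + x) ^ 0" if "x \<ge> 0" for j x using Db[OF that] by simp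
    define c where "c n = (\<integral>x. D 0 x * poly (laguerre n) x \<partial>exp_weight)" for n
    define A where "A = 8 * C / real K ^ r"
    have A0: "A \<ge> 0" using C(1) by (simp add: A_def)
    have cn: "\<bar>c n\<bar> * (2 * (real n + 1)) \<le> A * b n" if n: "n \<ge> 2 * K" for n
    proof -
      have n1: "real n \<ge> 1" using n K by linarith
      have "real n ^ (r + 4) * (\<bar>c n\<bar> * (2 * (real n + 1))) = (real n ^ (r + 4) * \<bar>c n\<bar>) * (2 * (real n + 1))"
        by (simp only: mult_ac)
      also have "\<dots> \<le> (C * (real n + 1)) * (2 * (real n + 1))"
        using C(2)[OF D Db', where n = n] n1 unfolding c_def by (intro mult_right_mono) auto
      also have "\<dots> \<le> (C * (2 * real n)) * (2 * (2 * real n))"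
        using n1 C(1) by (intro mult_mono) auto
      also have "\<dots> = 8 * C * real n ^ 2" by (simp add: power2_eq_square)
      finally have "real n ^ (r + 4) * (\<bar>c n\<bar> * (2 * (real n + 1))) \<le> 8 * C * real n ^ 2" .
      then have "\<bar>c n\<bar> * (2 * (real n + 1)) \<le> 8 * C * real n ^ 2 / real n ^ (r + 4)"
        using n1 by (simp add: pos_le_divide_eq mult.commute)
      also have "\<dots> = (8 * C / real n ^ r) * (1 / real n ^ 2)"
        using n1 by (simp add: power_add power4_eq_xxxx power2_eq_square)
      also have "\<dots> \<le> (8 * C / real K ^ r) * (1 / real n ^ 2)"
        using n K C(1) by (intro mult_right_mono divide_left_mono power_mono) auto
      finally show ?thesis by (simp add: A_def b_def)
    qed
    have node: "w k * \<bar>D 0 (x k) - (\<Sum>n<2 * K. c n * poly (laguerre n) (x k))\<bar> \<le> (A * suminf b) * (w k * exp (x k / 2))"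
      if k: "k \<in> {1..K}" for k
    proof (cases "w k = 0")
      case False
      then have wk: "w k > 0" "x k \<ge> 0" using gauss_laguerre_node[OF gl k] by auto
      have "\<bar>D 0 (x k) - (\<Sum>n<2 * K. c n * poly (laguerre n) (x k))\<bar> \<le> (A * exp (x k / 2)) * suminf b"
      proof (rule tail_suminf_bound[OF _ b])
        show "(\<lambda>n. c n * poly (laguerre n) (x k)) sums D 0 (x k)"
          unfolding c_def by (rule exp_weight_expansion[where D = D, OF D Db' wk(2)])
        fix n assume n: "2 * K \<le> n"
        have "\<bar>c n * poly (laguerre n) (x k)\<bar> \<le> \<bar>c n\<bar> * (2 * (real n + 1) * exp (x k / 2))"
          unfolding abs_mult using laguerre_bound[OF wk(2)] by (intro mult_left_mono) auto
        also have "\<dots> = (\<bar>c n\<bar> * (2 * (real n + 1))) * exp (x k / 2)" by (simp only: mult_ac)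
        also have "\<dots> \<le> (A * b n) * exp (x k / 2)" using cn[OF n] by (intro mult_right_mono) auto
        finally show "\<bar>c n * poly (laguerre n) (x k)\<bar> \<le> (A * exp (x k / 2)) * b n" by (simp only: mult_ac)
      qed (use A0 in auto)
      then have "w k * \<bar>D 0 (x k) - (\<Sum>n<2 * K. c n * poly (laguerre n) (x k))\<bar> \<le> w k * ((A * exp (x k / 2)) * suminf b)"
        using wk by (intro mult_left_mono) auto
      then show ?thesis by (simp only: mult_ac)
    qed simp
    have wnn: "w k \<ge> 0" if "k \<in> {1..K}" for k using gauss_laguerre_node[OF gl that] by auto
    have low: "(\<Sum>k=1..K. w k * (\<Sum>n<2 * K. c n * poly (laguerre n) (x k))) = integral\<^sup>L exp_weight (D 0)"
    proof -
      have "(\<Sum>k=1..K. w k * (\<Sum>n<2 * K. c n * poly (laguerre n) (x k)))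
          = (\<Sum>n<2 * K. c n * (\<Sum>k=1..K. w k * poly (laguerre n) (x k)))"
        unfolding sum_distrib_left by (subst sum.swap) (simp only: mult_ac)
      also have "\<dots> = (\<Sum>n<2 * K. if n = 0 then c 0 else 0)"
      proof (intro sum.cong refl)
        fix n assume n: "n \<in> {..<2 * K}"
        then have "(\<Sum>k=1..K. w k * poly (laguerre n) (x k)) = integral\<^sup>L exp_weight (poly (laguerre n))"
          using gauss_laguerre_exact[OF gl, of "laguerre n"] degree_laguerre_le[of n] by simp
        then show "c n * (\<Sum>k=1..K. w k * poly (laguerre n) (x k)) = (if n = 0 then c 0 else 0)"
          using laguerre_orthogonal[of n 0] laguerre_normalized[of 0] by (cases "n = 0") (simp_all del: poly_mult)
      qed
      also have "\<dots> = c 0" using K by (simp add: sum.delta)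
      finally show ?thesis by (simp add: c_def)
    qed
    \<comment> \<open>By \<open>low\<close> the first \<open>2 * K\<close> terms reproduce the
      integral exactly, so the error is the rule applied to the tail of the expansion.\<close>
    have "integral\<^sup>L exp_weight (D 0) - (\<Sum>k=1..K. w k * D 0 (x k))
        = - (\<Sum>k=1..K. w k * (D 0 (x k) - (\<Sum>n<2 * K. c n * poly (laguerre n) (x k))))"
      unfolding right_diff_distrib sum_subtractf low by simp
    then have "\<bar>integral\<^sup>L exp_weight (D 0) - (\<Sum>k=1..K. w k * D 0 (x k))\<bar>
        = \<bar>\<Sum>k=1..K. w k * (D 0 (x k) - (\<Sum>n<2 * K. c n * poly (laguerre n) (x k)))\<bar>" by simp
    also have "\<dots> \<le> (\<Sum>k=1..K. w k * \<bar>D 0 (x k) - (\<Sum>n<2 * K. c n * poly (laguerre n) (x k))\<bar>)"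
      using wnn by (intro order.trans[OF sum_abs]) (auto simp: abs_mult intro!: sum_mono mult_right_mono)
    also have "\<dots> \<le> (\<Sum>k=1..K. (A * suminf b) * (w k * exp (x k / 2)))"
      by (intro sum_mono node)
    also have "\<dots> = (A * suminf b) * (\<Sum>k=1..K. w k * exp (x k / 2))" by (simp only: sum_distrib_left)
    also have "\<dots> \<le> (A * suminf b) * (4 * real K)"
      using A0 b by (intro mult_left_mono gauss_laguerre_exp_half[OF gl]) (simp add: suminf_nonneg)
    also have "\<dots> = C' * (1 / real K ^ nat \<lceil>p\<rceil>)"
      using K by (simp add: A_def C'_def r_def field_simps)
    also have "\<dots> \<le> C' * real K powr (- p)"
    proof (rule mult_left_mono[OF _ C'0])
      have "p \<le> real (nat \<lceil>p\<rceil>)" by linarith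
      then have "real K powr p \<le> real K powr real (nat \<lceil>p\<rceil>)" using K by (intro powr_mono) auto
      also have "\<dots> = real K ^ nat \<lceil>p\<rceil>" using K by (simp add: powr_realpow)
      finally show "1 / real K ^ nat \<lceil>p\<rceil> \<le> real K powr - p"
        using K by (simp add: powr_minus inverse_eq_divide frac_le)
    qed
    finally show ?thesis .
  qed
  then show ?thesis using C'0 by blast
qed

section \<open>The transformed kernels\<close>

text \<open>\<open>H j\<close> is the \<open>j\<close>-th iterate of \<open>r d/dr\<close> on
  \<open>H 0\<close>. Along \<open>r = s * exp (l * y)\<close> the \<open>y\<close>-derivative is
  \<open>l\<close> times that operator, so the derivative bounds are
  \<open>\<bar>l\<bar> ^ j * B j\<close>, the same for every scale \<open>s\<close>.\<close>

lemma gauss_laguerre_error_log_scale: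
  fixes H :: "nat \<Rightarrow> real \<Rightarrow> real" and l p :: real
  assumes H: "\<And>j r. r > 0 \<Longrightarrow> (H j has_real_derivative H (Suc j) r / r) (at r)"
    and Hb: "\<And>j. \<exists>B. \<forall>r>0. \<bar>H j r\<bar> \<le> B"
  shows "\<exists>C\<ge>0. \<forall>s>0. \<forall>K\<ge>1. \<forall>x w. gauss_laguerre K x w \<longrightarrow>
      \<bar>(\<integral>y. H 0 (s * exp (l * y)) \<partial>exp_weight) - (\<Sum>k=1..K. w k * H 0 (s * exp (l * x k)))\<bar> \<le> C * real K powr (- p)"
proof -
  obtain B where B: "\<And>j r. r > 0 \<Longrightarrow> \<bar>H j r\<bar> \<le> B j" using Hb by metis
  obtain C where C: "C \<ge> 0" "\<And>D K x w. (\<And>j x. (D j has_real_derivative D (Suc j) x) (at x)) \<Longrightarrow>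
      (\<And>j x. x \<ge> 0 \<Longrightarrow> \<bar>D j x\<bar> \<le> \<bar>l\<bar> ^ j * B j) \<Longrightarrow> K \<ge> 1 \<Longrightarrow> gauss_laguerre K x w \<Longrightarrow>
      \<bar>integral\<^sup>L exp_weight (D 0) - (\<Sum>k=1..K. w k * D 0 (x k))\<bar> \<le> C * real K powr (- p)"
    using gauss_laguerre_error[of "\<lambda>j. \<bar>l\<bar> ^ j * B j" p] by blast
  show ?thesis
  proof (intro exI[of _ C] conjI allI impI C(1))
    fix s :: real and K x w
    assume s: "s > 0" and K: "K \<ge> 1" and gl: "gauss_laguerre K x w"
    define D where "D j y = l ^ j * H j (s * exp (l * y))" for j y
    have "\<bar>integral\<^sup>L exp_weight (D 0) - (\<Sum>k=1..K. w k * D 0 (x k))\<bar> \<le> C * real K powr (- p)"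
    proof (rule C(2)[OF _ _ K gl])
      fix j y
      have r: "s * exp (l * y) > 0" using s by simp
      have "((\<lambda>y. H j (s * exp (l * y))) has_real_derivative
          H (Suc j) (s * exp (l * y)) / (s * exp (l * y)) * (s * (exp (l * y) * l))) (at y)"
        by (rule DERIV_chain2[where f = "H j" and g = "\<lambda>y. s * exp (l * y)"])
           (use H[OF r] in \<open>auto intro!: derivative_eq_intros\<close>)
      moreover have "H (Suc j) (s * exp (l * y)) / (s * exp (l * y)) * (s * (exp (l * y) * l))
          = l * H (Suc j) (s * exp (l * y))" using s by simp
      ultimately have "((\<lambda>y. H j (s * exp (l * y))) has_real_derivative l * H (Suc j) (s * exp (l * y))) (at y)"
        by simp
      from DERIV_cmult[OF this, of "l ^ j"]
      show "(D j has_real_derivative D (Suc j) y) (at y)"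
        unfolding D_def by (simp add: mult.assoc mult.left_commute)
      show "\<bar>D j y\<bar> \<le> \<bar>l\<bar> ^ j * B j"
        unfolding D_def abs_mult power_abs using B[OF r, of j] by (intro mult_left_mono) auto
    qed
    then show "\<bar>(\<integral>y. H 0 (s * exp (l * y)) \<partial>exp_weight) - (\<Sum>k=1..K. w k * H 0 (s * exp (l * x k)))\<bar>
        \<le> C * real K powr (- p)"
      by (simp add: D_def[abs_def])
  qed
qed

text \<open>The Euler derivatives \<open>(r d/dr)\<^sup>j\<close> of \<open>exp (- r)\<close> and of \<open>(1 - exp (- r)) / r\<close> both
  have the form \<open>a (-1)\<^sup>j (1 - exp (- r)) / r + Q\<^sub>j(r) exp (- r)\<close> with this recursion for \<open>Q\<^sub>j\<close>.\<close>

primrec euler_poly :: "real \<Rightarrow> real poly \<Rightarrow> nat \<Rightarrow> real poly" where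
  "euler_poly a Q 0 = Q"
| "euler_poly a Q (Suc j) = [:a * (-1) ^ j:] + pCons 0 (pderiv (euler_poly a Q j) - euler_poly a Q j)"

text \<open>Used with \<open>a = 1, Q = 0\<close> for slow rates and \<open>a = 0, Q = 1\<close> for
  fast ones.\<close>

lemma gauss_laguerre_error_exp_kernels:
  fixes a l p :: real and Q :: "real poly"
  shows "\<exists>C\<ge>0. \<forall>s>0. \<forall>K\<ge>1. \<forall>x w. gauss_laguerre K x w \<longrightarrow>
      (let f = (\<lambda>y. let r = s * exp (l * y) in a * ((1 - exp (- r)) / r) + poly Q r * exp (- r))
       in \<bar>integral\<^sup>L exp_weight f - (\<Sum>k=1..K. w k * f (x k))\<bar> \<le> C * real K powr (- p))"
proof -
  define H where "H j r = a * (-1) ^ j * ((1 - exp (- r)) / r) + poly (euler_poly a Q j) r * exp (- r)" for j r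
  have "\<exists>C\<ge>0. \<forall>s>0. \<forall>K\<ge>1. \<forall>x w. gauss_laguerre K x w \<longrightarrow>
      \<bar>(\<integral>y. H 0 (s * exp (l * y)) \<partial>exp_weight) - (\<Sum>k=1..K. w k * H 0 (s * exp (l * x k)))\<bar> \<le> C * real K powr (- p)"
  proof (rule gauss_laguerre_error_log_scale)
    fix j and r :: real assume r: "r > 0"
    define h where "h = (1 - exp (- r)) / r"
    have "((\<lambda>r. (1 - exp (- r)) / r) has_real_derivative (exp (- r) * r - (1 - exp (- r))) / (r * r)) (at r)"
      using r by (auto intro!: derivative_eq_intros)
    moreover have "(exp (- r) * r - (1 - exp (- r))) / (r * r) = (exp (- r) - h) / r"
      using r by (simp add: h_def field_simps)
    \<comment> \<open>Applying \<open>r d/dr\<close> to \<open>h\<close> gives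
      \<open>exp (- r) - h\<close>: the sign of the \<open>h\<close> part flips, and the leftover
      exponential is the constant term added by \<open>euler_poly\<close>.\<close>
    ultimately have h: "((\<lambda>r. (1 - exp (- r)) / r) has_real_derivative (exp (- r) - h) / r) (at r)" by simp
    have g: "((\<lambda>r. poly (euler_poly a Q j) r * exp (- r)) has_real_derivative
        (poly (pderiv (euler_poly a Q j)) r - poly (euler_poly a Q j) r) * exp (- r)) (at r)"
      by (auto intro!: derivative_eq_intros poly_DERIV simp: algebra_simps)
    have "H (Suc j) r / r = a * (-1) ^ j * ((exp (- r) - h) / r)
        + (poly (pderiv (euler_poly a Q j)) r - poly (euler_poly a Q j) r) * exp (- r)"
      using r unfolding H_def h_def[symmetric] by (simp add: field_simps)
    then show "(H j has_real_derivative H (Suc j) r / r) (at r)"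
      unfolding H_def[of j, abs_def] using DERIV_add[OF DERIV_cmult[OF h, of "a * (-1) ^ j"] g] by simp
  next
    fix j
    obtain C where C: "\<And>r. r \<ge> 0 \<Longrightarrow> \<bar>poly (euler_poly a Q j) r\<bar> \<le> C * exp (1 * r)"
      using poly_bound_exp[of 1 "euler_poly a Q j"] by auto
    have "\<bar>H j r\<bar> \<le> \<bar>a\<bar> + C" if r: "r > 0" for r
    proof -
      have "\<bar>(1 - exp (- r)) / r\<bar> \<le> 1"
        using r exp_ge_add_one_self[of "- r"] by (simp add: abs_if field_simps)
      then have "\<bar>a * (-1) ^ j * ((1 - exp (- r)) / r)\<bar> \<le> \<bar>a\<bar> * 1"
        unfolding abs_mult by (intro mult_mono) (auto simp: power_abs)
      moreover have "\<bar>poly (euler_poly a Q j) r * exp (- r)\<bar> \<le> C * exp (1 * r) * exp (- r)"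
        unfolding abs_mult using C[of r] r by (intro mult_mono) (auto intro: order.trans[OF abs_ge_zero])
      moreover have "C * exp (1 * r) * exp (- r) = C" by (simp add: mult.assoc exp_add[symmetric])
      ultimately show ?thesis unfolding H_def by linarith
    qed
    then show "\<exists>B. \<forall>r>0. \<bar>H j r\<bar> \<le> B" by blast
  qed
  then show ?thesis by (simp add: H_def Let_def)
qed

text \<open>With \<open>v = exp w\<close>, the transformed integrand for the right-hand side \<open>y\<^sup>(\<^sup>m\<^sup>) = 1\<close>, without the
  constant \<open>sin (\<alpha> \<pi>) / \<pi>\<close>: the response \<open>v\<^sup>q\<^sup>-\<^sup>1 (1 - exp (- \<theta> v))\<close> after time \<open>\<theta>\<close>,
  folded to the half-line by \<open>w = - x / q\<close> and \<open>w = x / (1 - q)\<close>.\<close>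

definition step_kernel :: "real \<Rightarrow> real \<Rightarrow> real \<Rightarrow> real" where
  "step_kernel q \<theta> x = 1 / q * ((1 - exp (- \<theta> * exp (- x / q))) / exp (- x / q))
     + 1 / (1 - q) * (1 - exp (- \<theta> * exp (x / (1 - q))))"

lemma integrable_exp_weight_bounded:
  fixes f :: "real \<Rightarrow> real"
  assumes "f \<in> borel_measurable borel" "\<And>x. x \<ge> 0 \<Longrightarrow> \<bar>f x\<bar> \<le> B"
  shows "integrable exp_weight f"
  by (rule integrable_exp_weight_exp_bound[of _ B 0]) (use assms in auto)

text \<open>With \<open>r\<close> the product of \<open>\<theta>\<close> and the rate, the slow
  branch is \<open>\<theta> / q\<close> times \<open>(1 - exp (- r)) / r\<close>, and the fast one
  is a constant minus a multiple of \<open>exp (- r)\<close>. Constants are integrated exactly, and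
  \<open>\<theta> = 0\<close>, excluded by the logarithmic scale, gives the zero kernel.\<close>

lemma step_kernel_error:
  assumes q: "0 < q" "q < 1" and T: "T \<ge> 0"
  shows "\<exists>C\<ge>0. \<forall>\<theta>\<in>{0..T}. \<forall>K\<ge>1. \<forall>x w. gauss_laguerre K x w \<longrightarrow>
      \<bar>integral\<^sup>L exp_weight (step_kernel q \<theta>) - (\<Sum>k=1..K. w k * step_kernel q \<theta> (x k))\<bar> \<le> C * real K powr (- p)"
proof -
  obtain C1 where C1: "C1 \<ge> 0" "\<And>s K x w. s > 0 \<Longrightarrow> K \<ge> 1 \<Longrightarrow> gauss_laguerre K x w \<Longrightarrow>
     \<bar>(\<integral>y. (1 - exp (- (s * exp (- 1 / q * y)))) / (s * exp (- 1 / q * y)) \<partial>exp_weight)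
      - (\<Sum>k=1..K. w k * ((1 - exp (- (s * exp (- 1 / q * x k)))) / (s * exp (- 1 / q * x k))))\<bar> \<le> C1 * real K powr (- p)"
    using gauss_laguerre_error_exp_kernels[of "- 1 / q" 1 0 p] unfolding Let_def by auto
  obtain C2 where C2: "C2 \<ge> 0" "\<And>s K x w. s > 0 \<Longrightarrow> K \<ge> 1 \<Longrightarrow> gauss_laguerre K x w \<Longrightarrow>
     \<bar>(\<integral>y. exp (- (s * exp (1 / (1 - q) * y))) \<partial>exp_weight)
      - (\<Sum>k=1..K. w k * exp (- (s * exp (1 / (1 - q) * x k))))\<bar> \<le> C2 * real K powr (- p)"
    using gauss_laguerre_error_exp_kernels[of "1 / (1 - q)" 0 1 p] unfolding Let_def by auto
  define C where "C = T / q * C1 + 1 / (1 - q) * C2"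
  have C0: "C \<ge> 0" using C1(1) C2(1) q T by (simp add: C_def)
  have "\<bar>integral\<^sup>L exp_weight (step_kernel q \<theta>) - (\<Sum>k=1..K. w k * step_kernel q \<theta> (x k))\<bar> \<le> C * real K powr (- p)"
    if \<theta>: "\<theta> \<in> {0..T}" and K: "K \<ge> 1" and gl: "gauss_laguerre K x w" for \<theta> K x w
  proof (cases "\<theta> = 0")
    case True
    then have "step_kernel q \<theta> = (\<lambda>x. 0)" by (simp add: step_kernel_def fun_eq_iff)
    then show ?thesis using C0 by simp
  next
    case False
    then have \<theta>0: "\<theta> > 0" using \<theta> by simp
    define f1 where "f1 y = (1 - exp (- (\<theta> * exp (- 1 / q * y)))) / (\<theta> * exp (- 1 / q * y))" for y
    define f2 where "f2 y = exp (- (\<theta> * exp (1 / (1 - q) * y)))" for y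
    have eq: "step_kernel q \<theta> y = \<theta> / q * f1 y + (1 / (1 - q) - 1 / (1 - q) * f2 y)" for y
    proof -
      have "\<theta> / q * f1 y = 1 / q * ((1 - exp (- \<theta> * exp (- y / q))) / exp (- y / q))"
        using \<theta>0 by (simp add: f1_def)
      moreover have "1 / (1 - q) - 1 / (1 - q) * f2 y = 1 / (1 - q) * (1 - exp (- \<theta> * exp (y / (1 - q))))"
        by (simp add: f2_def right_diff_distrib)
      ultimately show ?thesis by (simp only: step_kernel_def)
    qed
    have i1: "integrable exp_weight f1"
    proof (rule integrable_exp_weight_bounded)
      show "f1 \<in> borel_measurable borel" unfolding f1_def by measurable
      have "\<bar>(1 - exp (- r)) / r\<bar> \<le> 1" if "r > 0" for r :: real
        using that exp_ge_add_one_self[of "- r"] by (simp add: abs_if field_simps)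
      then show "\<bar>f1 x\<bar> \<le> 1" for x using \<theta>0 by (simp add: f1_def)
    qed
    have i2: "integrable exp_weight f2"
    proof (rule integrable_exp_weight_bounded)
      show "f2 \<in> borel_measurable borel" unfolding f2_def by measurable
      show "\<bar>f2 x\<bar> \<le> 1" for x using \<theta>0 by (simp add: f2_def)
    qed
    have i3: "integrable exp_weight (\<lambda>y::real. c)" for c :: real
      by (rule integrable_exp_weight_bounded[of _ "\<bar>c\<bar>"]) auto
    have one: "integral\<^sup>L exp_weight (\<lambda>y. 1::real) = 1" using integral_exp_weight_power[of 0] by simp
    have w1: "(\<Sum>k=1..K. w k) = 1"
    proof -
      have "poly 1 = (\<lambda>y::real. 1)" by auto
      then show ?thesis using gauss_laguerre_exact[OF gl, of 1] K one by simp
    qed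
    have "integral\<^sup>L exp_weight (step_kernel q \<theta>)
        = \<theta> / q * integral\<^sup>L exp_weight f1 + (1 / (1 - q) - 1 / (1 - q) * integral\<^sup>L exp_weight f2)"
      unfolding eq[abs_def] using i1 i2 i3 one by simp
    moreover have "(\<Sum>k=1..K. w k * step_kernel q \<theta> (x k))
        = \<theta> / q * (\<Sum>k=1..K. w k * f1 (x k)) + (1 / (1 - q) * (\<Sum>k=1..K. w k) - 1 / (1 - q) * (\<Sum>k=1..K. w k * f2 (x k)))"
      unfolding eq sum_distrib_left sum_subtractf[symmetric] sum.distrib[symmetric]
      by (intro sum.cong refl) (simp add: algebra_simps)
    ultimately have "integral\<^sup>L exp_weight (step_kernel q \<theta>) - (\<Sum>k=1..K. w k * step_kernel q \<theta> (x k))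
        = \<theta> / q * (integral\<^sup>L exp_weight f1 - (\<Sum>k=1..K. w k * f1 (x k)))
          - 1 / (1 - q) * (integral\<^sup>L exp_weight f2 - (\<Sum>k=1..K. w k * f2 (x k)))"
      unfolding w1 by (simp add: right_diff_distrib)
    then have "\<bar>integral\<^sup>L exp_weight (step_kernel q \<theta>) - (\<Sum>k=1..K. w k * step_kernel q \<theta> (x k))\<bar>
        \<le> \<bar>\<theta> / q * (integral\<^sup>L exp_weight f1 - (\<Sum>k=1..K. w k * f1 (x k)))\<bar>
          + \<bar>1 / (1 - q) * (integral\<^sup>L exp_weight f2 - (\<Sum>k=1..K. w k * f2 (x k)))\<bar>" by linarith
    also have "\<dots> \<le> T / q * (C1 * real K powr (- p)) + 1 / (1 - q) * (C2 * real K powr (- p))"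
    proof (rule add_mono)
      show "\<bar>\<theta> / q * (integral\<^sup>L exp_weight f1 - (\<Sum>k=1..K. w k * f1 (x k)))\<bar> \<le> T / q * (C1 * real K powr (- p))"
        unfolding abs_mult
      proof (rule mult_mono)
        show "\<bar>\<theta> / q\<bar> \<le> T / q" using q \<theta> by (simp add: divide_right_mono)
        show "\<bar>integral\<^sup>L exp_weight f1 - (\<Sum>k=1..K. w k * f1 (x k))\<bar> \<le> C1 * real K powr (- p)"
          using C1(2)[OF \<theta>0 K gl] unfolding f1_def .
      qed (use q T in auto)
      show "\<bar>1 / (1 - q) * (integral\<^sup>L exp_weight f2 - (\<Sum>k=1..K. w k * f2 (x k)))\<bar> \<le> 1 / (1 - q) * (C2 * real K powr (- p))"
        unfolding abs_mult
      proof (rule mult_mono)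
        show "\<bar>integral\<^sup>L exp_weight f2 - (\<Sum>k=1..K. w k * f2 (x k))\<bar> \<le> C2 * real K powr (- p)"
          using C2(2)[OF \<theta>0 K gl] unfolding f2_def .
      qed (use q in auto)
    qed
    also have "\<dots> = C * real K powr (- p)" by (simp add: C_def distrib_right)
    finally show ?thesis .
  qed
  then show ?thesis using C0 by blast
qed

section \<open>Exact integral of the step kernel\<close>

lemma incomplete_gamma:
  assumes q: "q > (0::real)"
  defines "low \<equiv> \<lambda>r. integral {0..r} (\<lambda>t. t powr (q - 1) * exp (- t))"
  shows "\<And>r. r > 0 \<Longrightarrow> (low has_real_derivative r powr (q - 1) * exp (- r)) (at r)"
    and "(low \<longlongrightarrow> Gamma q) at_top" and "(low \<longlongrightarrow> 0) (at_right 0)"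
proof -
  define g where "g t = t powr (q - 1) * exp (- t)" for t :: real
  have [measurable]: "g \<in> borel_measurable borel" unfolding g_def by measurable
  have Gp: "Gamma q > 0" using q by (rule Gamma_real_pos)
  have "(\<integral>\<^sup>+t. ennreal (indicator {0..} t * g t) \<partial>lborel) = ennreal (Gamma q)"
    unfolding Gamma_conv_nn_integral_real[OF q] g_def by (simp add: exp_minus divide_inverse mult.assoc)
  then have "integrable lborel (\<lambda>t. indicator {0..} t * g t) \<and> integral\<^sup>L lborel (\<lambda>t. indicator {0..} t * g t) = Gamma q"
    using Gp by (intro iffD1[OF nn_integral_eq_integrable]) (auto simp: g_def)
  then have si: "set_integrable lborel {0..} g" and sv: "set_lebesgue_integral lborel {0..} g = Gamma q"
    by (auto simp: set_integrable_def set_lebesgue_integral_def)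
  have sub: "set_integrable lborel {0..r} g" for r
    by (rule set_integrable_subset[OF si]) auto
  have low: "low r = set_lebesgue_integral lborel {0..r} g" for r
    unfolding low_def using set_borel_integral_eq_integral(2)[OF sub[of r]] by (simp add: g_def[abs_def])
  have int: "g integrable_on {0..r}" for r
    using set_borel_integral_eq_integral(1)[OF sub[of r]] .
  show "(low \<longlongrightarrow> Gamma q) at_top"
    unfolding low[abs_def] sv[symmetric] by (rule tendsto_set_lebesgue_integral_at_top[OF _ si]) auto
  show "(low \<longlongrightarrow> 0) (at_right 0)"
  proof -
    have "continuous_on {0..1} low"
      unfolding low_def g_def[symmetric] by (rule indefinite_integral_continuous_1[OF int])
    then have "(low \<longlongrightarrow> low 0) (at 0 within {0..1})" by (auto simp: continuous_on_def)
    moreover have "at 0 within {0..1} = at_right (0::real)"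
      by (rule at_within_Icc_at_right) simp
    ultimately show ?thesis by (simp add: low_def)
  qed
  fix r :: real assume r: "r > 0"
  have "continuous (at r within {0..r + 1}) g"
    unfolding g_def using r by (intro continuous_intros) auto
  then have "(low has_vector_derivative g r) (at r within {0..r + 1})"
    unfolding low_def g_def[symmetric]
    using integral_has_vector_derivative_continuous_at[OF int[of "r + 1"], of r "{}"] r by simp
  moreover have "at r within {0..r + 1} = at r" by (rule at_within_Icc_at) (use r in auto)
  ultimately show "(low has_real_derivative r powr (q - 1) * exp (- r)) (at r)"
    by (simp add: has_real_derivative_iff_has_vector_derivative g_def)
qed

text \<open>Undoing the folding, the two branches are the parts \<open>v < 1\<close> and
  \<open>v > 1\<close> of the integral of \<open>v powr (q - 2) * (1 - exp (- \<theta> * v))\<close>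
  over \<open>v > 0\<close>, which scales like \<open>\<theta> powr (1 - q)\<close>.\<close>

lemma integral_step_kernel:
  assumes q: "0 < q" "q < 1" and \<theta>: "\<theta> > 0"
  shows "integral\<^sup>L exp_weight (step_kernel q \<theta>) = \<theta> powr (1 - q) * Gamma q / (1 - q)"
proof -
  define low where "low r = integral {0..r} (\<lambda>t. t powr (q - 1) * exp (- t))" for r
  note low = incomplete_gamma[OF q(1), folded low_def[abs_def]]
  \<comment> \<open>An antiderivative of \<open>r powr (q - 2) * (1 - exp (- r))\<close> found by
    parts; what remains is the lower incomplete Gamma function.\<close>
  define W where "W r = (- (r powr (q - 1) * (1 - exp (- r))) + low r) / (1 - q)" for r
  have dW: "(W has_real_derivative r powr (q - 2) * (1 - exp (- r))) (at r)" if r: "r > 0" for r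
  proof -
    have "(W has_real_derivative (- ((q - 1) * r powr (q - 1 - 1) * (1 - exp (- r)) + r powr (q - 1) * exp (- r))
        + r powr (q - 1) * exp (- r)) / (1 - q)) (at r)"
      unfolding W_def using r by (intro DERIV_cdivide) (auto intro!: derivative_eq_intros low(1))
    moreover have "(- ((q - 1) * r powr (q - 1 - 1) * (1 - exp (- r)) + r powr (q - 1) * exp (- r))
        + r powr (q - 1) * exp (- r)) / (1 - q) = r powr (q - 2) * (1 - exp (- r))"
      using q by (simp add: field_simps)
    ultimately show ?thesis by simp
  qed
  have W0: "(W \<longlongrightarrow> 0) (at_right 0)"
  proof -
    have "((\<lambda>r. r powr (q - 1) * (1 - exp (- r))) \<longlongrightarrow> 0) (at_right 0)"
    proof (rule Lim_null_comparison)
      show "\<forall>\<^sub>F r in at_right 0. norm (r powr (q - 1) * (1 - exp (- r))) \<le> r powr q"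
        using eventually_at_right_less[of 0]
      proof eventually_elim
        case (elim r)
        have "r powr (q - 1) * (1 - exp (- r)) \<le> r powr (q - 1) * r"
          using exp_ge_add_one_self[of "- r"] by (intro mult_left_mono) auto
        also have "\<dots> = r powr q" using elim by (simp add: powr_diff)
        finally show ?case using elim by simp
      qed
      show "((\<lambda>r. r powr q) \<longlongrightarrow> 0) (at_right 0)" using q by real_asymp
    qed
    then have "(W \<longlongrightarrow> (- 0 + 0) / (1 - q)) (at_right 0)"
      unfolding W_def by (intro tendsto_intros low(3)) (use q in auto)
    then show ?thesis by simp
  qed
  have Winf: "(W \<longlongrightarrow> Gamma q / (1 - q)) at_top"
  proof -
    have "((\<lambda>r. r powr (q - 1) * (1 - exp (- r))) \<longlongrightarrow> 0) at_top" using q by real_asymp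
    then have "(W \<longlongrightarrow> (- 0 + Gamma q) / (1 - q)) at_top"
      unfolding W_def by (intro tendsto_intros low(2)) (use q in auto)
    then show ?thesis by simp
  qed
  have pw: "\<theta> powr (1 - q) * ((\<theta> * exp y) powr (q - 2) * (\<theta> * exp y)) = exp ((q - 1) * y)" for y
  proof -
    have "(\<theta> * exp y) powr (q - 2) * (\<theta> * exp y) = exp ((q - 2) * (ln \<theta> + y)) * exp (ln \<theta> + y)"
      using \<theta> by (simp add: powr_def ln_mult exp_add)
    then show ?thesis using \<theta> by (simp add: powr_def exp_add[symmetric] algebra_simps)
  qed
  have dWc: "((\<lambda>x. \<theta> powr (1 - q) * W (\<theta> * exp (l * x))) has_real_derivative
      l * (exp ((q - 1) * (l * x)) * (1 - exp (- (\<theta> * exp (l * x)))))) (at x)" for l x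
  proof -
    have "((\<lambda>x. W (\<theta> * exp (l * x))) has_real_derivative
       (\<theta> * exp (l * x)) powr (q - 2) * (1 - exp (- (\<theta> * exp (l * x)))) * (\<theta> * (exp (l * x) * l))) (at x)"
      by (rule DERIV_chain2[where f = W and g = "\<lambda>x. \<theta> * exp (l * x)"])
         (use dW \<theta> in \<open>auto intro!: derivative_eq_intros\<close>)
    from DERIV_cmult[OF this, of "\<theta> powr (1 - q)"] show ?thesis
      unfolding pw[of "l * x", symmetric] by (simp only: mult_ac)
  qed
  define f1 where "f1 x = 1 / q * ((1 - exp (- \<theta> * exp (- x / q))) / exp (- x / q))" for x
  define f2 where "f2 x = 1 / (1 - q) * (1 - exp (- \<theta> * exp (x / (1 - q))))" for x
  have m: "f1 \<in> borel_measurable borel" "f2 \<in> borel_measurable borel"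
    unfolding f1_def f2_def by measurable
  define F1 where "F1 x = - (\<theta> powr (1 - q) * W (\<theta> * exp (- 1 / q * x)))" for x
  define F2 where "F2 x = \<theta> powr (1 - q) * W (\<theta> * exp (1 / (1 - q) * x))" for x
  have d1: "(F1 has_real_derivative exp (- x) * f1 x) (at x)" for x
  proof -
    have "exp ((q - 1) * (- 1 / q * x)) = exp (- x) / exp (- x / q)"
      using q by (simp add: exp_diff[symmetric] field_simps)
    then have "- (- 1 / q * (exp ((q - 1) * (- 1 / q * x)) * (1 - exp (- (\<theta> * exp (- 1 / q * x)))))) = exp (- x) * f1 x"
      by (simp add: f1_def)
    then show ?thesis unfolding F1_def using DERIV_minus[OF dWc[of "- 1 / q" x]] by simp
  qed
  have d2: "(F2 has_real_derivative exp (- x) * f2 x) (at x)" for x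
  proof -
    have "(q - 1) * (1 / (1 - q) * x) = - x" using q by (simp add: field_simps)
    then have "1 / (1 - q) * (exp ((q - 1) * (1 / (1 - q) * x)) * (1 - exp (- (\<theta> * exp (1 / (1 - q) * x))))) = exp (- x) * f2 x"
      by (simp add: f2_def)
    then show ?thesis unfolding F2_def using dWc[of "1 / (1 - q)" x] by simp
  qed
  have l1: "(F1 \<longlongrightarrow> - (\<theta> powr (1 - q) * 0)) at_top"
    unfolding F1_def
  proof (intro tendsto_intros filterlim_compose[OF W0])
    show "filterlim (\<lambda>x. \<theta> * exp (- 1 / q * x)) (at_right 0) at_top"
      using \<theta> q by real_asymp
  qed
  have l2: "(F2 \<longlongrightarrow> \<theta> powr (1 - q) * (Gamma q / (1 - q))) at_top"
    unfolding F2_def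
  proof (intro tendsto_intros filterlim_compose[OF Winf])
    have "1 / (1 - q) > 0" using q by simp
    then show "filterlim (\<lambda>x. \<theta> * exp (1 / (1 - q) * x)) at_top at_top"
      using \<theta> by real_asymp
  qed
  have n1: "f1 x \<ge> 0" for x using \<theta> q by (simp add: f1_def)
  have n2: "f2 x \<ge> 0" for x using \<theta> q by (simp add: f2_def)
  have "integral\<^sup>L exp_weight (\<lambda>x. f1 x + f2 x) = integral\<^sup>L exp_weight f1 + integral\<^sup>L exp_weight f2"
    by (rule Bochner_Integration.integral_add)
       (rule integrable_exp_weight_FTC_nonneg[OF m(1) d1 n1 l1] integrable_exp_weight_FTC_nonneg[OF m(2) d2 n2 l2])+
  also have "integral\<^sup>L exp_weight f1 = - (\<theta> powr (1 - q) * 0) - F1 0"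
    by (rule integral_exp_weight_FTC_nonneg[OF m(1) d1 n1 l1])
  also have "integral\<^sup>L exp_weight f2 = \<theta> powr (1 - q) * (Gamma q / (1 - q)) - F2 0"
    by (rule integral_exp_weight_FTC_nonneg[OF m(2) d2 n2 l2])
  \<comment> \<open>The contributions at \<open>x = 0\<close>, where the branches meet at
    \<open>v = 1\<close>, cancel: \<open>F1 0 + F2 0 = 0\<close>.\<close>
  finally show ?thesis
    by (simp add: F1_def F2_def f1_def[abs_def] f2_def[abs_def] step_kernel_def[abs_def])
qed

section \<open>The backward Euler method\<close>

text \<open>For noninteger \<open>\<alpha>\<close>, \<open>qD \<alpha>\<close> is the fractional
  part; shifting the sine by a multiple of \<open>pi\<close> produces a sign that cancels the one in
  \<open>cD\<close>.\<close>

lemma non_nat_ceiling_facts: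
  assumes "\<alpha> > 0" "\<alpha> \<notin> \<nat>"
  shows "0 < qD \<alpha>" "qD \<alpha> < 1" "real (ordm \<alpha>) - \<alpha> = 1 - qD \<alpha>"
    "cD \<alpha> = sin (pi * qD \<alpha>) / pi"
proof -
  have nI: "\<alpha> \<notin> \<int>"
  proof
    assume "\<alpha> \<in> \<int>"
    then obtain k where k: "\<alpha> = of_int k" by (elim Ints_cases)
    then have "\<alpha> = real (nat k)" using assms(1) by simp
    then show False using assms(2) of_nat_in_Nats by metis
  qed
  then have c: "\<lceil>\<alpha>\<rceil> = \<lfloor>\<alpha>\<rfloor> + 1" by (simp add: ceiling_altdef) (metis Ints_of_int)
  have q: "qD \<alpha> = \<alpha> - of_int \<lfloor>\<alpha>\<rfloor>" unfolding qD_def c by simp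
  show "0 < qD \<alpha>" "qD \<alpha> < 1"
    using nI frac_gt_0_iff[of \<alpha>] frac_lt_1[of \<alpha>] by (simp_all add: q frac_def)
  show "real (ordm \<alpha>) - \<alpha> = 1 - qD \<alpha>"
    using assms(1) by (simp add: ordm_def qD_def)
  define n where "n = nat \<lfloor>\<alpha>\<rfloor>"
  have n: "real n = of_int \<lfloor>\<alpha>\<rfloor>" using assms(1) by (simp add: n_def)
  have "\<alpha> * pi = pi * qD \<alpha> + real n * pi" unfolding q n by (simp add: algebra_simps)
  then have "sin (\<alpha> * pi) = (-1) ^ n * sin (pi * qD \<alpha>)"
    by (simp add: sin_add sin_npi cos_npi)
  then have "cD \<alpha> = ((-1) ^ n * (-1) ^ n) * sin (pi * qD \<alpha>) / pi"
    unfolding cD_def n_def[symmetric] by simp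
  also have "(-1::real) ^ n * (-1) ^ n = 1" by (simp flip: power_mult_distrib)
  finally show "cD \<alpha> = sin (pi * qD \<alpha>) / pi" by simp
qed

lemma Gamma_reflection_real: "Gamma q * Gamma (1 - q) = pi / sin (pi * q)" for q :: real
proof -
  have "complex_of_real (Gamma q * Gamma (1 - q)) = complex_of_real (pi / sin (pi * q))"
    using Gamma_reflection_complex[of "of_real q"]
    by (simp add: Gamma_complex_of_real[symmetric] sin_of_real[symmetric])
  then show ?thesis using of_real_eq_iff by blast
qed

text \<open>The kernel is singular at \<open>s = t\<close>, but its antiderivative vanishes there
  continuously. The fundamental theorem is therefore applied with differentiability required in the
  interior only.\<close>

lemma abel_integral_by_parts:
  fixes u u' :: "real \<Rightarrow> real"
  assumes q: "0 < q" "q < 1" and at: "a < t"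
    and u: "\<And>s. s \<in> {a..t} \<Longrightarrow> (u has_real_derivative u' s) (at s within {a..t})"
    and u': "continuous_on {a..t} u'"
  shows "((\<lambda>s. (t - s) powr (- q) * u s) has_integral
     ((t - a) powr (1 - q) / (1 - q) * u a + integral {a..t} (\<lambda>s. (t - s) powr (1 - q) / (1 - q) * u' s))) {a..t}"
proof -
  define G where "G s = - ((t - s) powr (1 - q) / (1 - q)) * u s" for s
  have cu: "continuous_on {a..t} u"
    using u by (meson DERIV_continuous continuous_on_eq_continuous_within)
  have cp: "continuous_on {a..t} (\<lambda>s. (t - s) powr (1 - q))"
    by (intro continuous_on_powr' continuous_intros) (use q in auto)
  have A: "((\<lambda>s. (t - s) powr (- q) * u s - (t - s) powr (1 - q) / (1 - q) * u' s) has_integral G t - G a) {a..t}"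
  proof (rule fundamental_theorem_of_calculus_interior)
    show "a \<le> t" using at by simp
    show "continuous_on {a..t} G" unfolding G_def by (intro continuous_intros cp cu) (use q in auto)
    fix s assume s: "s \<in> {a<..<t}"
    have us: "(u has_real_derivative u' s) (at s)"
      using u[of s] s by (simp add: at_within_Icc_at)
    have "((\<lambda>s. (t - s) powr (1 - q)) has_real_derivative - ((1 - q) * (t - s) powr (- q))) (at s)"
      using s by (auto intro!: derivative_eq_intros)
    then have "((\<lambda>s. - ((t - s) powr (1 - q) / (1 - q))) has_real_derivative - (- ((1 - q) * (t - s) powr (- q)) / (1 - q))) (at s)"
      by (intro DERIV_minus DERIV_cdivide)
    moreover have "- (- ((1 - q) * (t - s) powr (- q)) / (1 - q)) = (t - s) powr (- q)" using q by simp
    ultimately have "((\<lambda>s. - ((t - s) powr (1 - q) / (1 - q))) has_real_derivative (t - s) powr (- q)) (at s)" by simp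
    from DERIV_mult[OF this us]
    have "(G has_real_derivative (t - s) powr (- q) * u s - (t - s) powr (1 - q) / (1 - q) * u' s) (at s)"
      unfolding G_def by (simp add: mult.commute)
    then show "(G has_vector_derivative (t - s) powr (- q) * u s - (t - s) powr (1 - q) / (1 - q) * u' s) (at s)"
      by (simp add: has_real_derivative_iff_has_vector_derivative)
  qed
  have B: "((\<lambda>s. (t - s) powr (1 - q) / (1 - q) * u' s) has_integral
      integral {a..t} (\<lambda>s. (t - s) powr (1 - q) / (1 - q) * u' s)) {a..t}"
    by (intro integrable_integral integrable_continuous_real continuous_intros cp u') (use q in auto)
  have "((\<lambda>s. (t - s) powr (- q) * u s) has_integral
      (G t - G a + integral {a..t} (\<lambda>s. (t - s) powr (1 - q) / (1 - q) * u' s))) {a..t}"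
    using has_integral_add[OF A B] by (simp only: diff_add_cancel)
  then show ?thesis by (simp add: G_def)
qed

section \<open>Backward Euler with a rate-independent constant\<close>

text \<open>The implicit step solved for the new value, with the factor
  \<open>cD \<alpha> * exp (w * qD \<alpha>)\<close> divided out by linearity.\<close>

primrec euler_response :: "(real \<Rightarrow> real) \<Rightarrow> real \<Rightarrow> real \<Rightarrow> real \<Rightarrow> nat \<Rightarrow> real" where
  "euler_response u a h v 0 = 0"
| "euler_response u a h v (Suc n) = (euler_response u a h v n + h * u (a + real (Suc n) * h)) / (1 + h * v)"

text \<open>Solution of \<open>\<psi>' = - v \<psi> + u\<close>, \<open>\<psi> a = 0\<close>, written through \<open>u a\<close> and \<open>u'\<close>.\<close>

definition exact_response :: "(real \<Rightarrow> real) \<Rightarrow> (real \<Rightarrow> real) \<Rightarrow> real \<Rightarrow> real \<Rightarrow> real \<Rightarrow> real" where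
  "exact_response u u' a v t = (1 - exp (- (t - a) * v)) / v * u a
     + integral {a..t} (\<lambda>s. (1 - exp (- (t - s) * v)) / v * u' s)"

lemma phiBE_eq:
  assumes "h \<ge> 0"
  shows "phiBE \<alpha> Y a h n w = cD \<alpha> * exp (w * qD \<alpha>) * euler_response (Y (ordm \<alpha>)) a h (exp w) n"
proof (induction n)
  case (Suc n)
  have pos: "1 + h * exp w > 0" using assms by (simp add: add_pos_nonneg)
  have the: "(THE z. z = P + h * (- exp w * z + s)) = (P + h * s) / (1 + h * exp w)" for P s
  proof (rule the_equality)
    have "(1 + h * exp w) * ((P + h * s) / (1 + h * exp w)) = P + h * s" using pos by simp
    then show "(P + h * s) / (1 + h * exp w) = P + h * (- exp w * ((P + h * s) / (1 + h * exp w)) + s)"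
      by (simp only: algebra_simps)
    fix z assume "z = P + h * (- exp w * z + s)"
    then have "z * (1 + h * exp w) = P + h * s" by (simp add: algebra_simps)
    then show "z = (P + h * s) / (1 + h * exp w)" using pos by (simp add: eq_divide_eq)
  qed
  show ?case unfolding phiBE.simps euler_response.simps the Suc by (simp add: algebra_simps)
qed simp

text \<open>The defect of a step is \<open>h\<close> times the variation of the derivative
  \<open>\<rho>\<close> of the solution across it. \<open>\<rho>\<close> splits into
  \<open>u a * E\<close>, whose decrements sum to at most 1 however steep \<open>E\<close> is, and
  \<open>\<kappa>\<close>, whose Lipschitz constant \<open>2 * U1\<close> is free of
  \<open>v\<close>. Both parts thus contribute \<open>O(h)\<close>.\<close>

lemma backward_euler_error:
  fixes u u' :: "real \<Rightarrow> real"
  assumes T: "T > 0" and v: "v > 0" and N: "N \<ge> 1" and n: "n \<le> N"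
    and u: "\<And>s. s \<in> {a..a+T} \<Longrightarrow> (u has_real_derivative u' s) (at s within {a..a+T})"
    and u': "continuous_on {a..a+T} u'"
    and U: "\<bar>u a\<bar> \<le> U0" "\<And>s. s \<in> {a..a+T} \<Longrightarrow> \<bar>u' s\<bar> \<le> U1"
  defines "h \<equiv> T / real N"
  shows "\<bar>exact_response u u' a v (a + real n * h) - euler_response u a h v n\<bar> \<le> h * (U0 + 2 * U1 * T)"
proof -
  have h: "h > 0" using T N by (simp add: h_def)
  have U1: "U1 \<ge> 0" using U(2)[of a] T by (auto intro: order.trans[OF abs_ge_zero])
  have U0: "U0 \<ge> 0" using U(1) by linarith
  define I where "I t = integral {a..t} (\<lambda>s. exp (v * s) * u' s)" for t
  define \<kappa> where "\<kappa> t = exp (- v * t) * I t" for t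
  define E where "E t = exp (- (t - a) * v)" for t
  \<comment> \<open>The residual \<open>u - v * \<psi>\<close> of the solution
    \<open>\<psi>\<close>: the initial layer plus the exponentially weighted memory of
    \<open>u'\<close>.\<close>
  define \<rho> where "\<rho> t = u a * E t + \<kappa> t" for t
  define \<psi> where "\<psi> t = (u t - \<rho> t) / v" for t
  have ci: "continuous_on {a..a+T} (\<lambda>s. exp (v * s) * u' s)" by (intro continuous_intros u')
  have dI: "(I has_real_derivative exp (v * t) * u' t) (at t within {a..a+T})" if "t \<in> {a..a+T}" for t
    unfolding I_def by (rule integral_has_real_derivative[OF ci that])
  have d\<kappa>: "(\<kappa> has_real_derivative - v * \<kappa> t + u' t) (at t within {a..a+T})" if "t \<in> {a..a+T}" for t
  proof -
    have "(\<kappa> has_real_derivative (exp (- v * t) * (- v)) * I t + exp (v * t) * u' t * exp (- v * t)) (at t within {a..a+T})"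
      unfolding \<kappa>_def by (rule DERIV_mult[OF _ dI[OF that]]) (auto intro!: derivative_eq_intros)
    moreover have "exp (v * t) * u' t * exp (- v * t) = u' t"
      by (simp add: exp_minus)
    moreover have "(exp (- v * t) * (- v)) * I t = - v * \<kappa> t" by (simp add: \<kappa>_def)
    ultimately show ?thesis by (simp only:)
  qed
  \<comment> \<open>Integrating the exponential yields a factor \<open>1 / v\<close>. It compensates
    the \<open>v\<close> in \<open>\<kappa>' = - v * \<kappa> + u'\<close>, so
    \<open>\<bar>\<kappa>'\<bar>\<close> is at most \<open>2 * U1\<close>.\<close>
  have \<kappa>b: "v * \<bar>\<kappa> t\<bar> \<le> U1" if t: "t \<in> {a..a+T}" for t
  proof -
    have "((\<lambda>s. U1 * exp (v * s)) has_integral (U1 * exp (v * t) / v - U1 * exp (v * a) / v)) {a..t}"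
    proof (rule fundamental_theorem_of_calculus)
      fix s
      show "((\<lambda>s. U1 * exp (v * s) / v) has_vector_derivative U1 * exp (v * s)) (at s within {a..t})"
        using v by (auto intro!: derivative_eq_intros simp: has_real_derivative_iff_has_vector_derivative[symmetric])
    qed (use t in auto)
    then have i: "(\<lambda>s. U1 * exp (v * s)) integrable_on {a..t}"
      and iv: "integral {a..t} (\<lambda>s. U1 * exp (v * s)) = U1 * exp (v * t) / v - U1 * exp (v * a) / v"
      by (blast, rule integral_unique)
    have "norm (I t) \<le> integral {a..t} (\<lambda>s. U1 * exp (v * s))"
      unfolding I_def
    proof (rule integral_norm_bound_integral[OF _ i])
      show "(\<lambda>s. exp (v * s) * u' s) integrable_on {a..t}"
        by (rule integrable_continuous_real, rule continuous_on_subset[OF ci]) (use t in auto)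
      fix s assume "s \<in> {a..t}"
      then have "\<bar>u' s\<bar> \<le> U1" using t by (intro U) auto
      then show "norm (exp (v * s) * u' s) \<le> U1 * exp (v * s)"
        by (simp add: abs_mult mult.commute)
    qed
    also have "\<dots> \<le> U1 * exp (v * t) / v" unfolding iv using U1 v by simp
    finally have "v * \<bar>I t\<bar> \<le> U1 * exp (v * t)" using v by (simp add: pos_le_divide_eq mult.commute)
    then have "exp (- v * t) * (v * \<bar>I t\<bar>) \<le> exp (- v * t) * (U1 * exp (v * t))" by (intro mult_left_mono) auto
    also have "\<dots> = U1" by (simp add: exp_minus)
    finally show ?thesis by (simp add: \<kappa>_def abs_mult mult_ac)
  qed
  have dE: "(E has_real_derivative - v * E t) (at t within S)" for t S
    unfolding E_def by (auto intro!: derivative_eq_intros)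
  have d\<psi>: "(\<psi> has_real_derivative \<rho> t) (at t within {a..a+T})" if t: "t \<in> {a..a+T}" for t
  proof -
    have "(\<psi> has_real_derivative (u' t - (u a * (- v * E t) + (- v * \<kappa> t + u' t))) / v) (at t within {a..a+T})"
      unfolding \<psi>_def \<rho>_def
      by (intro DERIV_cdivide DERIV_diff DERIV_add DERIV_cmult u[OF t] dE d\<kappa>[OF t])
    moreover have "(u' t - (u a * (- v * E t) + (- v * \<kappa> t + u' t))) / v = \<rho> t"
      using v by (simp add: \<rho>_def field_simps)
    ultimately show ?thesis by simp
  qed
  have exact: "exact_response u u' a v t = \<psi> t" if t: "t \<in> {a..a+T}" for t
  proof -
    have sub: "continuous_on {a..t} u'" by (rule continuous_on_subset[OF u']) (use t in auto)
    have "(u' has_integral u t - u a) {a..t}"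
    proof (rule fundamental_theorem_of_calculus)
      fix s assume "s \<in> {a..t}"
      then show "(u has_vector_derivative u' s) (at s within {a..t})"
        unfolding has_real_derivative_iff_has_vector_derivative[symmetric]
        using t by (intro DERIV_subset[OF u]) auto
    qed (use t in auto)
    then have iu: "integral {a..t} u' = u t - u a" "u' integrable_on {a..t}"
      by (rule integral_unique, blast)
    have i2: "(\<lambda>s. exp (- (t - s) * v) * u' s) integrable_on {a..t}"
      by (intro integrable_continuous_real continuous_intros sub)
    have "exp (- (t - s) * v) * u' s = exp (- v * t) * (exp (v * s) * u' s)" for s
    proof -
      have "- (t - s) * v = - v * t + v * s" by (simp add: algebra_simps)
      then show ?thesis by (simp only: exp_add mult.assoc)
    qed
    then have \<kappa>: "integral {a..t} (\<lambda>s. exp (- (t - s) * v) * u' s) = \<kappa> t"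
      unfolding \<kappa>_def I_def by (simp only: integral_mult_right)
    have "integral {a..t} (\<lambda>s. (1 - exp (- (t - s) * v)) / v * u' s)
        = integral {a..t} (\<lambda>s. 1 / v * (u' s - exp (- (t - s) * v) * u' s))"
      by (intro integral_cong) (simp add: left_diff_distrib)
    also have "\<dots> = 1 / v * integral {a..t} (\<lambda>s. u' s - exp (- (t - s) * v) * u' s)"
      by (rule integral_mult_right)
    also have "integral {a..t} (\<lambda>s. u' s - exp (- (t - s) * v) * u' s) = (u t - u a) - \<kappa> t"
      using integral_diff[OF iu(2) i2] iu(1) \<kappa> by simp
    finally have "exact_response u u' a v t = (1 - E t) / v * u a + 1 / v * ((u t - u a) - \<kappa> t)"
      unfolding exact_response_def E_def by (simp only:)
    also have "\<dots> = \<psi> t" unfolding \<psi>_def \<rho>_def using v by (simp add: divide_simps) (simp add: algebra_simps)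
    finally show ?thesis .
  qed
  have Emono: "E s' \<le> E s" if "s \<le> s'" for s s' using that v by (simp add: E_def)
  have grid: "a + real j * h \<in> {a..a+T}" if "j \<le> N" for j
  proof -
    have "real j * h \<le> real N * h" using that h by (intro mult_right_mono) auto
    moreover have "real N * h = T" using N by (simp add: h_def)
    moreover have "0 \<le> real j * h" using h by simp
    ultimately show ?thesis by simp
  qed
  \<comment> \<open>Keeping \<open>1 - E\<close> instead of its bound 1 in the induction claim is
    what lets the layer defects telescope.\<close>
  have "\<bar>\<psi> (a + real n * h) - euler_response u a h v n\<bar> \<le> h * (U0 * (1 - E (a + real n * h)) + 2 * U1 * (real n * h))"
    using n
  proof (induction n)
    case 0
    have "\<psi> a = 0" by (simp add: \<psi>_def \<rho>_def E_def \<kappa>_def I_def)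
    then show ?case by (simp add: E_def)
  next
    case (Suc n)
    define t0 t1 where "t0 = a + real n * h" and "t1 = a + real (Suc n) * h"
    have tin: "t0 \<in> {a..a+T}" "t1 \<in> {a..a+T}" using Suc.prems grid[of n] grid[of "Suc n"] by (simp_all add: t0_def t1_def)
    have t01: "t1 = t0 + h" by (simp add: t0_def t1_def algebra_simps)
    \<comment> \<open>The exact increment is \<open>h * \<rho> \<xi>\<close> for an intermediate
      time, whereas backward Euler samples at \<open>t1\<close>; only
      \<open>\<rho> \<xi> - \<rho> t1\<close> enters the defect.\<close>
    obtain \<xi> where \<xi>: "\<xi> \<in> {t0<..<t1}" "\<psi> t1 - \<psi> t0 = \<rho> \<xi> * (t1 - t0)"
    proof -
      have "\<exists>x\<in>{t0<..<t1}. \<psi> t1 - \<psi> t0 = (*) (\<rho> x) (t1 - t0)"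
      proof (rule mvt_simple)
        fix x assume "t0 \<le> x" "x \<le> t1"
        then show "(\<psi> has_derivative (*) (\<rho> x)) (at x within {t0..t1})"
          using DERIV_subset[OF d\<psi>, of x "{t0..t1}"] tin by (auto simp: has_field_derivative_def)
      qed (use t01 h in simp)
      then show ?thesis using that by auto
    qed
    obtain \<eta> where \<eta>: "\<eta> \<in> {\<xi><..<t1}" "\<kappa> t1 - \<kappa> \<xi> = (- v * \<kappa> \<eta> + u' \<eta>) * (t1 - \<xi>)"
    proof -
      have "\<exists>x\<in>{\<xi><..<t1}. \<kappa> t1 - \<kappa> \<xi> = (*) (- v * \<kappa> x + u' x) (t1 - \<xi>)"
      proof (rule mvt_simple)
        fix x assume "\<xi> \<le> x" "x \<le> t1"
        then show "(\<kappa> has_derivative (*) (- v * \<kappa> x + u' x)) (at x within {\<xi>..t1})"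
          using DERIV_subset[OF d\<kappa>, of x "{\<xi>..t1}"] tin \<xi> by (auto simp: has_field_derivative_def)
      qed (use \<xi> in simp)
      then show ?thesis using that by auto
    qed
    have \<eta>in: "\<eta> \<in> {a..a+T}" using \<eta> \<xi> tin by auto
    have "\<bar>\<kappa> t1 - \<kappa> \<xi>\<bar> \<le> (2 * U1) * h"
    proof -
      have "\<bar>- v * \<kappa> \<eta> + u' \<eta>\<bar> \<le> v * \<bar>\<kappa> \<eta>\<bar> + \<bar>u' \<eta>\<bar>" 
        using v abs_triangle_ineq[of "- v * \<kappa> \<eta>" "u' \<eta>"] by (simp add: abs_mult)
      also have "\<dots> \<le> 2 * U1" using \<kappa>b[OF \<eta>in] U(2)[OF \<eta>in] by simp
      finally have "\<bar>- v * \<kappa> \<eta> + u' \<eta>\<bar> \<le> 2 * U1" .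
      then show ?thesis unfolding \<eta>(2) abs_mult using \<xi> t01 U1 by (intro mult_mono) auto
    qed
    moreover have "\<bar>u a * (E \<xi> - E t1)\<bar> \<le> U0 * (E t0 - E t1)"
      unfolding abs_mult using U(1) U0 Emono[of t0 \<xi>] Emono[of \<xi> t1] \<xi> by (intro mult_mono) auto
    moreover have "\<rho> \<xi> - \<rho> t1 = u a * (E \<xi> - E t1) - (\<kappa> t1 - \<kappa> \<xi>)" by (simp add: \<rho>_def right_diff_distrib)
    ultimately have \<rho>d: "\<bar>\<rho> \<xi> - \<rho> t1\<bar> \<le> U0 * (E t0 - E t1) + 2 * U1 * h" by linarith
    define e0 e1 where "e0 = \<psi> t0 - euler_response u a h v n" and "e1 = \<psi> t1 - euler_response u a h v (Suc n)"
    have "(1 + h * v) * euler_response u a h v (Suc n) = euler_response u a h v n + h * u t1"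
    proof -
      have "1 + h * v \<noteq> 0" using h v by (smt (verit) mult_pos_pos)
      then show ?thesis by (simp add: t1_def)
    qed
    moreover have "(1 + h * v) * \<psi> t1 = \<psi> t0 + h * u t1 + h * (\<rho> \<xi> - \<rho> t1)"
    proof -
      have "v * \<psi> t1 = u t1 - \<rho> t1" using v by (simp add: \<psi>_def)
      then have "h * v * \<psi> t1 = h * u t1 - h * \<rho> t1" by (simp add: mult.assoc right_diff_distrib)
      then show ?thesis using \<xi>(2) t01 by (simp add: algebra_simps)
    qed
    ultimately have "(1 + h * v) * e1 = e0 + h * (\<rho> \<xi> - \<rho> t1)"
      by (simp add: e0_def e1_def right_diff_distrib)
    then have "\<bar>(1 + h * v) * e1\<bar> \<le> \<bar>e0\<bar> + h * \<bar>\<rho> \<xi> - \<rho> t1\<bar>"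
      using abs_triangle_ineq[of e0 "h * (\<rho> \<xi> - \<rho> t1)"] h by (simp add: abs_mult)
    \<comment> \<open>Damping by \<open>1 + h * v\<close> is used only as being at least 1, so no
      smallness of \<open>h * v\<close> is required.\<close>
    moreover have "1 * \<bar>e1\<bar> \<le> (1 + h * v) * \<bar>e1\<bar>" using h v by (intro mult_right_mono) auto
    then have "\<bar>e1\<bar> \<le> \<bar>(1 + h * v) * e1\<bar>" using h v by (simp add: abs_mult abs_of_pos add_pos_pos)
    ultimately have "\<bar>e1\<bar> \<le> \<bar>e0\<bar> + h * \<bar>\<rho> \<xi> - \<rho> t1\<bar>" by linarith
    also have "\<dots> \<le> h * (U0 * (1 - E t0) + 2 * U1 * (real n * h)) + h * (U0 * (E t0 - E t1) + 2 * U1 * h)"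
      using Suc \<rho>d h by (intro add_mono mult_left_mono) (auto simp: e0_def t0_def)
    also have "\<dots> = h * (U0 * (1 - E t1) + 2 * U1 * (real (Suc n) * h))"
      by (simp add: algebra_simps)
    finally show ?case unfolding e1_def t1_def .
  qed
  also have "\<dots> \<le> h * (U0 * 1 + 2 * U1 * T)"
  proof (intro mult_left_mono add_mono)
    show "1 - E (a + real n * h) \<le> 1" by (simp add: E_def)
    show "real n * h \<le> T" using grid[OF n] by simp
  qed (use U0 U1 h in auto)
  finally show ?thesis using exact[OF grid[OF n]] by simp
qed

section \<open>The error estimate\<close>

lemma phi_hat_eq:
  fixes Y :: "nat \<Rightarrow> real \<Rightarrow> real"
  assumes q: "0 < qD \<alpha>" "qD \<alpha> < 1" and h: "h \<ge> 0"
  defines "q \<equiv> qD \<alpha>" and "u \<equiv> Y (ordm \<alpha>)"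
  shows "phi_hat \<alpha> Y a h n x = cD \<alpha> * (1 / q * euler_response u a h (exp (- x / q)) n
     + 1 / (1 - q) * (exp (x / (1 - q)) * euler_response u a h (exp (x / (1 - q))) n))"
proof -
  have 1: "exp x * exp (- x / q * q) = 1" using q by (simp add: q_def exp_minus)
  have 2: "exp x * exp (x / (1 - q) * q) = exp (x / (1 - q))"
    using q by (simp add: q_def exp_add[symmetric] field_simps)
  have "phi_hat \<alpha> Y a h n x = cD \<alpha> * (1 / q * ((exp x * exp (- x / q * q)) * euler_response u a h (exp (- x / q)) n)
     + 1 / (1 - q) * ((exp x * exp (x / (1 - q) * q)) * euler_response u a h (exp (x / (1 - q))) n))"
    unfolding phi_hat_def phiBE_eq[OF h] q_def u_def by (simp add: algebra_simps)
  then show ?thesis unfolding 1 2 by simp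
qed

text \<open>The exact counterpart of \<open>phi_hat_eq\<close>: for each rate,
  \<open>exact_response\<close> is already a superposition of step responses, and the two folded
  branches add up to \<open>step_kernel\<close>.\<close>

lemma step_kernel_superposition:
  assumes q: "0 < q" "q < 1" and u': "continuous_on {a..t} u'"
  shows "1 / q * exact_response u u' a (exp (- x / q)) t
      + 1 / (1 - q) * (exp (x / (1 - q)) * exact_response u u' a (exp (x / (1 - q))) t)
    = step_kernel q (t - a) x * u a + integral {a..t} (\<lambda>s. step_kernel q (t - s) x * u' s)"
proof -
  define v1 v2 where "v1 = exp (- x / q)" and "v2 = exp (x / (1 - q))"
  have v: "v1 \<noteq> 0" "v2 \<noteq> 0" by (simp_all add: v1_def v2_def)
  define m where "m v s = (1 - exp (- (t - s) * v)) / v" for v s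
  have sk: "step_kernel q (t - s) x = 1 / q * m v1 s + 1 / (1 - q) * v2 * m v2 s" for s
    using v by (simp add: step_kernel_def m_def v1_def v2_def)
  have i: "(\<lambda>s. m w s * u' s) integrable_on {a..t}" if "w \<noteq> 0" for w
    unfolding m_def by (intro integrable_continuous_real continuous_intros u') (use that in auto)
  have "integral {a..t} (\<lambda>s. step_kernel q (t - s) x * u' s)
      = integral {a..t} (\<lambda>s. 1 / q * (m v1 s * u' s) + 1 / (1 - q) * v2 * (m v2 s * u' s))"
    unfolding sk by (simp add: algebra_simps)
  also have "\<dots> = integral {a..t} (\<lambda>s. 1 / q * (m v1 s * u' s)) + integral {a..t} (\<lambda>s. 1 / (1 - q) * v2 * (m v2 s * u' s))"
    by (intro integral_add integrable_on_mult_right i v)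
  also have "\<dots> = 1 / q * integral {a..t} (\<lambda>s. m v1 s * u' s) + 1 / (1 - q) * v2 * integral {a..t} (\<lambda>s. m v2 s * u' s)"
    by (simp only: integral_mult_right)
  finally have int: "integral {a..t} (\<lambda>s. step_kernel q (t - s) x * u' s) = \<dots>" .
  define A where "A w = integral {a..t} (\<lambda>s. m w s * u' s)" for w
  have ex: "exact_response u u' a w t = m w a * u a + A w" for w
    unfolding exact_response_def m_def A_def ..
  show ?thesis
    unfolding v1_def[symmetric] v2_def[symmetric] ex int unfolding sk A_def[symmetric] by (simp add: algebra_simps)
qed

text \<open>After integration by parts the kernel is \<open>\<theta> powr (1 - q) / (1 - q)\<close>,
  a multiple of the integrated step kernel. The constants agree by the reflection formula,
  \<open>cD \<alpha> * Gamma q = 1 / Gamma (1 - q)\<close>.\<close>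

lemma caputo_eq:
  assumes \<alpha>: "\<alpha> > 0" "\<alpha> \<notin> \<nat>" and at: "a < t"
    and u: "\<And>s. s \<in> {a..t} \<Longrightarrow> (Y (ordm \<alpha>) has_real_derivative u' s) (at s within {a..t})"
    and u': "continuous_on {a..t} u'"
  defines "q \<equiv> qD \<alpha>"
  shows "caputo \<alpha> a Y t = cD \<alpha> * (integral\<^sup>L exp_weight (step_kernel q (t - a)) * Y (ordm \<alpha>) a
      + integral {a..t} (\<lambda>s. integral\<^sup>L exp_weight (step_kernel q (t - s)) * u' s))"
proof -
  note facts = non_nat_ceiling_facts[OF \<alpha>, folded q_def]
  have q: "0 < q" "q < 1" by (fact facts)+
  have sk0: "step_kernel q 0 = (\<lambda>x. 0)" by (simp add: step_kernel_def fun_eq_iff)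
  have "0 < pi * q" "pi * q < pi" using q by auto
  then have sinp: "sin (pi * q) > 0" by (rule sin_gt_zero)
  have G: "Gamma q > 0" "Gamma (1 - q) > 0" using q by (auto intro: Gamma_real_pos)
  have cG: "cD \<alpha> * Gamma q = 1 / Gamma (1 - q)"
    using Gamma_reflection_real[of q] sinp G unfolding facts(4) by (simp add: field_simps)
  have k: "1 / Gamma (1 - q) * (\<theta> powr (1 - q) / (1 - q)) = cD \<alpha> * integral\<^sup>L exp_weight (step_kernel q \<theta>)"
    if "\<theta> \<ge> 0" for \<theta>
    unfolding cG[symmetric] using integral_step_kernel[OF q, of \<theta>] that sk0 by (cases "\<theta> = 0") auto
  have "caputo \<alpha> a Y t = 1 / Gamma (1 - q) * integral {a..t} (\<lambda>s. (t - s) powr (- q) * Y (ordm \<alpha>) s)"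
    unfolding caputo_def facts(3) by simp
  also have "\<dots> = 1 / Gamma (1 - q) * ((t - a) powr (1 - q) / (1 - q) * Y (ordm \<alpha>) a
      + integral {a..t} (\<lambda>s. (t - s) powr (1 - q) / (1 - q) * u' s))"
    using abel_integral_by_parts[OF q at u u'] by (simp add: integral_unique)
  also have "\<dots> = (1 / Gamma (1 - q) * ((t - a) powr (1 - q) / (1 - q))) * Y (ordm \<alpha>) a
      + integral {a..t} (\<lambda>s. 1 / Gamma (1 - q) * ((t - s) powr (1 - q) / (1 - q) * u' s))"
    unfolding integral_mult_right by (simp only: distrib_left mult.assoc)
  also have "\<dots> = cD \<alpha> * integral\<^sup>L exp_weight (step_kernel q (t - a)) * Y (ordm \<alpha>) a
      + integral {a..t} (\<lambda>s. cD \<alpha> * (integral\<^sup>L exp_weight (step_kernel q (t - s)) * u' s))"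
  proof -
    have "integral {a..t} (\<lambda>s. 1 / Gamma (1 - q) * ((t - s) powr (1 - q) / (1 - q) * u' s))
        = integral {a..t} (\<lambda>s. cD \<alpha> * (integral\<^sup>L exp_weight (step_kernel q (t - s)) * u' s))"
      by (intro integral_cong) (use k in \<open>simp only: mult.assoc[symmetric] atLeastAtMost_iff diff_ge_0_iff_ge\<close>)
    then show ?thesis using k[of "t - a"] at by simp
  qed
  finally show ?thesis unfolding integral_mult_right by (simp only: distrib_left mult.assoc)
qed

text \<open>Read off from the closed form, which also holds at 0; it makes the products with
  \<open>u'\<close> integrable in time.\<close>

lemma continuous_integral_step_kernel:
  assumes q: "0 < q" "q < 1"
  shows "continuous_on {0..} (\<lambda>\<theta>. integral\<^sup>L exp_weight (step_kernel q \<theta>))"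
proof -
  have "continuous_on {0..} (\<lambda>\<theta>. \<theta> powr (1 - q) * Gamma q / (1 - q))"
    by (intro continuous_intros continuous_on_powr') (use q in auto)
  moreover have "integral\<^sup>L exp_weight (step_kernel q \<theta>) = \<theta> powr (1 - q) * Gamma q / (1 - q)" if "\<theta> \<in> {0..}" for \<theta>
  proof (cases "\<theta> = 0")
    case True
    then have "step_kernel q \<theta> = (\<lambda>x. 0)" by (simp add: step_kernel_def fun_eq_iff)
    then show ?thesis using True by simp
  qed (use that integral_step_kernel[OF q, of \<theta>] in simp)
  ultimately show ?thesis by (subst continuous_on_cong[OF refl]) auto
qed

text \<open>The O-terms become one inequality for all \<open>K, N \<ge> 1\<close> and all grid
  points, with constants independent of \<open>K\<close>, \<open>N\<close> and \<open>n\<close>;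
  this covers every way of letting \<open>K\<close> or \<open>N\<close> grow.\<close>

theorem theorem1:
  fixes \<alpha> a T :: real and y :: "real \<Rightarrow> real" and Y :: "nat \<Rightarrow> real \<Rightarrow> real"
    and xs ws :: "nat \<Rightarrow> nat \<Rightarrow> real"
  assumes alpha_pos: "\<alpha> > 0" and alpha_not_nat: "\<alpha> \<notin> \<nat>"
    and T_pos: "T > 0"
    and Y0: "Y 0 = y"
    and Y_deriv: "\<And>j t. j \<le> ordm \<alpha> \<Longrightarrow> t \<in> {a..a+T} \<Longrightarrow>
                    (Y j has_real_derivative Y (Suc j) t) (at t within {a..a+T})"
    and Y_cont: "continuous_on {a..a+T} (Y (Suc (ordm \<alpha>)))"
    and GL: "\<And>K. K \<ge> 1 \<Longrightarrow> gauss_laguerre K (xs K) (ws K)"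
  shows "\<forall>p > 0. \<exists>C1 C2. \<forall>K N. K \<ge> 1 \<longrightarrow> N \<ge> 1 \<longrightarrow>
           (\<forall>n \<in> {1..N}.
              \<bar>caputo \<alpha> a Y (a + real n * (T / real N))
                - (\<Sum>k=1..K. ws K k * phi_hat \<alpha> Y a (T / real N) n (xs K k))\<bar>
              \<le> C1 * real K powr (- p)
                 + C2 * (T / real N) * exp ((1 + qD \<alpha>) / (1 - qD \<alpha>) * (4 * real K + 2)))"
proof (intro allI impI)
  fix p :: real
  define q c u u' where "q = qD \<alpha>" and "c = cD \<alpha>" and "u = Y (ordm \<alpha>)" and "u' = Y (Suc (ordm \<alpha>))"
  have q: "0 < q" "q < 1"
    using non_nat_ceiling_facts[OF alpha_pos alpha_not_nat] by (simp_all add: q_def)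
  have du: "(u has_real_derivative u' s) (at s within {a..a+T})" if "s \<in> {a..a+T}" for s
    using Y_deriv[of "ordm \<alpha>" s] that by (simp add: u_def u'_def)
  have cu': "continuous_on {a..a+T} u'" using Y_cont by (simp add: u'_def)
  obtain U1 where U1: "\<And>s. s \<in> {a..a+T} \<Longrightarrow> \<bar>u' s\<bar> \<le> U1"
  proof -
    have "bounded (u' ` {a..a+T})" by (intro compact_imp_bounded compact_continuous_image cu') simp
    then obtain B where "\<forall>s\<in>{a..a+T}. \<bar>u' s\<bar> \<le> B" unfolding bounded_iff by auto
    then show ?thesis using that[of B] by blast
  qed
  have U10: "U1 \<ge> 0" using U1[of a] T_pos by (auto intro: order.trans[OF abs_ge_zero])
  obtain C where C: "C \<ge> 0" "\<And>\<theta> K x w. \<theta> \<in> {0..T} \<Longrightarrow> K \<ge> 1 \<Longrightarrow> gauss_laguerre K x w \<Longrightarrow>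
      \<bar>integral\<^sup>L exp_weight (step_kernel q \<theta>) - (\<Sum>k=1..K. w k * step_kernel q \<theta> (x k))\<bar> \<le> C * real K powr (- p)"
    using step_kernel_error[OF q, of T p] T_pos by auto
  \<comment> \<open>The quadrature error of the step kernel, paired with \<open>u a\<close> and with
    \<open>u'\<close> over a time span of at most \<open>T\<close>. In \<open>C2\<close>,
    \<open>Cb\<close> is the Euler constant and the reciprocals are the branch prefactors.\<close>
  define C1 where "C1 = \<bar>c\<bar> * (C * \<bar>u a\<bar> + C * U1 * T)"
  define Cb where "Cb = \<bar>u a\<bar> + 2 * U1 * T"
  define C2 where "C2 = \<bar>c\<bar> * Cb * (1 / q + 1 / (1 - q))"
  have Cb0: "Cb \<ge> 0" using U10 T_pos by (simp add: Cb_def)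
  show "\<exists>C1 C2. \<forall>K N. K \<ge> 1 \<longrightarrow> N \<ge> 1 \<longrightarrow>
           (\<forall>n \<in> {1..N}.
              \<bar>caputo \<alpha> a Y (a + real n * (T / real N))
                - (\<Sum>k=1..K. ws K k * phi_hat \<alpha> Y a (T / real N) n (xs K k))\<bar>
              \<le> C1 * real K powr (- p)
                 + C2 * (T / real N) * exp ((1 + qD \<alpha>) / (1 - qD \<alpha>) * (4 * real K + 2)))"
  proof (rule exI[of _ C1], rule exI[of _ C2], intro allI impI ballI)
    fix K N n :: nat assume K: "1 \<le> K" and N: "1 \<le> N" and n: "n \<in> {1..N}"
    define h t x w where "h = T / real N" and "t = a + real n * h" and "x = xs K" and "w = ws K"
    have gl: "gauss_laguerre K x w" using GL[OF K] by (simp add: x_def w_def)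
    have h: "h > 0" using T_pos N by (simp add: h_def)
    have at: "a < t" using h n by (simp add: t_def)
    have tT: "t \<le> a + T"
    proof -
      have "real n * h \<le> real N * h" using n h by (intro mult_right_mono) auto
      then show ?thesis using N by (simp add: t_def h_def)
    qed
    have sub: "{a..t} \<subseteq> {a..a+T}" using tT by auto
    have cut: "continuous_on {a..t} u'" by (rule continuous_on_subset[OF cu' sub])
    have dut: "(Y (ordm \<alpha>) has_real_derivative u' s) (at s within {a..t})" if "s \<in> {a..t}" for s
      using DERIV_subset[OF du sub] that sub by (auto simp: u_def)
    define Q where "Q \<theta> = (\<Sum>k=1..K. w k * step_kernel q \<theta> (x k))" for \<theta>
    define J where "J \<theta> = integral\<^sup>L exp_weight (step_kernel q \<theta>)" for \<theta>
    \<comment> \<open>\<open>phi_hat\<close> with exact responses in place of backward Euler; it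
      separates the quadrature error from the time-stepping error.\<close>
    define ex where "ex z = c * (1 / q * exact_response u u' a (exp (- z / q)) t
        + 1 / (1 - q) * (exp (z / (1 - q)) * exact_response u u' a (exp (z / (1 - q))) t))" for z
    have csk: "continuous_on {a..t} (\<lambda>s. step_kernel q (t - s) z)" for z
      unfolding step_kernel_def by (intro continuous_intros) (use q in auto)
    have cQ: "continuous_on {a..t} (\<lambda>s. Q (t - s))"
      unfolding Q_def by (intro continuous_intros csk)
    have cJ: "continuous_on {a..t} (\<lambda>s. J (t - s))"
      unfolding J_def
      by (rule continuous_on_compose2[OF continuous_integral_step_kernel[OF q]]) (auto intro!: continuous_intros)
    have exsum: "(\<Sum>k=1..K. w k * ex (x k)) = c * (Q (t - a) * u a + integral {a..t} (\<lambda>s. Q (t - s) * u' s))"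
    proof -
      have i: "(\<lambda>s. step_kernel q (t - s) z * u' s) integrable_on {a..t}" for z
        by (intro integrable_continuous_real continuous_intros csk cut)
      have "integral {a..t} (\<lambda>s. Q (t - s) * u' s)
          = integral {a..t} (\<lambda>s. \<Sum>k=1..K. w k * (step_kernel q (t - s) (x k) * u' s))"
        unfolding Q_def sum_distrib_right mult.assoc ..
      also have "\<dots> = (\<Sum>k=1..K. integral {a..t} (\<lambda>s. w k * (step_kernel q (t - s) (x k) * u' s)))"
        by (intro integral_sum integrable_on_mult_right i) auto
      also have "\<dots> = (\<Sum>k=1..K. w k * integral {a..t} (\<lambda>s. step_kernel q (t - s) (x k) * u' s))"
        by (simp only: integral_mult_right)
      finally have Qi: "integral {a..t} (\<lambda>s. Q (t - s) * u' s) = \<dots>" .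
      show ?thesis
        unfolding ex_def step_kernel_superposition[OF q cut] Qi unfolding Q_def
        by (simp add: sum_distrib_left sum_distrib_right sum.distrib[symmetric] algebra_simps)
    qed
    have quad: "\<bar>caputo \<alpha> a Y t - (\<Sum>k=1..K. w k * ex (x k))\<bar> \<le> C1 * real K powr (- p)"
    proof -
      define e where "e = C * real K powr (- p)"
      have JQ: "\<bar>J \<theta> - Q \<theta>\<bar> \<le> e" if "\<theta> \<in> {0..T}" for \<theta>
        using C(2)[OF that K gl] by (simp add: J_def Q_def e_def)
      have e0: "e \<ge> 0" using C(1) by (simp add: e_def)
      have cap: "caputo \<alpha> a Y t = c * (J (t - a) * u a + integral {a..t} (\<lambda>s. J (t - s) * u' s))"
        using caputo_eq[where Y = Y, OF alpha_pos alpha_not_nat at dut cut] by (simp add: c_def J_def q_def u_def)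
      have ii: "(\<lambda>s. J (t - s) * u' s) integrable_on {a..t}" "(\<lambda>s. Q (t - s) * u' s) integrable_on {a..t}"
        by (intro integrable_continuous_real continuous_intros cJ cQ cut)+
      have dI: "integral {a..t} (\<lambda>s. (J (t - s) - Q (t - s)) * u' s)
          = integral {a..t} (\<lambda>s. J (t - s) * u' s) - integral {a..t} (\<lambda>s. Q (t - s) * u' s)"
        using integral_diff[OF ii] by (simp only: left_diff_distrib)
      have eq: "caputo \<alpha> a Y t - (\<Sum>k=1..K. w k * ex (x k))
          = c * ((J (t - a) - Q (t - a)) * u a + integral {a..t} (\<lambda>s. (J (t - s) - Q (t - s)) * u' s))"
        unfolding cap exsum dI by (simp add: right_diff_distrib left_diff_distrib distrib_left)
      have "norm (integral {a..t} (\<lambda>s. (J (t - s) - Q (t - s)) * u' s)) \<le> integral {a..t} (\<lambda>s. e * U1)"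
      proof (rule integral_norm_bound_integral)
        show "(\<lambda>s. (J (t - s) - Q (t - s)) * u' s) integrable_on {a..t}"
          by (intro integrable_continuous_real continuous_intros cJ cQ cut)
        fix s assume s: "s \<in> {a..t}"
        then have "\<bar>J (t - s) - Q (t - s)\<bar> \<le> e" "\<bar>u' s\<bar> \<le> U1" using tT JQ[of "t - s"] U1[of s] by auto
        then show "norm ((J (t - s) - Q (t - s)) * u' s) \<le> e * U1"
          using e0 by (simp add: abs_mult mult_mono)
      qed auto
      also have "\<dots> \<le> e * U1 * T"
      proof -
        have "integral {a..t} (\<lambda>s. e * U1) = (t - a) * (e * U1)" using at by simp
        also have "\<dots> \<le> T * (e * U1)" using tT e0 U10 by (intro mult_right_mono) auto
        finally show ?thesis by (simp add: mult_ac)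
      qed
      finally have b2: "\<bar>integral {a..t} (\<lambda>s. (J (t - s) - Q (t - s)) * u' s)\<bar> \<le> e * U1 * T" by simp
      have b1: "\<bar>(J (t - a) - Q (t - a)) * u a\<bar> \<le> e * \<bar>u a\<bar>"
        unfolding abs_mult using JQ[of "t - a"] at tT by (intro mult_right_mono) auto
      have "\<bar>caputo \<alpha> a Y t - (\<Sum>k=1..K. w k * ex (x k))\<bar> \<le> \<bar>c\<bar> * (e * \<bar>u a\<bar> + e * U1 * T)"
        unfolding eq abs_mult[of c] using b1 b2
        by (intro mult_left_mono order.trans[OF abs_triangle_ineq] add_mono) auto
      also have "\<dots> = C1 * real K powr (- p)" by (simp add: C1_def e_def algebra_simps)
      finally show ?thesis .
    qed
    define X where "X = exp ((1 + q) / (1 - q) * (4 * real K + 2))"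
    have be: "\<bar>ex z - phi_hat \<alpha> Y a h n z\<bar> \<le> C2 * h * X" if z: "0 \<le> z" "z \<le> 4 * real K - 2" for z
    proof -
      define d where "d v = exact_response u u' a v t - euler_response u a h v n" for v
      have db: "\<bar>d v\<bar> \<le> h * Cb" if "v > 0" for v
        unfolding d_def Cb_def t_def h_def
        by (rule backward_euler_error[OF T_pos that N _ du cu' order.refl U1]) (use n in auto)
      \<comment> \<open>The nodes alone give the exponent \<open>z / (1 - q)\<close> with
        \<open>z \<le> 4 * K - 2\<close>; the factor \<open>1 + q\<close> and the \<open>+ 2\<close>
        in the claimed bound are slack.\<close>
      have X1: "exp (z / (1 - q)) \<le> X"
      proof -
        have "z \<le> (1 + q) * (4 * real K + 2)"
        proof -
          have "z \<le> 1 * (4 * real K + 2)" using z by simp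
          also have "\<dots> \<le> (1 + q) * (4 * real K + 2)" using q by (intro mult_right_mono) auto
          finally show ?thesis .
        qed
        then have "z / (1 - q) \<le> (1 + q) * (4 * real K + 2) / (1 - q)" using q by (intro divide_right_mono) auto
        then show ?thesis by (simp add: X_def)
      qed
      have "1 \<le> exp (z / (1 - q))" using z q by simp
      then have X0: "1 \<le> X" using X1 by linarith
      have hC: "0 \<le> h * Cb" using h Cb0 by simp
      have "ex z - phi_hat \<alpha> Y a h n z
         = c * (1 / q * d (exp (- z / q)) + 1 / (1 - q) * (exp (z / (1 - q)) * d (exp (z / (1 - q)))))"
        unfolding ex_def phi_hat_eq[OF q[unfolded q_def] less_imp_le[OF h]] q_def[symmetric] c_def[symmetric] u_def[symmetric] d_def
        by (simp add: algebra_simps)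
      also have "\<bar>\<dots>\<bar> \<le> \<bar>c\<bar> * (1 / q * (h * Cb * X) + 1 / (1 - q) * (h * Cb * X))"
        unfolding abs_mult[of c]
      proof (intro mult_left_mono order.trans[OF abs_triangle_ineq] add_mono)
        have "\<bar>d (exp (- z / q))\<bar> \<le> h * Cb * X"
          using db[of "exp (- z / q)"] mult_left_mono[OF X0 hC] by simp
        then show "\<bar>1 / q * d (exp (- z / q))\<bar> \<le> 1 / q * (h * Cb * X)"
          unfolding abs_mult using q by (intro mult_mono) auto
        have "\<bar>exp (z / (1 - q)) * d (exp (z / (1 - q)))\<bar> \<le> X * (h * Cb)"
          unfolding abs_mult using X1 X0 db[of "exp (z / (1 - q))"] by (intro mult_mono) auto
        then have *: "\<bar>exp (z / (1 - q)) * d (exp (z / (1 - q)))\<bar> \<le> h * Cb * X" by (simp only: mult_ac)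
        show "\<bar>1 / (1 - q) * (exp (z / (1 - q)) * d (exp (z / (1 - q))))\<bar> \<le> 1 / (1 - q) * (h * Cb * X)"
          unfolding abs_mult[of "1 / (1 - q)"] using q * by (intro mult_mono) auto
      qed auto
      also have "\<dots> = C2 * h * X" by (simp add: C2_def algebra_simps)
      finally show ?thesis .
    qed
    have "\<bar>(\<Sum>k=1..K. w k * ex (x k)) - (\<Sum>k=1..K. w k * phi_hat \<alpha> Y a h n (x k))\<bar>
        \<le> (\<Sum>k=1..K. w k * (C2 * h * X))"
      unfolding sum_subtractf[symmetric] right_diff_distrib[symmetric]
    proof (intro order.trans[OF sum_abs] sum_mono)
      fix k assume k: "k \<in> {1..K}"
      from gauss_laguerre_node[OF gl k]
      show "\<bar>w k * (ex (x k) - phi_hat \<alpha> Y a h n (x k))\<bar> \<le> w k * (C2 * h * X)"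
      proof
        assume w: "0 < w k \<and> 0 \<le> x k \<and> x k \<le> 4 * real K - 2"
        then have "w k * \<bar>ex (x k) - phi_hat \<alpha> Y a h n (x k)\<bar> \<le> w k * (C2 * h * X)"
          by (intro mult_left_mono be) auto
        then show ?thesis using w by (simp add: abs_mult)
      qed simp
    qed
    \<comment> \<open>The weights are nonnegative with sum 1, so the per-node bound passes to the
      sum without a factor \<open>K\<close>.\<close>
    also have "\<dots> = C2 * h * X"
    proof -
      have "poly 1 = (\<lambda>y::real. 1)" by auto
      then have "(\<Sum>k=1..K. w k) = 1"
        using gauss_laguerre_exact[OF gl, of 1] K integral_exp_weight_power[of 0] by simp
      then show ?thesis unfolding sum_distrib_right[symmetric] by simp
    qed
    finally have "\<bar>caputo \<alpha> a Y t - (\<Sum>k=1..K. w k * phi_hat \<alpha> Y a h n (x k))\<bar> \<le> C1 * real K powr (- p) + C2 * h * X"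
      using quad by linarith
    then show "\<bar>caputo \<alpha> a Y (a + real n * (T / real N))
                - (\<Sum>k=1..K. ws K k * phi_hat \<alpha> Y a (T / real N) n (xs K k))\<bar>
              \<le> C1 * real K powr (- p)
                 + C2 * (T / real N) * exp ((1 + qD \<alpha>) / (1 - qD \<alpha>) * (4 * real K + 2))"
      unfolding X_def t_def h_def x_def w_def q_def .
  qed
qed

end
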